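(* Let $\{f_n\}_{n\ge1}$ be a sequence of vector-valued functions $f_n:\mathbb{T}^d\to\mathbb{T}^d$ with a uniform Lipschitz constant, i.e. there is $c>0$ with $|f_n(\mathbf{x})-f_n(\mathbf{y})|\le c|\mathbf{x}-\mathbf{y}|$ for all $n\in\mathbb{N}$ and $\mathbf{x},\mathbf{y}\in\mathbb{T}^d$. Let $T$ be a real, non-singular $d\times d$ matrix, regarded as a transformation of the torus $\mathbb{T}^d$. Suppose that $T$ is diagonal with all eigenvalues $\beta_i>1$, and assume that $1<\beta_1\le\beta_2\le\dots\le\beta_d$. Let $\psi:\mathbb{N}\to\mathbb{R}^+$ and $\tau:=\liminf_{n\to\infty}\frac{-\log\psi(n)}{n}$. Then $$\dim_{\mathrm H}W(T,\psi,\{f_n\})=\min_{1\le i\le d}\left\{\frac{i\log\beta_i-\sum_{j:\beta_j>\beta_ie^{\tau}}(\log\beta_j-\log\beta_i-\tau)+\sum_{j>i}\log\beta_j}{\tau+\log\beta_i}\right\},$$ where the right-hand side is read as $0$ if $\tau=\infty$.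
   Context: $\mathbb{T}^d=\mathbb{R}^d/\mathbb{Z}^d$; $|\cdot|$ denotes the usual metric on $\mathbb{T}$ (distance of the difference to the nearest integer) and also the metric on $\mathbb{T}^d$ induced by the Euclidean metric. A real matrix $T$ acts on $\mathbb{T}^d$ (identified with $[0,1)^d$) by $\mathbf{x}\mapsto T\mathbf{x}\ (\mathrm{mod}\ 1)$ and $T^n$ is the $n$-th iterate of this map. For $\mathbf{y}\in\mathbb{T}^d$ let $L(\mathbf{y},\psi(n))=\{\mathbf{x}\in\mathbb{T}^d:|x_i-y_i|<\psi(n)\text{ for all }1\le i\le d\}$. Define $$W(T,\psi,\{f_n\})=\{\mathbf{x}\in\mathbb{T}^d:T^n(\mathbf{x})\in L(f_n(\mathbf{x}),\psi(n))\text{ for infinitely many }n\in\mathbb{N}\}.$$ $\mathbb{R}^+$ is the set of positive reals and $\dim_{\mathrm H}$ is Hausdorff dimension.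
   Formalization: The formal statement additionally assumes τ + log β_i > 0 for all i (τ > −log β_1); without it the formula can be undefined (τ = −∞, or 0/0) or false (d=2, β=(2,4), ψ(n)=8^n: W is the whole torus, but the minimum is at most 1). *)

theory Defs
  imports "HOL-Analysis.Analysis"
begin

definition circle_dist :: "real \<Rightarrow> real \<Rightarrow> real" where
  "circle_dist s t = \<bar>(s - t) - of_int (round (s - t))\<bar>"

lemma circle_dist_le: "circle_dist s t \<le> \<bar>s - t - of_int k\<bar>"
  unfolding circle_dist_def by (rule round_diff_minimal)

lemma circle_dist_nonneg [simp]: "0 \<le> circle_dist s t"
  by (simp add: circle_dist_def)

lemma circle_dist_commute: "circle_dist s t = circle_dist t s"
proof -
  have "circle_dist s t \<le> circle_dist t s" for s t
    using circle_dist_le[of s t "- round (t - s)"] by (simp add: circle_dist_def)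
  then show ?thesis by (meson antisym)
qed

lemma circle_dist_triangle: "circle_dist s u \<le> circle_dist s t + circle_dist t u"
  using circle_dist_le[of s u "round (s - t) + round (t - u)"]
  by (simp add: circle_dist_def)

lemma circle_dist_eq_0_iff:
  assumes "0 \<le> s" "s < 1" "0 \<le> t" "t < 1"
  shows "circle_dist s t = 0 \<longleftrightarrow> s = t"
proof
  assume "circle_dist s t = 0"
  then have *: "s - t = of_int (round (s - t))" by (simp add: circle_dist_def)
  moreover have "\<bar>s - t\<bar> < 1" using assms by linarith
  ultimately have "\<bar>of_int (round (s - t)) :: real\<bar> < 1" by metis
  then have "round (s - t) = 0" by linarith
  with * show "s = t" by simp
qed (simp add: circle_dist_def)

text \<open>The dimension of the torus is \<open>CARD('n)\<close>; each point is given by its representative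
  in the half-open unit cube.\<close>

typedef ('n::finite) torus = "{x :: real ^ 'n. \<forall>i. 0 \<le> x $ i \<and> x $ i < 1}"
  morphisms torus_rep torus_abs
  by (rule exI[of _ 0]) simp

lemma torus_rep_bounds: "0 \<le> torus_rep x $ i" "torus_rep x $ i < 1"
  using torus_rep[of x] by auto

instantiation torus :: (finite) metric_space
begin

definition dist_torus :: "'a torus \<Rightarrow> 'a torus \<Rightarrow> real" where
  "dist_torus x y = L2_set (\<lambda>i. circle_dist (torus_rep x $ i) (torus_rep y $ i)) UNIV"

definition uniformity_torus :: "('a torus \<times> 'a torus) filter" where
  "uniformity_torus = (INF e\<in>{0 <..}. principal {(x, y). dist x y < e})"

definition open_torus :: "'a torus set \<Rightarrow> bool" where
  "open_torus U = (\<forall>x\<in>U. eventually (\<lambda>(x', y). x' = x \<longrightarrow> y \<in> U) uniformity)"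

instance
proof
  fix x y z :: "'a torus"
  have "dist x y = 0 \<longleftrightarrow> (\<forall>i. torus_rep x $ i = torus_rep y $ i)"
    by (auto simp: dist_torus_def L2_set_eq_0_iff circle_dist_eq_0_iff torus_rep_bounds)
  then show "dist x y = 0 \<longleftrightarrow> x = y"
    by (simp add: torus_rep_inject flip: vec_eq_iff)
  have "dist x y \<le> L2_set (\<lambda>i. circle_dist (torus_rep x $ i) (torus_rep z $ i)
      + circle_dist (torus_rep y $ i) (torus_rep z $ i)) UNIV"
    unfolding dist_torus_def
    by (intro L2_set_mono) (auto intro: order_trans[OF circle_dist_triangle]
          simp: circle_dist_commute[of "torus_rep y $ _"])
  also have "\<dots> \<le> dist x z + dist y z"
    unfolding dist_torus_def by (rule L2_set_triangle_ineq)
  finally show "dist x y \<le> dist x z + dist y z" .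
qed (simp_all add: uniformity_torus_def open_torus_def)

end

text \<open>The distance just defined is the quotient metric: the least Euclidean distance between
  lifts to \<open>\<real>\<^sup>d\<close>.\<close>

lemma dist_torus_le: "dist x y \<le> norm (torus_rep x - torus_rep y - (\<chi> i. of_int (k i)))"
  unfolding dist_torus_def norm_vec_def
  by (intro L2_set_mono) (auto intro: circle_dist_le)

lemma dist_torus_attained:
  "\<exists>k. dist x y = norm (torus_rep x - torus_rep y - (\<chi> i. of_int (k i)))"
  by (rule exI[of _ "\<lambda>i. round (torus_rep x $ i - torus_rep y $ i)"])
    (simp add: dist_torus_def norm_vec_def circle_dist_def)

definition torus_map :: "real ^ 'n ^ 'n \<Rightarrow> 'n::finite torus \<Rightarrow> 'n torus" where
  "torus_map T x = torus_abs (\<chi> i. frac ((T *v torus_rep x) $ i))"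

lemma torus_rep_torus_map: "torus_rep (torus_map T x) = (\<chi> i. frac ((T *v torus_rep x) $ i))"
  unfolding torus_map_def by (rule torus_abs_inverse) (simp add: frac_lt_1)

definition target :: "'n::finite torus \<Rightarrow> real \<Rightarrow> 'n torus set" where
  "target y r = {x. \<forall>i. circle_dist (torus_rep x $ i) (torus_rep y $ i) < r}"

definition shrinking_target_set ::
    "real ^ 'n ^ 'n \<Rightarrow> (nat \<Rightarrow> real) \<Rightarrow> (nat \<Rightarrow> 'n::finite torus \<Rightarrow> 'n torus) \<Rightarrow> 'n torus set" where
  "shrinking_target_set T \<psi> f =
    {x. infinite {n. 1 \<le> n \<and> (torus_map T ^^ n) x \<in> target (f n x) (\<psi> n)}}"

text \<open>\<open>\<beta> 1, \<dots>, \<beta> d\<close> are the eigenvalues of \<open>T\<close> listed with algebraic multiplicity, that is,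
  the roots of the characteristic polynomial.\<close>

definition eigenvalue_list :: "real ^ 'n ^ 'n \<Rightarrow> (nat \<Rightarrow> real) \<Rightarrow> bool" where
  "eigenvalue_list T \<beta> \<longleftrightarrow> (\<forall>t. det (mat t - T) = (\<Prod>i = 1..CARD('n). t - \<beta> i))"

text \<open>\<open>diam(U)\<^sup>s\<close> with the conventions \<open>0\<^sup>0 = 1\<close> for nonempty sets (whereas \<open>0 powr 0 = 0\<close>)
  and value \<open>0\<close> for the empty set.\<close>

definition hausdorff_gauge :: "real \<Rightarrow> 'a::metric_space set \<Rightarrow> real" where
  "hausdorff_gauge s U = (if U = {} then 0 else if s = 0 then 1 else diameter U powr s)"

text \<open>Boundedness of the covering sets is explicit because \<open>diameter\<close> is \<open>0\<close> on unbounded sets.\<close>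

definition hausdorff_premeasure :: "real \<Rightarrow> real \<Rightarrow> 'a::metric_space set \<Rightarrow> ennreal" where
  "hausdorff_premeasure \<delta> s A =
    (INF U \<in> {U :: nat \<Rightarrow> 'a set. A \<subseteq> (\<Union>k. U k) \<and> (\<forall>k. bounded (U k) \<and> diameter (U k) \<le> \<delta>)}.
       \<Sum>k. ennreal (hausdorff_gauge s (U k)))"

definition hausdorff_measure :: "real \<Rightarrow> 'a::metric_space set \<Rightarrow> ennreal" where
  "hausdorff_measure s A = (SUP \<delta> \<in> {0<..}. hausdorff_premeasure \<delta> s A)"

definition hausdorff_dim :: "'a::metric_space set \<Rightarrow> ereal" where
  "hausdorff_dim A = Inf {ereal s | s. 0 \<le> s \<and> hausdorff_measure s A = 0}"

end

theory Submission
  imports Defs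
begin

text \<open>
  Write \<open>l\<^sub>j = ln \<beta>\<^sub>j\<close> and \<open>rate \<tau> x = \<Sum>\<^sub>j (min l\<^sub>j x + max 0 (x - l\<^sub>j - \<tau>))\<close>.  At time \<open>n\<close> the
  set of points that hit their target consists of about \<open>exp (n \<Sum>\<^sub>j l\<^sub>j)\<close> boxes with sides
  \<open>exp (- n (l\<^sub>j + \<tau>))\<close>, one in each product of cylinders of the maps \<open>x \<mapsto> \<beta>\<^sub>j x mod 1\<close>; although
  the target moves with the point, the Lipschitz bound makes it almost constant on a box.  A set of
  diameter \<open>exp (- n x)\<close> carries mass about \<open>exp (- n rate \<tau> x)\<close>, so the dimension is the
  infimum of \<open>rate \<tau> x / x\<close>, attained at one of the points \<open>x = l\<^sub>i + \<tau>\<close>, where the quotient is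
  the \<open>i\<close>-th term of the formula.  The upper bound covers the boxes by sets of diameter
  \<open>exp (- n (l\<^sub>i + \<tau>))\<close>.  For the lower bound, a Cantor set is built along sparse times, using only
  full cylinders, on which the iterate is affine onto \<open>[0, 1)\<close>; there are at least \<open>\<kappa> \<beta>\<^sub>j\<^sup>n\<close> of
  these, and they occur in every interval at a scale comparable to its length up to an exponent
  close to \<open>1\<close>.  For \<open>\<tau> < 0\<close> both sides of the formula are \<open>d\<close>.
\<close>

section \<open>Cylinders of beta-transformations\<close>

text \<open>When \<beta> is not an integer, the last branch of the map is incomplete and the image
  of a cylinder may stop short of the target. Full cylinders avoid this, and they concatenate, so
  the Cantor construction can restart inside each of its boxes. The price is that an interval
  contains a full cylinder only of length comparable to a power \<sigma> > 1 of its own length: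
  targets of exponent \<tau>1 yield boxes of exponent \<tau>2 = \<sigma> \<tau>1. This is harmless
  because the rate is continuous in \<tau>, and both bounds are proved for exponents near \<tau>
  only. In the mass estimate two consecutive levels matter, since the times grow so fast that all
  that was built before time n costs at most exp (\<epsilon> n). The other obstacle is that the
  centre of the target depends on the point and couples the coordinates: below, it is pinned by a
  contraction; above, the Lipschitz term is absorbed into the distance that it bounds.\<close>

definition beta_map :: "real \<Rightarrow> real \<Rightarrow> real" where
  "beta_map \<beta> x = frac (\<beta> * x)"

text \<open>The left end point \<open>a\<close> encodes the cylinder, and fullness is stated through
  the inverse branch \<open>a + v / \<beta> ^ n\<close>, which has to work for every
  \<open>v\<close> in [0, 1). This replaces words of digits.\<close>

definition full :: "real \<Rightarrow> nat \<Rightarrow> real \<Rightarrow> bool" where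
  "full \<beta> n a \<longleftrightarrow> 0 \<le> a \<and> a + 1 / \<beta> ^ n \<le> 1 \<and>
    (\<forall>v. 0 \<le> v \<and> v < 1 \<longrightarrow> (beta_map \<beta> ^^ n) (a + v / \<beta> ^ n) = v)"

lemma fullD:
  assumes "full \<beta> n a"
  shows "0 \<le> a" "a + 1 / \<beta> ^ n \<le> 1"
    and "\<And>v. 0 \<le> v \<Longrightarrow> v < 1 \<Longrightarrow> (beta_map \<beta> ^^ n) (a + v / \<beta> ^ n) = v"
  using assms by (auto simp: full_def)

lemma full_0: "full \<beta> 0 0"
  by (simp add: full_def)

lemma full_less_1: "full \<beta> n a \<Longrightarrow> 0 < \<beta> \<Longrightarrow> a < 1"
  using fullD(2)[of \<beta> n a] by (smt (verit) zero_less_divide_1_iff zero_less_power)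

text \<open>Prepending the digit \<open>i\<close>: the pullback of a full cylinder along branch
  \<open>i\<close> is full as soon as it fits into [0, 1], even if that branch itself is
  incomplete.\<close>

lemma full_Suc:
  assumes "full \<beta> n a" "1 < \<beta>" "(of_int i + (a + 1 / \<beta> ^ n)) / \<beta> \<le> 1" "0 \<le> i"
  shows "full \<beta> (Suc n) ((of_int i + a) / \<beta>)"
  unfolding full_def
proof (intro conjI allI impI)
  have b: "\<beta> > 0" using assms by simp
  show "0 \<le> (of_int i + a) / \<beta>" using assms fullD(1)[OF assms(1)] by auto
  have "(of_int i + a) / \<beta> + 1 / \<beta> ^ Suc n = (of_int i + (a + 1 / \<beta> ^ n)) / \<beta>"
    using b by (simp add: field_simps)
  then show "(of_int i + a) / \<beta> + 1 / \<beta> ^ Suc n \<le> 1" using assms(3) by simp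
  fix v :: real assume v: "0 \<le> v \<and> v < 1"
  have pw: "0 < \<beta> ^ n" using b by simp
  have "\<beta> * ((of_int i + a) / \<beta> + v / \<beta> ^ Suc n) = of_int i + (a + v / \<beta> ^ n)"
    using b by (simp add: field_simps)
  moreover have "v / \<beta> ^ n < 1 / \<beta> ^ n" using v pw by (intro divide_strict_right_mono) auto
  then have "a + v / \<beta> ^ n < 1" using fullD(2)[OF assms(1)] by linarith
  moreover have "0 \<le> a + v / \<beta> ^ n" using fullD(1)[OF assms(1)] v pw by auto
  ultimately have "beta_map \<beta> ((of_int i + a) / \<beta> + v / \<beta> ^ Suc n) = a + v / \<beta> ^ n"
    unfolding beta_map_def by (simp add: frac_unique_iff)
  then show "(beta_map \<beta> ^^ Suc n) ((of_int i + a) / \<beta> + v / \<beta> ^ Suc n) = v"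
    using fullD(3)[OF assms(1)] v by (simp add: funpow_Suc_right del: funpow.simps)
qed

text \<open>Concatenation: the second cylinder is rescaled into the first one, on which the iterate
  of order \<open>n\<close> is affine onto [0, 1).\<close>

lemma full_add:
  assumes "full \<beta> n a" "full \<beta> m b" "1 < \<beta>"
  shows "full \<beta> (n + m) (a + b / \<beta> ^ n)"
  unfolding full_def
proof (intro conjI allI impI)
  have pn: "0 < \<beta> ^ n" and pm: "0 < \<beta> ^ m" using assms by auto
  show "0 \<le> a + b / \<beta> ^ n" using assms fullD(1) pn by auto
  have "(b + 1 / \<beta> ^ m) / \<beta> ^ n \<le> 1 / \<beta> ^ n"
    using fullD(2)[OF assms(2)] pn by (intro divide_right_mono) auto
  then show "a + b / \<beta> ^ n + 1 / \<beta> ^ (n + m) \<le> 1"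
    using fullD(2)[OF assms(1)] by (simp add: add_divide_distrib power_add mult.commute)
  fix v :: real assume v: "0 \<le> v \<and> v < 1"
  have "v / \<beta> ^ m < 1 / \<beta> ^ m" using v pm by (intro divide_strict_right_mono) auto
  then have 1: "b + v / \<beta> ^ m < 1" using fullD(2)[OF assms(2)] by linarith
  have 2: "0 \<le> b + v / \<beta> ^ m" using fullD(1)[OF assms(2)] v pm by auto
  have "a + b / \<beta> ^ n + v / \<beta> ^ (n + m) = a + (b + v / \<beta> ^ m) / \<beta> ^ n"
    by (simp add: add_divide_distrib power_add mult.commute)
  then have "(beta_map \<beta> ^^ n) (a + b / \<beta> ^ n + v / \<beta> ^ (n + m)) = b + v / \<beta> ^ m"
    using fullD(3)[OF assms(1) 2 1] by presburger
  then show "(beta_map \<beta> ^^ (n + m)) (a + b / \<beta> ^ n + v / \<beta> ^ (n + m)) = v"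
    using fullD(3)[OF assms(2)] v by (simp add: add.commute[of n m] funpow_add)
qed

lemma full_zero: "1 < \<beta> \<Longrightarrow> full \<beta> n 0"
proof (induction n)
  case (Suc n)
  have "1 / \<beta> ^ n / \<beta> \<le> 1"
    using Suc.prems one_le_power[of \<beta> "Suc n"] by (simp add: field_simps)
  then show ?case using full_Suc[of \<beta> n 0 0] Suc by simp
qed (simp add: full_0)

text \<open>Appending the cylinder at 0 shortens a cylinder and keeps its left end point; this
  brings cylinders of different orders to a common one.\<close>

lemma full_pad: "full \<beta> n a \<Longrightarrow> 1 < \<beta> \<Longrightarrow> n \<le> m \<Longrightarrow> full \<beta> m a"
  using full_add[of \<beta> n a "m - n" 0] full_zero[of \<beta> "m - n"] by simp

text \<open>The iterate of order \<open>n\<close> vanishes at \<open>b\<close>, but at an interior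
  point of the cylinder of \<open>a\<close> it is the rescaled distance to \<open>a\<close>, which
  is positive.\<close>

lemma full_separated:
  assumes "full \<beta> n a" "full \<beta> n b" "1 < \<beta>" "a < b"
  shows "1 / \<beta> ^ n \<le> b - a"
proof (rule ccontr)
  assume "\<not> ?thesis"
  then have "(b - a) * \<beta> ^ n < 1" using assms by (simp add: field_simps)
  moreover have "0 \<le> (b - a) * \<beta> ^ n" using assms by auto
  ultimately have "(beta_map \<beta> ^^ n) (a + ((b - a) * \<beta> ^ n) / \<beta> ^ n) = (b - a) * \<beta> ^ n"
    using fullD(3)[OF assms(1)] by blast
  moreover have "(beta_map \<beta> ^^ n) (b + 0 / \<beta> ^ n) = 0"
    by (rule fullD(3)[OF assms(2)]) auto
  moreover have "a + ((b - a) * \<beta> ^ n) / \<beta> ^ n = b + 0 / \<beta> ^ n" using assms by simp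
  ultimately have "(b - a) * \<beta> ^ n = 0" by simp
  then show False using assms by simp
qed

section \<open>Counting full cylinders from below and branches from above\<close>

lemma separated_card:
  fixes S :: "real set"
  assumes S: "S \<subseteq> {u..u + L}" and l: "0 < l" and sep: "\<And>a b. a \<in> S \<Longrightarrow> b \<in> S \<Longrightarrow> a < b \<Longrightarrow> l \<le> b - a"
  shows "finite S" "0 \<le> L \<Longrightarrow> real (card S) \<le> L / l + 1"
proof -
  define g where "g = (\<lambda>a. nat \<lfloor>(a - u) / l\<rfloor>)"
  have "g a \<noteq> g b" if "a \<in> S" "b \<in> S" "a < b" for a b
  proof -
    have "(a - u) / l + 1 \<le> (b - u) / l"
      using divide_right_mono[OF sep[OF that], of l] l by (simp add: diff_divide_distrib)
    then have "\<lfloor>(a - u) / l\<rfloor> + 1 \<le> \<lfloor>(b - u) / l\<rfloor>" by linarith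
    moreover have "0 \<le> \<lfloor>(a - u) / l\<rfloor>" using that S l by auto
    ultimately show ?thesis unfolding g_def by linarith
  qed
  then have inj: "inj_on g S" by (metis inj_onI linorder_neqE_linordered_idom)
  have sub: "g ` S \<subseteq> {..nat \<lfloor>L / l\<rfloor>}"
  proof
    fix k assume "k \<in> g ` S"
    then obtain a where a: "a \<in> S" "k = g a" by auto
    have "a - u \<le> L" using a S by auto
    then have "(a - u) / l \<le> L / l" using l by (intro divide_right_mono) auto
    then show "k \<in> {..nat \<lfloor>L / l\<rfloor>}" using a by (auto simp: g_def intro!: nat_mono floor_mono)
  qed
  show "finite S" using inj sub finite_imageD finite_subset by blast
  assume L: "0 \<le> L"
  have "card S \<le> card {..nat \<lfloor>L / l\<rfloor>}" using inj sub card_inj_on_le by blast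
  then have "card S \<le> nat \<lfloor>L / l\<rfloor> + 1" by simp
  also have "real \<dots> \<le> L / l + 1" using L l by simp
  finally show "real (card S) \<le> L / l + 1" by linarith
qed

text \<open>The cap \<open>t\<close> is there for the induction on \<open>n\<close>: the incomplete
  branch over [0, t) has image \<open>[0, frac (\<beta> t))\<close>, so caps other than 1 arise even
  when the start is 1.\<close>

definition fulls :: "real \<Rightarrow> nat \<Rightarrow> real \<Rightarrow> real set" where
  "fulls \<beta> n t = {a. full \<beta> n a \<and> a + 1 / \<beta> ^ n \<le> t}"

lemma finite_full: "1 < \<beta> \<Longrightarrow> finite {a. full \<beta> n a}"
  by (rule separated_card[of _ 0 1 "1 / \<beta> ^ n"])
    (use full_separated fullD(1) full_less_1 in \<open>force simp: less_imp_le\<close>)+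

lemma finite_fulls: "1 < \<beta> \<Longrightarrow> finite (fulls \<beta> n t)"
  using finite_full by (rule finite_subset[rotated]) (auto simp: fulls_def)

lemma inj_digit:
  assumes "0 < (\<beta>::real)" 
  shows "inj_on (\<lambda>(i::int, a). (of_int i + a) / \<beta>) (UNIV \<times> {0..<1})"
proof (rule inj_onI)
  fix x y :: "int \<times> real"
  assume xy: "x \<in> UNIV \<times> {0..<1}" "y \<in> UNIV \<times> {0..<1}"
    "(\<lambda>(i, a). (of_int i + a) / \<beta>) x = (\<lambda>(i, a). (of_int i + a) / \<beta>) y"
  obtain i a j b where x: "x = (i, a)" and y: "y = (j, b)" by fastforce
  with xy have *: "0 \<le> a" "a < 1" "0 \<le> b" "b < 1" "(of_int i + a) / \<beta> = (of_int j + b) / \<beta>"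
    by auto
  then have eq: "of_int i + a = of_int j + b" using assms by (simp add: field_simps)
  then have "\<bar>of_int (i - j) :: real\<bar> < 1" using * by (simp add: abs_if)
  then have "i = j" by linarith
  then show "x = y" using eq x y by simp
qed

lemma card_fulls_Suc:
  assumes "1 < \<beta>" "0 \<le> t" "t \<le> 1"
  shows "nat \<lfloor>\<beta> * t\<rfloor> * card (fulls \<beta> n 1) + card (fulls \<beta> n (frac (\<beta> * t)))
    \<le> card (fulls \<beta> (Suc n) t)"
proof -
  let ?P = "{0..<\<lfloor>\<beta> * t\<rfloor>} \<times> fulls \<beta> n 1" and ?Q = "{\<lfloor>\<beta> * t\<rfloor>} \<times> fulls \<beta> n (frac (\<beta> * t))"
  let ?g = "\<lambda>(i::int, a). (of_int i + a) / \<beta>"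
  have b: "\<beta> > 0" using assms by simp
  have range: "a \<in> {0..<1}" if "a \<in> fulls \<beta> n s" for a s
    using that b by (auto simp: fulls_def full_less_1 dest: fullD(1))
  have inj: "inj_on ?g (?P \<union> ?Q)"
    by (rule inj_on_subset[OF inj_digit[OF b]]) (use range in auto)
  have "?g ` (?P \<union> ?Q) \<subseteq> fulls \<beta> (Suc n) t"
  proof clarify
    fix i a assume ia: "(i, a) \<in> ?P \<union> ?Q"
    have f: "full \<beta> n a" and i0: "0 \<le> i" using ia assms by (auto simp: fulls_def)
    have *: "of_int i + (a + 1 / \<beta> ^ n) \<le> \<beta> * t"
    proof (cases "i < \<lfloor>\<beta> * t\<rfloor>")
      case True
      then have "of_int i + 1 \<le> \<beta> * t" by linarith
      then show ?thesis using fullD(2)[OF f] by linarith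
    next
      case False
      then have "i = \<lfloor>\<beta> * t\<rfloor>" "a + 1 / \<beta> ^ n \<le> frac (\<beta> * t)"
        using ia by (auto simp: fulls_def)
      then show ?thesis by (simp add: frac_def)
    qed
    then have **: "(of_int i + (a + 1 / \<beta> ^ n)) / \<beta> \<le> t" using b by (simp add: field_simps)
    then have "full \<beta> (Suc n) ((of_int i + a) / \<beta>)"
      using full_Suc[OF f assms(1) _ i0] assms by linarith
    moreover have "(of_int i + a) / \<beta> + 1 / \<beta> ^ Suc n \<le> t"
      using ** b by (simp add: add_divide_distrib add.assoc mult.commute)
    ultimately show "(of_int i + a) / \<beta> \<in> fulls \<beta> (Suc n) t" by (simp add: fulls_def)
  qed
  then have "card (?g ` (?P \<union> ?Q)) \<le> card (fulls \<beta> (Suc n) t)"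
    using finite_fulls assms by (intro card_mono) auto
  moreover have "card (?g ` (?P \<union> ?Q)) = card (?P \<union> ?Q)" by (rule card_image[OF inj])
  moreover have "card (?P \<union> ?Q) = card ?P + card ?Q"
    using finite_fulls assms by (intro card_Un_disjoint) auto
  ultimately show ?thesis by (simp add: card_cartesian_product)
qed

text \<open>Splitting \<open>[0, t)\<close> into full branches and one incomplete branch with image \<open>[0, frac (\<beta> t))\<close>
  loses at most one cylinder per step, and nothing before the last branch when \<open>t = 1\<close>; hence the
  convergent product of the factors \<open>1 - \<beta>\<^sup>-\<^sup>i\<close>.\<close>

lemma card_fulls_lower:
  assumes "1 < \<beta>"
  defines "k \<equiv> \<lambda>n. \<Prod>i<n. 1 - (1 / \<beta>) ^ Suc i"
  shows "k n * \<beta> ^ n \<le> real (card (fulls \<beta> n 1))"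
    and "0 \<le> t \<Longrightarrow> t \<le> 1 \<Longrightarrow> k n * (\<beta> ^ n * t - 1) \<le> real (card (fulls \<beta> n t))"
proof -
  have k0: "0 \<le> k n" for n
    unfolding k_def using assms by (intro prod_nonneg) (auto simp: power_le_one_iff simp del: power_Suc)
  have "k n * \<beta> ^ n \<le> real (card (fulls \<beta> n 1)) \<and>
    (\<forall>t. 0 \<le> t \<and> t \<le> 1 \<longrightarrow> k n * (\<beta> ^ n * t - 1) \<le> real (card (fulls \<beta> n t)))"
  proof (induction n)
    case 0
    have "fulls \<beta> 0 1 = {0}" by (auto simp: fulls_def full_0 dest: fullD(1,2))
    then show ?case by (auto simp: k_def)
  next
    case (Suc n)
    have step: "k n * (\<beta> ^ Suc n * t - 1) \<le> real (card (fulls \<beta> (Suc n) t))"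
      if t: "0 \<le> t" "t \<le> 1" for t
    proof -
      have fl: "real (nat \<lfloor>\<beta> * t\<rfloor>) = \<beta> * t - frac (\<beta> * t)"
        using t assms by (simp add: frac_def)
      have "k n * (\<beta> ^ Suc n * t - 1) =
          (\<beta> * t - frac (\<beta> * t)) * (k n * \<beta> ^ n) + k n * (\<beta> ^ n * frac (\<beta> * t) - 1)"
        by (simp add: algebra_simps)
      also have "\<dots> \<le> real (nat \<lfloor>\<beta> * t\<rfloor>) * real (card (fulls \<beta> n 1))
          + real (card (fulls \<beta> n (frac (\<beta> * t))))"
        unfolding fl[symmetric] using Suc.IH
        by (intro add_mono mult_left_mono) (auto simp: frac_lt_1 less_imp_le)
      also have "\<dots> \<le> real (card (fulls \<beta> (Suc n) t))"
        using card_fulls_Suc[OF assms(1) t, of n] by (metis of_nat_add of_nat_le_iff of_nat_mult)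
      finally show ?thesis .
    qed
    have "k (Suc n) = k n * (1 - 1 / \<beta> ^ Suc n)"
      by (simp add: k_def power_divide)
    \<comment> \<open>The new factor of \<open>k\<close> is exactly what turns the loss of one
      cylinder at t = 1 into a bound with no subtracted term, ready for the next step.\<close>
    then have eq: "k (Suc n) * \<beta> ^ Suc n = k n * (\<beta> ^ Suc n * 1 - 1)"
      using assms by (simp add: field_simps)
    have le: "k (Suc n) \<le> k n"
      using k0[of n] assms by (simp add: k_def mult_left_le)
    have "k (Suc n) * (\<beta> ^ Suc n * t - 1) \<le> real (card (fulls \<beta> (Suc n) t))"
      if t: "0 \<le> t" "t \<le> 1" for t
    proof (cases "\<beta> ^ Suc n * t - 1 \<ge> 0")
      case True
      then have "k (Suc n) * (\<beta> ^ Suc n * t - 1) \<le> k n * (\<beta> ^ Suc n * t - 1)"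
        using le by (intro mult_right_mono)
      then show ?thesis using step[OF t] by linarith
    next
      case False
      then have "k (Suc n) * (\<beta> ^ Suc n * t - 1) \<le> 0" using k0[of "Suc n"]
        by (intro mult_nonneg_nonpos) auto
      then show ?thesis by linarith
    qed
    moreover have "k (Suc n) * \<beta> ^ Suc n \<le> real (card (fulls \<beta> (Suc n) 1))"
      unfolding eq by (rule step) auto
    ultimately show ?case by blast
  qed
  then show "k n * \<beta> ^ n \<le> real (card (fulls \<beta> n 1))"
    and "0 \<le> t \<Longrightarrow> t \<le> 1 \<Longrightarrow> k n * (\<beta> ^ n * t - 1) \<le> real (card (fulls \<beta> n t))"
    by auto
qed

lemma card_full_ge:
  assumes "1 < \<beta>"
  obtains \<kappa> where "0 < \<kappa>" "\<And>n. \<kappa> * \<beta> ^ n \<le> real (card {a. full \<beta> n a})"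
proof -
  define q where "q = 1 / \<beta>"
  have q: "0 < q" "q < 1" using assms by (auto simp: q_def)
  \<comment> \<open>From 1 - y >= exp (- y / (1 - y)) and y <= q the product is at least the
    exponential of minus the geometric sum, itself at most q / (1 - q), divided once more by 1 -
    q.\<close>
  define \<kappa> where "\<kappa> = exp (- (q / (1 - q)\<^sup>2))"
  have "\<kappa> \<le> (\<Prod>i<n. 1 - q ^ Suc i)" for n
  proof -
    have 1: "exp (- (q ^ Suc i / (1 - q))) \<le> 1 - q ^ Suc i" for i
    proof -
      define y where "y = q ^ Suc i"
      have y: "0 < y" "y \<le> q" using q power_le_one[of q i] by (auto simp: y_def mult_left_le)
      have "1 / (1 - y) = 1 + y / (1 - y)" using y q by (simp add: field_simps)
      also have "\<dots> \<le> exp (y / (1 - y))" by (rule exp_ge_add_one_self)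
      also have "\<dots> \<le> exp (y / (1 - q))" using y q by (auto intro: divide_left_mono)
      finally have *: "1 / (1 - y) \<le> exp (y / (1 - q))" .
      have "1 / exp (y / (1 - q)) \<le> 1 - y"
        using * y q by (simp add: pos_divide_le_eq mult.commute)
      then show ?thesis unfolding y_def[symmetric] exp_minus by (simp add: inverse_eq_divide)
    qed
    have "(\<Sum>i<n. q ^ Suc i) \<le> q / (1 - q)"
    proof -
      have "(\<Sum>i<n. q ^ Suc i) = q * (\<Sum>i<n. q ^ i)" by (simp add: sum_distrib_left)
      also have "(\<Sum>i<n. q ^ i) = (1 - q ^ n) / (1 - q)" using q by (simp add: sum_gp_strict)
      also have "\<dots> \<le> 1 / (1 - q)" using q by (intro divide_right_mono) auto
      finally show ?thesis using q by (simp add: field_simps)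
    qed
    then have "(\<Sum>i<n. q ^ Suc i) / (1 - q) \<le> q / (1 - q) / (1 - q)" 
      using q by (intro divide_right_mono) auto
    then have "\<kappa> \<le> exp (- (\<Sum>i<n. q ^ Suc i) / (1 - q))"
      unfolding \<kappa>_def by (simp add: power2_eq_square del: power_Suc)
    also have "\<dots> = (\<Prod>i<n. exp (- (q ^ Suc i / (1 - q))))"
      by (simp add: exp_sum[symmetric] sum_negf sum_divide_distrib del: power_Suc)
    also have "\<dots> \<le> (\<Prod>i<n. 1 - q ^ Suc i)" by (intro prod_mono) (use 1 in auto)
    finally show ?thesis .
  qed
  moreover have "fulls \<beta> n 1 = {a. full \<beta> n a}" for n
    by (auto simp: fulls_def dest: fullD(2))
  moreover have "(\<Prod>i<n. 1 - q ^ Suc i) * \<beta> ^ n \<le> real (card (fulls \<beta> n 1))" for n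
    unfolding q_def by (rule card_fulls_lower(1)[OF assms])
  moreover have "0 \<le> \<beta> ^ n" for n using assms by simp
  ultimately have "\<kappa> * \<beta> ^ n \<le> real (card {a. full \<beta> n a})" for n
    by (metis mult_right_mono order_trans)
  moreover have "0 < \<kappa>" by (simp add: \<kappa>_def)
  ultimately show ?thesis by (rule that[rotated])
qed

text \<open>On each branch of the iterate the function below is constant, so its values label the
  branches.\<close>

definition branch :: "real \<Rightarrow> nat \<Rightarrow> real \<Rightarrow> real" where
  "branch \<beta> n x = \<beta> ^ n * x - (beta_map \<beta> ^^ n) x"

lemma branch_Suc: "branch \<beta> (Suc n) x = \<beta> ^ n * of_int \<lfloor>\<beta> * x\<rfloor> + branch \<beta> n (beta_map \<beta> x)"
  by (simp add: branch_def beta_map_def frac_def funpow_Suc_right algebra_simps del: funpow.simps)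

lemma beta_map_range: "0 \<le> beta_map \<beta> x" "beta_map \<beta> x < 1"
  by (auto simp: beta_map_def frac_lt_1)

lemma funpow_beta_map_range:
  assumes "0 \<le> x" "x < 1"
  shows "0 \<le> (beta_map \<beta> ^^ n) x" "(beta_map \<beta> ^^ n) x < 1"
  using assms beta_map_range by (induction n) auto

text \<open>Splitting by the first digit again. The surplus 1 of each complete branch adds up to at
  most \<beta> t, which is the next term of the geometric sum; the incomplete branch supplies the
  final 1.\<close>

lemma card_branch_le:
  assumes b: "1 < \<beta>" and "0 \<le> t" "t \<le> 1"
  shows "finite (branch \<beta> n ` {0..<t}) \<and>
    real (card (branch \<beta> n ` {0..<t})) \<le> \<beta> ^ n * t * (\<Sum>i<n. (1 / \<beta>) ^ i) + 1"
  using assms(2,3)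
proof (induction n arbitrary: t)
  case 0
  have "branch \<beta> 0 ` {0..<t} \<subseteq> {0}" by (auto simp: branch_def)
  moreover from card_mono[OF _ this] have "card (branch \<beta> 0 ` {0..<t}) \<le> 1" by simp
  ultimately show ?case by (auto intro: finite_subset)
next
  case (Suc n)
  let ?K = "\<Sum>i<n. (1 / \<beta>) ^ i"
  let ?C = "\<lambda>t. branch \<beta> n ` {0..<t}"
  let ?A = "(\<lambda>(i, c). \<beta> ^ n * of_int i + c) ` ({0..<\<lfloor>\<beta> * t\<rfloor>} \<times> ?C 1)"
  let ?B = "(\<lambda>c. \<beta> ^ n * of_int \<lfloor>\<beta> * t\<rfloor> + c) ` ?C (frac (\<beta> * t))"
  have fin: "finite ?A" "finite ?B" using Suc.IH by (auto simp: frac_lt_1 less_imp_le)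
  have sub: "branch \<beta> (Suc n) ` {0..<t} \<subseteq> ?A \<union> ?B"
  proof clarify
    fix x assume x: "x \<in> {0..<t}" and nB: "branch \<beta> (Suc n) x \<notin> ?B"
    have lt: "\<beta> * x < \<beta> * t" using x b by auto
    have m: "beta_map \<beta> x \<in> {0..<1}" using beta_map_range by auto
    have "\<lfloor>\<beta> * x\<rfloor> \<noteq> \<lfloor>\<beta> * t\<rfloor>"
    proof
      assume *: "\<lfloor>\<beta> * x\<rfloor> = \<lfloor>\<beta> * t\<rfloor>"
      then have "beta_map \<beta> x < frac (\<beta> * t)" using lt by (simp add: beta_map_def frac_def)
      then have "branch \<beta> (Suc n) x \<in> ?B"
        using m unfolding branch_Suc * by auto
      then show False using nB by simp
    qed
    moreover have "\<lfloor>\<beta> * x\<rfloor> \<le> \<lfloor>\<beta> * t\<rfloor>" using lt by (intro floor_mono) simp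
    moreover have "0 \<le> \<lfloor>\<beta> * x\<rfloor>" using x b by auto
    ultimately have "(\<lfloor>\<beta> * x\<rfloor>, branch \<beta> n (beta_map \<beta> x)) \<in> {0..<\<lfloor>\<beta> * t\<rfloor>} \<times> ?C 1"
      using m by auto
    from imageI[OF this, of "\<lambda>(i, c). \<beta> ^ n * of_int i + c"]
    show "branch \<beta> (Suc n) x \<in> ?A" unfolding branch_Suc by simp
  qed
  have t0: "0 \<le> \<beta> * t" using b Suc.prems by simp
  have "card (branch \<beta> (Suc n) ` {0..<t}) \<le> card (?A \<union> ?B)"
    using fin sub by (intro card_mono) auto
  also have "\<dots> \<le> card ?A + card ?B" by (rule card_Un_le)
  also have "\<dots> \<le> nat \<lfloor>\<beta> * t\<rfloor> * card (?C 1) + card (?C (frac (\<beta> * t)))"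
  proof (intro add_mono)
    show "card ?A \<le> nat \<lfloor>\<beta> * t\<rfloor> * card (?C 1)"
      using card_image_le[of "{0..<\<lfloor>\<beta> * t\<rfloor>} \<times> ?C 1"] Suc.IH[of 1]
      by (simp add: card_cartesian_product)
    show "card ?B \<le> card (?C (frac (\<beta> * t)))"
      using Suc.IH[of "frac (\<beta> * t)"] by (intro card_image_le) (simp add: frac_lt_1 less_imp_le)
  qed
  finally have "real (card (branch \<beta> (Suc n) ` {0..<t})) \<le>
      real (nat \<lfloor>\<beta> * t\<rfloor> * card (?C 1) + card (?C (frac (\<beta> * t))))"
    by (simp only: of_nat_le_iff)
  also have "\<dots> = of_int \<lfloor>\<beta> * t\<rfloor> * real (card (?C 1)) + real (card (?C (frac (\<beta> * t))))"
    using t0 by simp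
  also have "\<dots> \<le> of_int \<lfloor>\<beta> * t\<rfloor> * (\<beta> ^ n * 1 * ?K + 1) + (\<beta> ^ n * frac (\<beta> * t) * ?K + 1)"
    using Suc.IH[of 1] Suc.IH[of "frac (\<beta> * t)"] t0
    by (intro add_mono mult_left_mono) (auto simp: frac_lt_1 less_imp_le)
  also have "\<dots> = \<beta> ^ Suc n * t * ?K + of_int \<lfloor>\<beta> * t\<rfloor> + 1"
    by (simp add: frac_def algebra_simps)
  also have "\<dots> \<le> \<beta> ^ Suc n * t * ?K + \<beta> * t + 1" by simp
  also have "\<dots> = \<beta> ^ Suc n * t * (\<Sum>i<Suc n. (1 / \<beta>) ^ i) + 1"
    using b by (simp add: power_divide field_simps)
  finally show ?case using finite_subset[OF sub] fin by auto
qed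

lemma card_branch:
  assumes "1 < \<beta>"
  shows "finite (branch \<beta> n ` {0..<1})"
    and "real (card (branch \<beta> n ` {0..<1})) \<le> (\<beta> / (\<beta> - 1) + 1) * \<beta> ^ n"
proof -
  show "finite (branch \<beta> n ` {0..<1})" using card_branch_le[OF assms, of 1 n] by auto
  have "(\<Sum>i<n. (1 / \<beta>) ^ i) = (1 - (1 / \<beta>) ^ n) / (1 - 1 / \<beta>)" using assms by (simp add: sum_gp_strict)
  also have "\<dots> \<le> 1 / (1 - 1 / \<beta>)" using assms by (intro divide_right_mono) auto
  also have "\<dots> = \<beta> / (\<beta> - 1)" using assms by (simp add: field_simps)
  finally have "\<beta> ^ n * 1 * (\<Sum>i<n. (1 / \<beta>) ^ i) + 1 \<le> \<beta> ^ n * 1 * (\<beta> / (\<beta> - 1)) + \<beta> ^ n"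
    using assms by (intro add_mono mult_left_mono) auto
  then show "real (card (branch \<beta> n ` {0..<1})) \<le> (\<beta> / (\<beta> - 1) + 1) * \<beta> ^ n"
    using card_branch_le[OF assms, of 1 n] by (simp add: algebra_simps)
qed

section \<open>Full cylinders inside short intervals and near a point\<close>

lemma power_between:
  assumes "1 < (\<beta>::real)" "0 < r" "r \<le> 1"
  obtains n where "1 / \<beta> ^ n \<le> r" "r / \<beta> < 1 / \<beta> ^ n"
proof -
  define n where "n = (LEAST n. 1 / r \<le> \<beta> ^ n)"
  have ex: "\<exists>n. 1 / r \<le> \<beta> ^ n"
    using real_arch_pow[OF assms(1), of "1 / r"] less_imp_le by blast
  have 1: "1 / r \<le> \<beta> ^ n" unfolding n_def by (rule LeastI_ex[OF ex])
  have 2: "\<beta> ^ n < \<beta> / r"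
  proof (cases n)
    case 0
    have "1 < \<beta> / r" using assms by (simp add: field_simps)
    then show ?thesis using 0 by simp
  next
    case (Suc m)
    then have "\<beta> ^ m < 1 / r" using not_less_Least[of m "\<lambda>n. 1 / r \<le> \<beta> ^ n"] n_def
      by (metis lessI not_le)
    then have "\<beta> * \<beta> ^ m < \<beta> * (1 / r)" using assms by (intro mult_strict_left_mono) auto
    then show ?thesis using Suc by simp
  qed
  have p: "0 < \<beta> ^ n" using assms by simp
  show ?thesis
  proof (rule that[of n])
    show "1 / \<beta> ^ n \<le> r" using 1 p assms by (simp add: field_simps)
    show "r / \<beta> < 1 / \<beta> ^ n" using 2 p assms by (simp add: field_simps)
  qed
qed

text \<open>Iterate an interval until its image contains an integer \<open>k\<close> in its interior.  If the part to the
  right of \<open>k\<close> is not negligible, then it contains a full cylinder with left end point \<open>k\<close>; otherwise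
  continue with the part to the left, which is still longer by the factor \<open>\<gamma> = \<beta>\<^sup>1\<^sup>/\<^sup>\<sigma> > 1\<close>.\<close>

lemma full_in_interval_aux:
  assumes b: "1 < \<beta>" and \<sigma>: "1 < \<sigma>"
  defines "\<gamma> \<equiv> \<beta> powr (1 / \<sigma>)"
  defines "c \<equiv> (1 - \<gamma> / \<beta>) / \<beta>"
  assumes "0 \<le> u" "u < v" "v \<le> 1" "1 / \<gamma> ^ N < v - u"
  shows "\<exists>n a. full \<beta> n a \<and> u \<le> a \<and> a + 1 / \<beta> ^ n \<le> v \<and> c * (v - u) powr \<sigma> \<le> 1 / \<beta> ^ n"
  using assms(5-8)
proof (induction N arbitrary: u v)
  \<comment> \<open>\<open>N\<close> bounds the number of enlargements by \<gamma>. For N = 0 the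
    interval would be longer than [0, 1].\<close>
  case 0
  then show ?case by simp
next
  case (Suc N)
  have \<gamma>: "1 < \<gamma>" "\<gamma> < \<beta>"
  proof -
    show "1 < \<gamma>" using b \<sigma> by (simp add: \<gamma>_def)
    have "\<beta> powr (1 / \<sigma>) < \<beta> powr 1" using b \<sigma> by (intro powr_less_mono) auto
    then show "\<gamma> < \<beta>" using b by (simp add: \<gamma>_def)
  qed
  have \<gamma>\<sigma>: "\<gamma> powr \<sigma> = \<beta>" using b \<sigma> by (simp add: \<gamma>_def powr_powr)
  define w where "w = v - u"
  have w: "0 < w" "w \<le> 1" using Suc.prems by (auto simp: w_def)
  have c: "0 < c" "c \<le> 1 / \<beta>" using \<gamma> b by (auto simp: c_def field_simps)
  have wpow: "w powr \<sigma> \<le> w" 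
    using powr_mono'[of 1 \<sigma> w] w \<sigma> by simp
  define p q where "p = \<beta> * u" and "q = \<beta> * v"
  have pq: "0 \<le> p" "p < q" "q - p = \<beta> * w" "q \<le> \<beta>"
    using Suc.prems b by (auto simp: p_def q_def w_def algebra_simps)
  have \<gamma>w: "1 / \<gamma> ^ N < \<gamma> * w"
    using Suc.prems(4) \<gamma> unfolding w_def by (simp add: field_simps)
  have recurse: ?case if i: "0 \<le> i" "of_int i \<le> p" "p \<le> u'" "u' < v'" "v' \<le> q" "v' \<le> of_int i + 1"
      and len: "\<gamma> * w \<le> v' - u'" for i :: int and u' v'
  proof -
    have "\<exists>n a. full \<beta> n a \<and> u' - i \<le> a \<and> a + 1 / \<beta> ^ n \<le> v' - i
      \<and> c * ((v' - i) - (u' - i)) powr \<sigma> \<le> 1 / \<beta> ^ n"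
      by (rule Suc.IH) (use i len \<gamma>w in auto)
    then obtain n a where n: "full \<beta> n a" "u' - i \<le> a" "a + 1 / \<beta> ^ n \<le> v' - i"
      "c * (v' - u') powr \<sigma> \<le> 1 / \<beta> ^ n" by auto
    have eq: "(i + a) / \<beta> + 1 / \<beta> ^ Suc n = (i + (a + 1 / \<beta> ^ n)) / \<beta>"
      using b by (simp add: field_simps)
    have v: "(i + (a + 1 / \<beta> ^ n)) / \<beta> \<le> v"
      using n(3) i b by (simp add: pos_divide_le_eq q_def mult.commute)
    have "full \<beta> (Suc n) ((i + a) / \<beta>)"
      using n(1) b order_trans[OF v Suc.prems(3)] i(1) by (rule full_Suc)
    moreover have "u \<le> (i + a) / \<beta>"
      using n(2) i b by (simp add: pos_le_divide_eq p_def mult.commute)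
    moreover have "c * (v - u) powr \<sigma> \<le> 1 / \<beta> ^ Suc n"
    proof -
      \<comment> \<open>The reason for \<gamma>: enlarging the length by \<gamma> multiplies its
        \<sigma>-th power by \<beta>, which pays for the additional order of the cylinder.\<close>
      have "c * (v - u) powr \<sigma> * \<beta> = c * (\<gamma> * w) powr \<sigma>"
        using \<gamma> w by (simp add: powr_mult \<gamma>\<sigma> w_def)
      also have "\<dots> \<le> c * (v' - u') powr \<sigma>"
        using len c w \<gamma> \<sigma> by (intro mult_left_mono powr_mono2) auto
      also have "\<dots> \<le> 1 / \<beta> ^ n" by (rule n)
      finally show ?thesis using b by (simp add: field_simps)
    qed
    ultimately show ?thesis using eq v by (intro exI[of _ "Suc n"] exI[of _ "(i + a) / \<beta>"]) simp
  qed
  define i where "i = \<lfloor>p\<rfloor>"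
  have i: "of_int i \<le> p" "p < of_int i + 1" "0 \<le> i" using pq(1) by (auto simp: i_def)
  show ?case
  proof (cases "q \<le> of_int i + 1")
    case True
    show ?thesis
      by (rule recurse[of i p q]) (use i pq True \<gamma> w in auto)
  next
    case F1: False
    show ?thesis
    \<comment> \<open>The threshold divides the image length \<beta> w into (\<beta> - \<gamma>) w
      to the right of the integer and \<gamma> w to the left.\<close>
    proof (cases "q - (of_int i + 1) \<ge> (1 - \<gamma> / \<beta>) * (\<beta> * w)")
      case True
      \<comment> \<open>Truncated at 1, since the right part may exceed one branch. A cylinder at 0
        of length about \<open>r\<close> is shifted to the integer and pulled back.\<close>
      define r where "r = min 1 (q - (of_int i + 1))"
      have r: "0 < r" "r \<le> 1" using F1 by (auto simp: r_def)
      obtain n where n: "1 / \<beta> ^ n \<le> r" "r / \<beta> < 1 / \<beta> ^ n"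
        using power_between[OF b r] by blast
      have "c * w powr \<sigma> \<le> 1 / \<beta> ^ Suc n"
      proof (cases "r = 1")
        case True
        have "c * w powr \<sigma> \<le> 1 / \<beta>" 
          using mult_mono[of c "1/\<beta>" "w powr \<sigma>" 1] c wpow w b by auto
        moreover have "\<beta> ^ n < \<beta> ^ 1" using n(2) True b by (simp add: field_simps)
        then have "n = 0" using b by (metis less_one power_strict_increasing_iff)
        ultimately show ?thesis by simp
      next
        case False
        then have "r = q - (of_int i + 1)" by (auto simp: r_def)
        then have "(1 - \<gamma> / \<beta>) * (\<beta> * w) / \<beta> / \<beta> \<le> r / \<beta> / \<beta>"
          using True b by (intro divide_right_mono) auto
        moreover have "(1 - \<gamma> / \<beta>) * (\<beta> * w) / \<beta> / \<beta> = c * w" using b by (simp add: c_def)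
        moreover have "r / \<beta> / \<beta> < 1 / \<beta> ^ Suc n" 
          using divide_strict_right_mono[OF n(2), of \<beta>] b by (simp add: mult.commute)
        moreover have "c * w powr \<sigma> \<le> c * w" using c wpow by simp
        ultimately show ?thesis by linarith
      qed
      moreover have v: "(of_int (i + 1) + (0 + 1 / \<beta> ^ n)) / \<beta> \<le> v"
      proof -
        have "of_int (i + 1) + (0 + 1 / \<beta> ^ n) \<le> q" using n(1) by (simp add: r_def)
        then show ?thesis using b by (simp add: pos_divide_le_eq q_def mult.commute)
      qed
      have "0 \<le> i + 1" using i by simp
      with full_zero[OF b] b order_trans[OF v Suc.prems(3)]
      have "full \<beta> (Suc n) ((of_int (i + 1) + 0) / \<beta>)" by (rule full_Suc)
      moreover have "u \<le> (of_int (i + 1) + 0) / \<beta>"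
        using i b by (simp add: pos_le_divide_eq p_def mult.commute)
      moreover have "(of_int (i + 1) + 0) / \<beta> + 1 / \<beta> ^ Suc n = (of_int (i + 1) + (0 + 1 / \<beta> ^ n)) / \<beta>"
        using b by (simp add: field_simps)
      ultimately show ?thesis using v unfolding w_def
        by (intro exI[of _ "Suc n"] exI[of _ "(of_int (i + 1) + 0) / \<beta>"]) simp
    next
      case False
      have "(1 - \<gamma> / \<beta>) * (\<beta> * w) = \<beta> * w - \<gamma> * w" using b by (simp add: field_simps)
      then have "\<gamma> * w \<le> (of_int i + 1) - p" using False pq by linarith
      then show ?thesis
        by (intro recurse[of i p "of_int i + 1"]) (use i pq F1 in auto)
    qed
  qed
qed

lemma full_in_interval:
  assumes "1 < \<beta>" "1 < \<sigma>"
  obtains c where "0 < c" "\<And>u v. 0 \<le> u \<Longrightarrow> u < v \<Longrightarrow> v \<le> 1 \<Longrightarrow>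
    \<exists>n a. full \<beta> n a \<and> u \<le> a \<and> a + 1 / \<beta> ^ n \<le> v \<and> c * (v - u) powr \<sigma> \<le> 1 / \<beta> ^ n"
proof -
  define \<gamma> where "\<gamma> = \<beta> powr (1 / \<sigma>)"
  have "\<beta> powr (1 / \<sigma>) < \<beta> powr 1" using assms by (intro powr_less_mono) auto
  then have \<gamma>: "1 < \<gamma>" "\<gamma> < \<beta>" using assms by (auto simp: \<gamma>_def)
  show ?thesis
  proof (rule that)
    show "0 < (1 - \<gamma> / \<beta>) / \<beta>" using \<gamma> assms by (simp add: field_simps)
    fix u v :: real assume uv: "0 \<le> u" "u < v" "v \<le> 1"
    obtain N where N: "1 / (v - u) < \<gamma> ^ N" using real_arch_pow[OF \<gamma>(1)] by blast
    have "0 < \<gamma> ^ N" using \<gamma> by simp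
    then have "1 / \<gamma> ^ N < v - u" using N uv by (simp add: pos_divide_less_eq mult.commute)
    from full_in_interval_aux[OF assms uv this[unfolded \<gamma>_def]]
    show "\<exists>n a. full \<beta> n a \<and> u \<le> a \<and> a + 1 / \<beta> ^ n \<le> v \<and>
        (1 - \<gamma> / \<beta>) / \<beta> * (v - u) powr \<sigma> \<le> 1 / \<beta> ^ n"
      unfolding \<gamma>_def .
  qed
qed

text \<open>Three lifts of a ball on the circle can meet [0, 1). The left ends of the cylinders
  meeting one of them lie in an interval of length \<open>2 * r + 1 / \<beta> ^ n\<close> and have
  gaps of at least \<open>1 / \<beta> ^ n\<close>.\<close>

lemma card_full_near:
  fixes n :: nat
  assumes \<beta>: "1 < \<beta>" and r: "0 < r" and y: "0 \<le> y" "y < 1"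
  defines "S \<equiv> {a. full \<beta> n a \<and> (\<exists>x. a \<le> x \<and> x < a + 1 / \<beta> ^ n \<and> circle_dist x y \<le> r)}"
  shows "real (card S) \<le> 3 * (2 * r * \<beta> ^ n + 2)"
proof -
  define R where "R k = {a. full \<beta> n a} \<inter> {y + of_int k - r - 1 / \<beta> ^ n .. y + of_int k + r}" for k :: int
  have p: "0 < \<beta> ^ n" using \<beta> by simp
  have cR: "real (card (R k)) \<le> 2 * r * \<beta> ^ n + 2" for k
  proof -
    have "real (card (R k)) \<le> (2 * r + 1 / \<beta> ^ n) / (1 / \<beta> ^ n) + 1"
      by (rule separated_card(2)[of _ "y + of_int k - r - 1 / \<beta> ^ n"])
        (use full_separated \<beta> r p in \<open>auto simp: R_def\<close>)
    also have "\<dots> = 2 * r * \<beta> ^ n + 2" using \<beta> by (simp add: distrib_right)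
    finally show ?thesis .
  qed
  have sub: "S \<subseteq> R (-1) \<union> (R 0 \<union> R 1)"
  proof
    fix a assume "a \<in> S"
    then obtain x where x: "full \<beta> n a" "a \<le> x" "x < a + 1 / \<beta> ^ n" "circle_dist x y \<le> r"
      by (auto simp: S_def)
    define k where "k = round (x - y)"
    have "0 \<le> x" "x < 1" using x fullD[OF x(1)] by linarith+
    then have "-1 \<le> k" "k \<le> 1" using y unfolding k_def round_def by linarith+
    then have k: "k = -1 \<or> k = 0 \<or> k = 1" by linarith
    have "\<bar>x - y - of_int k\<bar> \<le> r" using x(4) by (simp add: circle_dist_def k_def)
    then have "a \<in> R k" using x by (auto simp: R_def abs_le_iff)
    then show "a \<in> R (-1) \<union> (R 0 \<union> R 1)" using k by auto
  qed
  have "finite (R k)" for k using finite_full[OF \<beta>] by (simp add: R_def)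
  then have "card S \<le> card (R (-1) \<union> (R 0 \<union> R 1))" using sub by (intro card_mono) auto
  also have "\<dots> \<le> card (R (-1)) + (card (R 0) + card (R 1))"
    using card_Un_le[of "R 0" "R 1"] card_Un_le[of "R (-1)" "R 0 \<union> R 1"] by linarith
  finally have "real (card S) \<le> real (card (R (-1)) + (card (R 0) + card (R 1)))"
    by (rule of_nat_mono)
  then show ?thesis using cR[of "-1"] cR[of 0] cR[of 1] by simp
qed

section \<open>Hausdorff measure and dimension\<close>

lemma hausdorff_gauge_nonneg: "0 \<le> hausdorff_gauge s U"
  by (simp add: hausdorff_gauge_def)

lemma hausdorff_measure_mono: "A \<subseteq> B \<Longrightarrow> hausdorff_measure s A \<le> hausdorff_measure s B"
  unfolding hausdorff_measure_def hausdorff_premeasure_def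
  by (intro SUP_mono' INF_superset_mono) auto

lemma hausdorff_dim_leI:
  assumes "0 \<le> a" "\<And>s. a < s \<Longrightarrow> hausdorff_measure s A = 0"
  shows "hausdorff_dim A \<le> ereal a"
proof (rule ereal_le_epsilon2)
  fix e :: real assume "0 < e"
  then have "ereal (a + e) \<in> {ereal s |s. 0 \<le> s \<and> hausdorff_measure s A = 0}"
    using assms by auto
  then show "hausdorff_dim A \<le> ereal a + ereal e"
    unfolding hausdorff_dim_def by (intro Inf_lower) simp
qed

lemma hausdorff_dim_geI:
  assumes "\<And>s. 0 \<le> s \<Longrightarrow> s < a \<Longrightarrow> hausdorff_measure s A \<noteq> 0"
  shows "ereal a \<le> hausdorff_dim A"
  unfolding hausdorff_dim_def
proof (rule Inf_greatest)
  fix x assume "x \<in> {ereal s |s. 0 \<le> s \<and> hausdorff_measure s A = 0}"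
  then obtain s where "x = ereal s" "0 \<le> s" "hausdorff_measure s A = 0" by blast
  then show "ereal a \<le> x" using assms[of s] by (cases "s < a") auto
qed

lemma diameter_leI:
  assumes "0 \<le> d" "\<And>x y. x \<in> U \<Longrightarrow> y \<in> U \<Longrightarrow> dist x y \<le> d"
  shows "bounded U" "diameter U \<le> d"
proof -
  show "bounded U"
  proof (cases "U = {}")
    case False
    then obtain x where "x \<in> U" by auto
    then show ?thesis using assms(2) unfolding bounded_def by blast
  qed simp
  show "diameter U \<le> d" 
    using assms by (auto simp: diameter_def intro!: cSUP_least)
qed

lemma ex_powr_less:
  assumes "0 < (s::real)" "0 < e" "0 < r0"
  obtains r where "0 < r" "r < r0" "r powr s \<le> e"
proof
  define r where "r = min (r0 / 2) (e powr (1 / s))"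
  show "0 < r" "r < r0" using assms by (auto simp: r_def)
  have "r powr s \<le> (e powr (1 / s)) powr s" using assms by (intro powr_mono2) (auto simp: r_def)
  then show "r powr s \<le> e" using assms by (simp add: powr_powr)
qed

text \<open>The parametrisation \<^term>\<open>X\<close> of a subset of \<^term>\<open>A\<close> by the unit interval makes Lebesgue
  measure the mass that is distributed; only outer estimates are needed, so \<^term>\<open>X\<close> need not
  be measurable.\<close>

lemma mass_distribution:
  fixes A :: "'a::metric_space set" and X :: "real \<Rightarrow> 'a"
  assumes s: "0 \<le> s" "s < s'" and C: "0 < C" and r0: "0 < r0" "r0 \<le> 1"
    and X: "\<And>t. 0 \<le> t \<Longrightarrow> t < 1 \<Longrightarrow> X t \<in> A"
    and mass: "\<And>U r. 0 < r \<Longrightarrow> r < r0 \<Longrightarrow> (\<And>x y. x \<in> U \<Longrightarrow> y \<in> U \<Longrightarrow> dist x y \<le> r) \<Longrightarrow> U \<noteq> {} \<Longrightarrow>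
      \<exists>S \<in> sets lborel. {t. 0 \<le> t \<and> t < 1 \<and> X t \<in> U} \<subseteq> S \<and> emeasure lborel S \<le> ennreal (C * r powr s')"
  shows "hausdorff_measure s A \<noteq> 0"
proof
  assume 0: "hausdorff_measure s A = 0"
  have "hausdorff_premeasure (r0 / 2) s A \<le> hausdorff_measure s A"
    unfolding hausdorff_measure_def using r0 by (intro SUP_upper) auto
  also have "\<dots> < ennreal (1 / (4 * C))" using 0 C by simp
  finally obtain U where U: "A \<subseteq> (\<Union>k. U k)" "\<And>k. bounded (U k)" "\<And>k. diameter (U k) \<le> r0 / 2"
    and sumU: "(\<Sum>k. ennreal (hausdorff_gauge s (U k))) < ennreal (1 / (4 * C))"
    unfolding hausdorff_premeasure_def INF_less_iff by auto
  have "\<exists>S. S \<in> sets lborel \<and> {t. 0 \<le> t \<and> t < 1 \<and> X t \<in> U k} \<subseteq> S \<and>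
      emeasure lborel S \<le> ennreal C * ennreal (hausdorff_gauge s (U k)) + ennreal ((1/2) ^ Suc (Suc k))" for k
  proof (cases "U k = {}")
    case False
    have s': "0 < s'" using s by simp
    have e: "(0::real) < (1/2) ^ Suc (Suc k) / C" using C by simp
    \<comment> \<open>\<open>mass\<close> needs a positive radius, but a covering set may be a
      single point. After multiplication by \<open>C\<close> the substitutes \<open>r1\<close> cost
      1/2 altogether and the gauges at most 1/4, less than the length 1 of the parameter
      interval.\<close>
    obtain r1 where r1: "0 < r1" "r1 < r0" "r1 powr s' \<le> (1/2) ^ Suc (Suc k) / C"
      using ex_powr_less[OF s' e r0(1)] by blast
    define D where "D = diameter (U k)"
    have D: "0 \<le> D" "D \<le> r0 / 2" using diameter_ge_0[OF U(2)] U(3) by (auto simp: D_def)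
    define r where "r = max D r1"
    have r: "0 < r" "r < r0" using r1 D r0 by (auto simp: r_def)
    have "D powr s' \<le> hausdorff_gauge s (U k)"
    proof (cases "D = 0")
      case True
      then show ?thesis using hausdorff_gauge_nonneg by simp
    next
      case Dn: False
      have "D powr s' \<le> D powr s" using Dn D r0 s by (intro powr_mono') auto
      also have "\<dots> = hausdorff_gauge s (U k)" using Dn D False by (simp add: hausdorff_gauge_def D_def)
      finally show ?thesis .
    qed
    moreover have "r powr s' \<le> D powr s' + r1 powr s'" by (simp add: r_def max_def)
    ultimately have "r powr s' \<le> hausdorff_gauge s (U k) + (1/2) ^ Suc (Suc k) / C" using r1(3) by linarith
    from mult_left_mono[OF this less_imp_le[OF C]]
    have le: "C * r powr s' \<le> C * hausdorff_gauge s (U k) + (1/2) ^ Suc (Suc k)"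
      using C by (simp add: distrib_left)
    have "dist x y \<le> r" if "x \<in> U k" "y \<in> U k" for x y
      using diameter_bounded_bound[OF U(2) that] by (simp add: r_def D_def)
    then obtain S where S: "S \<in> sets lborel" "{t. 0 \<le> t \<and> t < 1 \<and> X t \<in> U k} \<subseteq> S"
      "emeasure lborel S \<le> ennreal (C * r powr s')"
      using mass[OF r _ False] by blast
    note S(3)
    also have "ennreal (C * r powr s') \<le> ennreal (C * hausdorff_gauge s (U k) + (1/2) ^ Suc (Suc k))"
      using le by (rule ennreal_leI)
    also have "\<dots> = ennreal C * ennreal (hausdorff_gauge s (U k)) + ennreal ((1/2) ^ Suc (Suc k))"
      using C hausdorff_gauge_nonneg[of s "U k"] by (subst ennreal_plus) (auto simp: ennreal_mult)
    finally show ?thesis using S by blast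
  qed (auto intro!: exI[of _ "{}"])
  then have "\<exists>S. \<forall>k. S k \<in> sets lborel \<and> {t. 0 \<le> t \<and> t < 1 \<and> X t \<in> U k} \<subseteq> S k \<and>
      emeasure lborel (S k) \<le> ennreal C * ennreal (hausdorff_gauge s (U k)) + ennreal ((1/2) ^ Suc (Suc k))"
    by (intro choice allI)
  then obtain S where S: "\<And>k. S k \<in> sets lborel" "\<And>k. {t. 0 \<le> t \<and> t < 1 \<and> X t \<in> U k} \<subseteq> S k"
      "\<And>k. emeasure lborel (S k) \<le> ennreal C * ennreal (hausdorff_gauge s (U k)) + ennreal ((1/2) ^ Suc (Suc k))"
    by blast
  have sub: "{0..<1} \<subseteq> (\<Union>k. S k)"
  proof
    fix t :: real assume t: "t \<in> {0..<1}"
    then have "X t \<in> (\<Union>k. U k)" using X U(1) by auto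
    then show "t \<in> (\<Union>k. S k)" using t S(2) by fastforce
  qed
  have sums: "(\<lambda>k. (1/2::real) ^ Suc (Suc k)) sums (1/2)"
    using sums_mult[OF power_half_series, of "1/2"] by (simp add: power_Suc)
  have "ennreal 1 = emeasure lborel {0..<1::real}" by simp
  also have "\<dots> \<le> emeasure lborel (\<Union>k. S k)" using sub S(1) by (intro emeasure_mono) auto
  also have "\<dots> \<le> (\<Sum>k. emeasure lborel (S k))" using S(1) by (intro emeasure_subadditive_countably) auto
  also have "\<dots> \<le> (\<Sum>k. ennreal C * ennreal (hausdorff_gauge s (U k)) + ennreal ((1/2) ^ Suc (Suc k)))"
    using S(3) by (intro suminf_le) auto
  also have "\<dots> = ennreal C * (\<Sum>k. ennreal (hausdorff_gauge s (U k))) + (\<Sum>k. ennreal ((1/2) ^ Suc (Suc k)))"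
    by (subst suminf_add[symmetric]) auto
  also have "(\<Sum>k. ennreal ((1/2) ^ Suc (Suc k))) = ennreal (1/2)"
    using sums by (intro suminf_ennreal_eq) auto
  also have "ennreal C * (\<Sum>k. ennreal (hausdorff_gauge s (U k))) + ennreal (1/2)
      \<le> ennreal C * ennreal (1 / (4 * C)) + ennreal (1/2)"
    using sumU by (intro add_mono mult_left_mono) (auto intro: less_imp_le)
  also have "ennreal C * ennreal (1 / (4 * C)) = ennreal (1/4)"
    using C by (simp add: ennreal_mult[symmetric])
  also have "ennreal (1/4) + ennreal (1/2) = ennreal (1/4 + 1/2)" by (rule ennreal_plus[symmetric]) auto
  finally show False by (subst (asm) ennreal_le_iff) auto
qed

text \<open>The convergence half of a Borel-Cantelli argument: the covers of the sets
  \<open>E n\<close> beyond any bound together cover \<open>A\<close>, and their total cost is a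
  tail of a convergent series.\<close>

lemma hausdorff_measure_limsup_eq_0:
  fixes A :: "'a::metric_space set" and E :: "nat \<Rightarrow> 'a set" and N \<delta> :: "nat \<Rightarrow> real"
  assumes s: "0 < s"
    and A: "\<And>x. x \<in> A \<Longrightarrow> infinite {n. x \<in> E n}"
    and cover: "eventually (\<lambda>n. \<exists>F. finite F \<and> real (card F) \<le> N n \<and> E n \<subseteq> \<Union> F \<and>
      (\<forall>U\<in>F. \<forall>x\<in>U. \<forall>y\<in>U. dist x y \<le> \<delta> n)) sequentially"
    and \<delta>: "\<And>n. 0 \<le> \<delta> n" "\<delta> \<longlonglongrightarrow> 0"
    and summable: "summable (\<lambda>n. N n * \<delta> n powr s)"
    and N: "\<And>n. 0 \<le> N n"
  shows "hausdorff_measure s A = 0"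
proof -
  have "hausdorff_premeasure d s A \<le> ennreal e" if d: "0 < d" and e: "0 < e" for d e
  proof -
    have "eventually (\<lambda>n. \<delta> n < d) sequentially" using \<delta>(2) d by (rule order_tendstoD)
    from eventually_conj[OF this cover] obtain M0 where M0: "\<And>n. n \<ge> M0 \<Longrightarrow> \<delta> n < d"
      "\<And>n. n \<ge> M0 \<Longrightarrow> \<exists>F. finite F \<and> real (card F) \<le> N n \<and> E n \<subseteq> \<Union> F \<and>
      (\<forall>U\<in>F. \<forall>x\<in>U. \<forall>y\<in>U. dist x y \<le> \<delta> n)"
      unfolding eventually_sequentially by (metis (no_types, lifting))
    obtain M1 where M1: "\<And>n. n \<ge> M1 \<Longrightarrow> norm (\<Sum>i. N (i + n) * \<delta> (i + n) powr s) < e"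
      using suminf_exist_split[OF e summable] by blast
    define M where "M = max M0 M1"
    have "\<exists>F. finite F \<and> real (card F) \<le> N (n + M) \<and> E (n + M) \<subseteq> \<Union> F \<and>
      (\<forall>U\<in>F. \<forall>x\<in>U. \<forall>y\<in>U. dist x y \<le> \<delta> (n + M))" for n
      by (rule M0(2)) (simp add: M_def)
    then obtain F where F: "\<And>n. finite (F n)" "\<And>n. real (card (F n)) \<le> N (n + M)" "\<And>n. E (n + M) \<subseteq> \<Union> (F n)"
      "\<And>n U x y. U \<in> F n \<Longrightarrow> x \<in> U \<Longrightarrow> y \<in> U \<Longrightarrow> dist x y \<le> \<delta> (n + M)"
      by metis
    obtain h where h: "\<And>n. bij_betw (h n) {0..<card (F n)} (F n)"
      using ex_bij_betw_nat_finite[OF F(1)] by metis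
    \<comment> \<open>Each finite cover is padded with empty sets, whose gauge is 0. The pairs are
      then listed by \<open>prod_decode\<close>, as the premeasure asks for a single
      sequence.\<close>
    define V where "V = (\<lambda>(n, i). if i < card (F n) then h n i else {})"
    have dV: "x \<in> V (n, i) \<Longrightarrow> y \<in> V (n, i) \<Longrightarrow> dist x y \<le> \<delta> (n + M)" for n i x y
    proof -
      assume xy: "x \<in> V (n, i)" "y \<in> V (n, i)"
      then have i: "i < card (F n)" by (auto simp: V_def split: if_splits)
      then have "h n i \<in> F n" using bij_betw_apply[OF h[of n]] by simp
      then show ?thesis using F(4) xy i by (simp add: V_def)
    qed
    have \<delta>M: "\<delta> (n + M) \<le> d" for n 
    proof -
      have "n + M \<ge> M0" by (simp add: M_def)
      then show ?thesis using M0(1) less_imp_le by blast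
    qed
    have gauge: "hausdorff_gauge s (V (n, i)) \<le> (if i < card (F n) then \<delta> (n + M) powr s else 0)" for n i
    proof (cases "V (n, i) = {}")
      case False
      then have i: "i < card (F n)" by (auto simp: V_def split: if_splits)
      have "bounded (V (n, i))" "diameter (V (n, i)) \<le> \<delta> (n + M)"
        by (rule diameter_leI[OF \<delta>(1) dV]; assumption)+
      then show ?thesis using False i s diameter_ge_0
        by (auto simp: hausdorff_gauge_def intro!: powr_mono2)
    qed (simp add: hausdorff_gauge_def)
    have "hausdorff_premeasure d s A \<le> (\<Sum>k. ennreal (hausdorff_gauge s (V (prod_decode k))))"
      unfolding hausdorff_premeasure_def
    proof (rule INF_lower, clarify, intro conjI allI)
      show "A \<subseteq> (\<Union>k. V (prod_decode k))"
      proof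
        fix x assume "x \<in> A"
        from A[OF this] obtain m where "m \<ge> M" "x \<in> E m"
          unfolding infinite_nat_iff_unbounded_le by auto
        then have "x \<in> \<Union> (F (m - M))" using F(3)[of "m - M"] by auto
        then obtain W where W: "W \<in> F (m - M)" "x \<in> W" by blast
        then have "W \<in> h (m - M) ` {0..<card (F (m - M))}"
          using bij_betw_imp_surj_on[OF h[of "m - M"]] by simp
        then obtain i where "i < card (F (m - M))" "x \<in> h (m - M) i" using W by auto
        then have "x \<in> V (prod_decode (prod_encode (m - M, i)))" by (simp add: V_def)
        then show "x \<in> (\<Union>k. V (prod_decode k))" by blast
      qed
      fix k
      obtain n i where ni: "prod_decode k = (n, i)" by fastforce
      show "bounded (V (prod_decode k))" "diameter (V (prod_decode k)) \<le> d"
        unfolding ni using diameter_leI[OF \<delta>(1), of "V (n, i)" "n + M"] dV[of _ n i] \<delta>M[of n]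
        by (blast, fastforce)
    qed
    also have "\<dots> = (\<Sum>n. \<Sum>i. ennreal (hausdorff_gauge s (V (n, i))))"
      using suminf_ennreal_2dimen[of "\<lambda>n. \<Sum>i. ennreal (hausdorff_gauge s (V (n, i)))"
          "\<lambda>p. ennreal (hausdorff_gauge s (V p))"] by simp
    also have "\<dots> \<le> (\<Sum>n. ennreal (N (n + M) * \<delta> (n + M) powr s))"
    proof (intro suminf_le allI)
      fix n
      have "(\<Sum>i. ennreal (hausdorff_gauge s (V (n, i)))) \<le>
          (\<Sum>i. ennreal (if i < card (F n) then \<delta> (n + M) powr s else 0))"
        using gauge by (intro suminf_le allI ennreal_leI) auto
      also have "\<dots> = (\<Sum>i<card (F n). ennreal (\<delta> (n + M) powr s))"
        by (subst suminf_finite[of "{..<card (F n)}"]) auto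
      also have "\<dots> = ennreal (real (card (F n)) * \<delta> (n + M) powr s)"
        by (simp add: ennreal_mult ennreal_of_nat_eq_real_of_nat)
      also have "\<dots> \<le> ennreal (N (n + M) * \<delta> (n + M) powr s)"
        using F(2) by (intro ennreal_leI mult_right_mono) auto
      finally show "(\<Sum>i. ennreal (hausdorff_gauge s (V (n, i)))) \<le> ennreal (N (n + M) * \<delta> (n + M) powr s)" .
    qed auto
    also have "\<dots> = ennreal (\<Sum>n. N (n + M) * \<delta> (n + M) powr s)"
      using summable N by (intro suminf_ennreal2) (auto intro: summable_ignore_initial_segment)
    also have "\<dots> \<le> ennreal e" using M1[of M] by (intro ennreal_leI) (auto simp: M_def)
    finally show ?thesis .
  qed
  then have "hausdorff_premeasure d s A = 0" if "0 < d" for d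
    using that by (metis ennreal_le_epsilon add_0 le_zero_eq)
  then show ?thesis unfolding hausdorff_measure_def by simp
qed

section \<open>Boxes inside the hitting sets\<close>

lemma circle_dist_abs: "circle_dist s t \<le> \<bar>s - t\<bar>"
  using circle_dist_le[of s t 0] by simp

lemma circle_dist_le_dist: "circle_dist (torus_rep x $ i) (torus_rep y $ i) \<le> dist x y"
  unfolding dist_torus_def by (rule member_le_L2_set) auto

lemma dist_torus_le_sum: "dist x y \<le> (\<Sum>i\<in>UNIV. \<bar>torus_rep x $ i - torus_rep y $ i\<bar>)"
  unfolding dist_torus_def
  by (rule order_trans[OF L2_set_le_sum]) (auto intro: sum_mono circle_dist_abs)

lemma torus_rep_abs:
  assumes "\<And>i. 0 \<le> v i \<and> v i < 1"
  shows "torus_rep (torus_abs (\<chi> i. v i)) $ i = v i"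
  using assms by (subst torus_abs_inverse) auto

text \<open>For a diagonal matrix with entries \<open>B\<close> the coordinates of an orbit evolve
  independently; only the moving centre \<open>g x\<close> couples them.\<close>

definition hit_set ::
    "('n::finite \<Rightarrow> real) \<Rightarrow> ('n torus \<Rightarrow> 'n torus) \<Rightarrow> real \<Rightarrow> nat \<Rightarrow> 'n torus set" where
  "hit_set B g r n =
    {x. \<forall>i. circle_dist ((beta_map (B i) ^^ n) (torus_rep x $ i)) (torus_rep (g x) $ i) < r}"

lemma hit_set_mono: "r \<le> r' \<Longrightarrow> hit_set B g r n \<subseteq> hit_set B g r' n"
  unfolding hit_set_def by (auto intro: less_le_trans)

text \<open>Both local lifts have absolute value below 1/4, so their difference stays below 1/2 and
  is already a shortest representative. Hence lifting the centre keeps its Lipschitz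
  constant.\<close>

lemma round_diff_cancel:
  assumes "circle_dist s y < 1/4" "circle_dist t y < 1/4"
  shows "\<bar>(s - y - of_int (round (s - y))) - (t - y - of_int (round (t - y)))\<bar> = circle_dist s t"
proof -
  have "\<bar>(s - t) - of_int (round (s - y) - round (t - y))\<bar> < 1/2"
    using assms unfolding circle_dist_def of_int_diff by linarith
  from round_unique'[OF this] show ?thesis by (simp add: circle_dist_def)
qed

text \<open>The target \<open>g x\<close> is reached exactly at a fixed point.  The contraction acts on lifts of
  the image coordinates to \<open>[0, B i)\<close>; the lift \<open>Y\<close> is kept away from \<open>0\<close> because next to the left
  end of the cylinder there may be no point whose image wraps around.\<close>

lemma fixed_point_box:
  fixes B :: "'n::finite \<Rightarrow> real" and g :: "'n torus \<Rightarrow> 'n torus"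
  assumes b: "1 < b" "\<And>i. b \<le> B i"
    and lip: "\<And>x y. dist (g x) (g y) \<le> c * dist x y" and c: "0 < c"
    and \<eta>: "0 < \<eta>" "\<eta> \<le> 1/8" "\<And>i. 4 * \<eta> \<le> B i - 1"
    and N: "c * (2 * real CARD('n)) \<le> \<eta> * b ^ Suc N"
    and \<rho>: "0 < \<rho>" "\<rho> \<le> \<eta>"
    and a: "\<And>i. full (B i) N (a i)"
  shows "\<exists>z. (\<forall>i. \<rho> \<le> z i \<and> z i + \<rho> < B i) \<and>
    (\<forall>x. (\<forall>i. \<bar>torus_rep x $ i - (a i + z i / B i ^ Suc N)\<bar> \<le> \<rho> / B i ^ Suc N)
      \<longrightarrow> x \<in> hit_set B g (3 * \<rho>) (Suc N))"
proof -
  let ?d = "real CARD('n)"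
  have B: "1 < B i" for i using b(1) b(2)[of i] by linarith
  have B0: "0 < B i" for i using B[of i] by linarith
  have pw: "b ^ Suc N \<le> B i ^ Suc N" for i using b by (intro power_mono) auto
  have bp: "0 < b ^ Suc N" using b by simp
  have d1: "1 \<le> ?d" using finite_UNIV_card_ge_0[where 'a='n] by simp
  have cb: "c * (2 * ?d) / b ^ Suc N \<le> \<eta>" using N bp by (simp add: pos_divide_le_eq)
  define x0 where "x0 = torus_abs (\<chi> i. a i)"
  define y where "y i = torus_rep (g x0) $ i" for i
  \<comment> \<open>A coordinate below 2 \<eta> is raised by 1. Either way \<open>Y i\<close> stays
    at distance at least 2 \<eta> from 0 and from \<open>B i\<close>, the latter because 4 \<eta> <=
    B i - 1.\<close>
  define Y where "Y i = (if 2 * \<eta> \<le> y i then y i else y i + 1)" for i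
  have Y: "2 * \<eta> \<le> Y i" "Y i < 1 + 2 * \<eta>" for i
    using torus_rep_bounds[of "g x0" i] \<eta> by (auto simp: Y_def y_def)
  define K where "K = cbox (\<chi> i. Y i - \<eta>) ((\<chi> i. Y i + \<eta>) :: real ^ 'n)"
  have K: "V \<in> K \<longleftrightarrow> (\<forall>i. Y i - \<eta> \<le> V $ i \<and> V $ i \<le> Y i + \<eta>)" for V
    by (auto simp: K_def mem_box_cart)
  \<comment> \<open>For \<open>V $ i\<close> in [0, B i), \<open>P V\<close> is the point of the
    cylinder whose image after N + 1 steps has the coordinates \<open>frac (V $ i)\<close>: the last
    reduction mod 1 is left open.\<close>
  define P where "P V = torus_abs (\<chi> i. a i + V $ i / B i ^ Suc N)" for V :: "real ^ 'n"
  have inQ: "0 \<le> a i + v / B i ^ Suc N" "a i + v / B i ^ Suc N < a i + 1 / B i ^ N"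
    "a i + v / B i ^ Suc N < 1"
    if "0 \<le> v" "v < B i" for v i
  proof -
    show "0 \<le> a i + v / B i ^ Suc N" using fullD(1)[OF a[of i]] that B0[of i] by auto
    have "v / B i < 1" using that by simp
    then have "v / B i / B i ^ N < 1 / B i ^ N" using B0[of i] by (intro divide_strict_right_mono) auto
    then show "a i + v / B i ^ Suc N < a i + 1 / B i ^ N" by simp
    then show "a i + v / B i ^ Suc N < 1" using fullD(2)[OF a[of i]] by linarith
  qed
  have rep: "torus_rep (P V) $ i = a i + V $ i / B i ^ Suc N"
    if "\<And>i. 0 \<le> V $ i \<and> V $ i < B i" for V i
    unfolding P_def using that inQ by (intro torus_rep_abs) auto
  have Kb: "0 \<le> V $ i" "V $ i < B i" "\<bar>V $ i\<bar> \<le> 2" if "V \<in> K" for V i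
  proof -
    have "Y i - \<eta> \<le> V $ i" "V $ i \<le> Y i + \<eta>" using that unfolding K by auto
    then show "0 \<le> V $ i" "V $ i < B i" "\<bar>V $ i\<bar> \<le> 2"
      using Y[of i] \<eta>(1,2) \<eta>(3)[of i] by linarith+
  qed
  have repK: "torus_rep (P V) $ i = a i + V $ i / B i ^ Suc N" if "V \<in> K" for V i
    using rep Kb(1,2)[OF that] by blast
  have rep0: "torus_rep x0 $ i = a i" for i
    unfolding x0_def using a fullD(1) full_less_1 B0 by (intro torus_rep_abs) blast
  have close: "circle_dist (torus_rep (g (P V)) $ i) (y i) \<le> \<eta>" if V: "V \<in> K" for V i
  proof -
    have "circle_dist (torus_rep (g (P V)) $ i) (y i) \<le> dist (g (P V)) (g x0)"
      unfolding y_def by (rule circle_dist_le_dist)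
    also have "\<dots> \<le> c * dist (P V) x0" by (rule lip)
    also have "\<dots> \<le> c * (\<Sum>i\<in>UNIV. \<bar>torus_rep (P V) $ i - torus_rep x0 $ i\<bar>)"
      using c by (intro mult_left_mono dist_torus_le_sum) auto
    also have "\<dots> \<le> c * (\<Sum>i\<in>(UNIV::'n set). 2 / b ^ Suc N)"
    proof (intro mult_left_mono sum_mono)
      fix i
      have "\<bar>V $ i / B i ^ Suc N\<bar> = \<bar>V $ i\<bar> / B i ^ Suc N" using B0[of i] by simp
      also have "\<dots> \<le> 2 / b ^ Suc N" using Kb(3)[OF V] pw bp by (intro frac_le) auto
      finally show "\<bar>torus_rep (P V) $ i - torus_rep x0 $ i\<bar> \<le> 2 / b ^ Suc N"
        using repK[OF V] rep0 V by (simp del: power_Suc)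
    qed (use c in auto)
    also have "\<dots> = c * (2 * ?d) / b ^ Suc N" by simp
    finally show ?thesis using cb by linarith
  qed
  \<comment> \<open>The lift near \<open>Y\<close> of the centre that belongs to \<open>P V\<close>.
    A fixed point \<open>V\<close> reduces mod 1 to \<open>g (P V)\<close>, so \<open>P V\<close>
    lands exactly on its own centre.\<close>
  define \<Phi> where "\<Phi> V = (\<chi> i. Y i + (torus_rep (g (P V)) $ i - y i
      - of_int (round (torus_rep (g (P V)) $ i - y i))))" for V :: "real ^ 'n"
  have \<Phi>K: "\<Phi> ` K \<subseteq> K"
  proof clarify
    fix V assume "V \<in> K"
    then have "\<bar>torus_rep (g (P V)) $ i - y i - of_int (round (torus_rep (g (P V)) $ i - y i))\<bar> \<le> \<eta>" for i
      using close[of V i] by (simp add: circle_dist_def)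
    then show "\<Phi> V \<in> K" unfolding K \<Phi>_def by (simp add: abs_le_iff) (smt (verit))
  qed
  have contr: "dist (\<Phi> V) (\<Phi> V') \<le> (1/2) * dist V V'" if V: "V \<in> K" "V' \<in> K" for V V'
  proof -
    have lt: "circle_dist (torus_rep (g (P V)) $ i) (y i) < 1/4" if "V \<in> K" for V i
      using close[OF that, of i] \<eta> by linarith
    have "dist (\<Phi> V) (\<Phi> V') = L2_set (\<lambda>i. \<bar>\<Phi> V $ i - \<Phi> V' $ i\<bar>) UNIV"
      by (simp add: dist_vec_def dist_real_def)
    also have "\<dots> = dist (g (P V)) (g (P V'))"
      unfolding dist_torus_def \<Phi>_def
      using round_diff_cancel[OF lt[OF V(1)] lt[OF V(2)]] by simp
    also have "\<dots> \<le> c * dist (P V) (P V')" by (rule lip)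
    also have "dist (P V) (P V') \<le> L2_set (\<lambda>i. (1 / b ^ Suc N) * dist (V $ i) (V' $ i)) UNIV"
      unfolding dist_torus_def
    proof (rule L2_set_mono)
      fix i
      have "circle_dist (torus_rep (P V) $ i) (torus_rep (P V') $ i)
          \<le> \<bar>torus_rep (P V) $ i - torus_rep (P V') $ i\<bar>" by (rule circle_dist_abs)
      also have "\<dots> = \<bar>V $ i - V' $ i\<bar> / B i ^ Suc N"
        using repK[OF V(1)] repK[OF V(2)] B0[of i] by (simp add: diff_divide_distrib[symmetric])
      also have "\<dots> \<le> \<bar>V $ i - V' $ i\<bar> / b ^ Suc N" using pw bp by (intro frac_le) auto
      finally show "circle_dist (torus_rep (P V) $ i) (torus_rep (P V') $ i)
          \<le> (1 / b ^ Suc N) * dist (V $ i) (V' $ i)" by (simp add: dist_real_def)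
    qed simp
    also have "\<dots> = (1 / b ^ Suc N) * dist V V'"
      unfolding dist_vec_def by (rule L2_set_right_distrib[symmetric]) (use b in auto)
    finally have "dist (\<Phi> V) (\<Phi> V') \<le> (c / b ^ Suc N) * dist V V'" using c by simp
    also have "\<dots> \<le> (1/2) * dist V V'"
    proof (rule mult_right_mono)
      have "c * 1 \<le> c * (2 * ?d)" using d1 c by (intro mult_left_mono) linarith+
      then have "c / b ^ Suc N \<le> c * (2 * ?d) / b ^ Suc N" using bp by (intro divide_right_mono) auto
      then show "c / b ^ Suc N \<le> 1/2" using cb \<eta> by linarith
    qed simp
    finally show ?thesis .
  qed
  have "(\<chi> i. Y i) \<in> K" unfolding K using \<eta> by simp
  then have "K \<noteq> {}" by blast
  moreover have "complete K" unfolding K_def using closed_cbox by (simp add: complete_eq_closed)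
  ultimately obtain V where V: "V \<in> K" "\<Phi> V = V"
    using Banach_fix[of K "1/2" \<Phi>] \<Phi>K contr by (auto simp: Ex1_def)
  show ?thesis
  proof (intro exI[of _ "\<lambda>i. V $ i"] conjI allI impI)
    fix i
    show "\<rho> \<le> V $ i" "V $ i + \<rho> < B i"
      using V(1) Y[of i] \<eta>(1,2) \<eta>(3)[of i] \<rho> unfolding K by (smt (verit))+
  next
    fix x assume x: "\<forall>i. \<bar>torus_rep x $ i - (a i + V $ i / B i ^ Suc N)\<bar> \<le> \<rho> / B i ^ Suc N"
    have "circle_dist ((beta_map (B i) ^^ Suc N) (torus_rep x $ i)) (torus_rep (g x) $ i) < 3 * \<rho>" for i
    proof -
      define u where "u = (torus_rep x $ i - a i) * B i ^ Suc N"
      have Bp: "0 < B i ^ Suc N" using B0[of i] by simp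
      have xu: "torus_rep x $ i = a i + (u / B i) / B i ^ N"
        using B0[of i] by (simp add: u_def)
      have "u - V $ i = (torus_rep x $ i - (a i + V $ i / B i ^ Suc N)) * B i ^ Suc N"
        using B0[of i] by (simp add: u_def field_simps)
      then have "\<bar>u - V $ i\<bar> = \<bar>torus_rep x $ i - (a i + V $ i / B i ^ Suc N)\<bar> * B i ^ Suc N"
        using Bp by (simp add: abs_mult del: power_Suc)
      also have "\<dots> \<le> (\<rho> / B i ^ Suc N) * B i ^ Suc N" using x Bp by (intro mult_right_mono) auto
      also have "\<dots> = \<rho>" using B0[of i] by simp
      finally have uV: "\<bar>u - V $ i\<bar> \<le> \<rho>" .
      have u: "0 \<le> u" "u < B i"
        using uV V(1) Y[of i] \<eta>(1,2) \<eta>(3)[of i] \<rho> unfolding K by (smt (verit))+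
      have "(beta_map (B i) ^^ N) (torus_rep x $ i) = u / B i"
        unfolding xu using u B0[of i] by (intro fullD(3)[OF a]) auto
      then have img: "(beta_map (B i) ^^ Suc N) (torus_rep x $ i) = frac u"
        using B0[of i] by (simp add: beta_map_def)
      define h where "h = torus_rep (g (P V)) $ i"
      have "\<exists>k::int. Y i = y i + of_int k"
        unfolding Y_def by (metis add.right_neutral of_int_0 of_int_1)
      then obtain k :: int where "Y i = y i + of_int k" by blast
      moreover have "V $ i = Y i + (h - y i - of_int (round (h - y i)))"
        using arg_cong[OF V(2), of "\<lambda>v. v $ i"] by (simp add: \<Phi>_def h_def)
      moreover define m where "m = k - round (h - y i)"
      ultimately have m: "V $ i = h + of_int m" by simp
      have "circle_dist (frac u) h \<le> \<bar>frac u - h - of_int (m - \<lfloor>u\<rfloor>)\<bar>" by (rule circle_dist_le)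
      also have "\<dots> = \<bar>u - V $ i\<bar>" using m by (simp add: frac_def)
      finally have 1: "circle_dist (frac u) h \<le> \<rho>" using uV by linarith
      have "circle_dist h (torus_rep (g x) $ i) \<le> dist (g (P V)) (g x)"
        unfolding h_def by (rule circle_dist_le_dist)
      also have "\<dots> \<le> c * dist (P V) x" by (rule lip)
      also have "\<dots> \<le> c * (\<Sum>i\<in>UNIV. \<bar>torus_rep (P V) $ i - torus_rep x $ i\<bar>)"
        using c by (intro mult_left_mono dist_torus_le_sum) auto
      also have "\<dots> \<le> c * (\<Sum>i\<in>(UNIV::'n set). \<rho> / b ^ Suc N)"
      proof (intro mult_left_mono sum_mono)
        fix i
        have "\<bar>torus_rep (P V) $ i - torus_rep x $ i\<bar> \<le> \<rho> / B i ^ Suc N"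
          using x repK[OF V(1)] by (simp add: abs_minus_commute)
        also have "\<dots> \<le> \<rho> / b ^ Suc N" using pw bp \<rho> by (intro frac_le) auto
        finally show "\<bar>torus_rep (P V) $ i - torus_rep x $ i\<bar> \<le> \<rho> / b ^ Suc N" .
      qed (use c in auto)
      also have "\<dots> = (c * (2 * ?d) / b ^ Suc N) * (\<rho> / 2)" by simp
      also have "\<dots> \<le> \<eta> * (\<rho> / 2)" using cb \<rho> by (intro mult_right_mono) auto
      also have "\<dots> \<le> 1 * \<rho>" using \<eta> \<rho> by (intro mult_mono) auto
      finally have "circle_dist h (torus_rep (g x) $ i) \<le> \<rho>" by simp
      \<comment> \<open>One \<rho> for the displacement of the image and one for the motion of the
        centre; the third makes the inequality strict.\<close>
      then show ?thesis
        using circle_dist_triangle[of "frac u" "torus_rep (g x) $ i" h] 1 \<rho> unfolding img by linarith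
    qed
    then show "x \<in> hit_set B g (3 * \<rho>) (Suc N)" by (simp add: hit_set_def)
  qed
qed

text \<open>The orders \<open>h\<close> depend on the time and the coordinate but not on the
  cylinder, so all boxes of one time have the same shape. Their sides are full cylinders again, in
  which a later generation can be placed.\<close>

lemma full_box_in_hit_set:
  fixes B :: "'n::finite \<Rightarrow> real" and f :: "nat \<Rightarrow> 'n torus \<Rightarrow> 'n torus"
  assumes B: "\<And>i. 1 < B i"
    and lip: "\<And>n x y. 1 \<le> n \<Longrightarrow> dist (f n x) (f n y) \<le> c * dist x y" and c: "0 < c"
    and \<tau>: "0 < \<tau>1" "\<tau>1 < \<tau>2"
    and inf: "infinite {n. 1 \<le> n \<and> exp (- \<tau>1 * real n) \<le> \<psi> n}"
  obtains C S where "0 < C" "infinite S"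
    "\<And>n. n \<in> S \<Longrightarrow> 1 \<le> n \<and> (\<exists>h. (\<forall>i. C / (B i ^ n * exp (\<tau>2 * real n)) \<le> 1 / B i ^ h i) \<and>
      (\<forall>a. (\<forall>i. full (B i) (n - 1) (a i)) \<longrightarrow>
        (\<exists>e. (\<forall>i. full (B i) (h i) (e i) \<and> a i \<le> e i \<and> e i + 1 / B i ^ h i < a i + 1 / B i ^ (n - 1)) \<and>
          (\<forall>x. (\<forall>i. e i \<le> torus_rep x $ i \<and> torus_rep x $ i \<le> e i + 1 / B i ^ h i) \<longrightarrow>
            x \<in> hit_set B (f n) (\<psi> n) n))))"
proof -
  \<comment> \<open>With this ratio the \<sigma>-th power of exp (- \<tau>1 n) is exp (- \<tau>2 n):
    the gap between the exponents pays for locating full cylinders.\<close>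
  define \<sigma> where "\<sigma> = \<tau>2 / \<tau>1"
  have \<sigma>: "1 < \<sigma>" using \<tau> by (simp add: \<sigma>_def)
  have B0: "0 < B i" for i using B[of i] by linarith
  define b where "b = Min (range B)"
  have b: "1 < b" "\<And>i. b \<le> B i" unfolding b_def using B by (auto simp: Min_gr_iff)
  define \<eta> where "\<eta> = min (1/8) (Min (range (\<lambda>i. (B i - 1) / 4)))"
  have \<eta>le: "\<eta> \<le> (B i - 1) / 4" for i
    unfolding \<eta>_def by (rule min.coboundedI2, rule Min_le) auto
  have "0 < \<eta>" unfolding \<eta>_def using B by (auto simp: Min_gr_iff)
  moreover have "4 * \<eta> \<le> B i - 1" for i using mult_left_mono[OF \<eta>le[of i], of 4] by simp
  moreover have "\<eta> \<le> 1/8" by (simp add: \<eta>_def)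
  ultimately have \<eta>: "0 < \<eta>" "\<eta> \<le> 1/8" "\<And>i. 4 * \<eta> \<le> B i - 1" by blast+
  have "\<exists>C. 0 < C \<and> (\<forall>u v. 0 \<le> u \<longrightarrow> u < v \<longrightarrow> v \<le> 1 \<longrightarrow>
    (\<exists>n a. full (B i) n a \<and> u \<le> a \<and> a + 1 / B i ^ n \<le> v \<and> C * (v - u) powr \<sigma> \<le> 1 / B i ^ n))" for i
    using full_in_interval[OF B \<sigma>, of i] by metis
  then obtain K where K: "\<And>i. 0 < K i"
    "\<And>i u v. 0 \<le> u \<Longrightarrow> u < v \<Longrightarrow> v \<le> 1 \<Longrightarrow>
    (\<exists>n a. full (B i) n a \<and> u \<le> a \<and> a + 1 / B i ^ n \<le> v \<and> K i * (v - u) powr \<sigma> \<le> 1 / B i ^ n)"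
    by metis
  define K' where "K' i = K i * (2 * \<eta> / (3 * B i)) powr \<sigma>" for i
  have K'0: "0 < K' i" for i using K(1)[of i] \<eta>(1) B0[of i] by (simp add: K'_def)
  define C where "C = Min (range K')"
  have C: "0 < C" "\<And>i. C \<le> K' i" unfolding C_def using K'0 by (auto simp: Min_gr_iff)
  define S where "S = {n. 1 \<le> n \<and> exp (- \<tau>1 * real n) \<le> \<psi> n} \<inter> {n. c * (2 * real CARD('n)) \<le> \<eta> * b ^ n}"
  obtain n0 where n0: "c * (2 * real CARD('n)) / \<eta> < b ^ n0" using real_arch_pow[OF b(1)] by blast
  have "c * (2 * real CARD('n)) \<le> \<eta> * b ^ n" if "n0 \<le> n" for n
  proof -
    have "c * (2 * real CARD('n)) / \<eta> < b ^ n" using n0 power_increasing[OF that, of b] b by linarith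
    then show ?thesis using \<eta> by (simp add: pos_divide_less_eq mult.commute)
  qed
  then have "{n. 1 \<le> n \<and> exp (- \<tau>1 * real n) \<le> \<psi> n} \<subseteq> S \<union> {..<n0}"
    unfolding S_def using not_le by blast
  then have infS: "infinite S" using inf finite_subset by blast
  have main: "1 \<le> n \<and> (\<exists>h. (\<forall>i. C / (B i ^ n * exp (\<tau>2 * real n)) \<le> 1 / B i ^ h i) \<and>
      (\<forall>a. (\<forall>i. full (B i) (n - 1) (a i)) \<longrightarrow>
        (\<exists>e. (\<forall>i. full (B i) (h i) (e i) \<and> a i \<le> e i \<and> e i + 1 / B i ^ h i < a i + 1 / B i ^ (n - 1)) \<and>
          (\<forall>x. (\<forall>i. e i \<le> torus_rep x $ i \<and> torus_rep x $ i \<le> e i + 1 / B i ^ h i) \<longrightarrow>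
            x \<in> hit_set B (f n) (\<psi> n) n))))" if n: "n \<in> S" for n
  proof (cases n)
    case 0
    then show ?thesis using n by (simp add: S_def)
  next
    case (Suc N)
    define \<rho> where "\<rho> = \<eta> / 3 * exp (- \<tau>1 * real n)"
    have "exp (- \<tau>1 * real n) \<le> 1" using \<tau> by simp
    then have "\<rho> \<le> \<eta> / 3 * 1" unfolding \<rho>_def using \<eta>(1) by (intro mult_left_mono) auto
    moreover have "0 < \<rho>" unfolding \<rho>_def using \<eta>(1) by simp
    ultimately have \<rho>: "0 < \<rho>" "\<rho> \<le> \<eta>" using \<eta>(1) by auto
    have "3 * \<rho> \<le> 1 * exp (- \<tau>1 * real n)" unfolding \<rho>_def using \<eta> by simp
    then have \<rho>\<psi>: "3 * \<rho> \<le> \<psi> n" using n by (simp add: S_def)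
    have len: "0 < 2 * \<rho> / B i" "2 * \<rho> / B i \<le> 1" for i
      using \<rho> \<eta>(1,2) \<eta>(3)[of i] B0[of i] by (auto simp: field_simps)
    define r where "r i = K i * (2 * \<rho> / B i) powr \<sigma>" for i
    have r: "0 < r i" "r i \<le> 1" for i
    proof -
      show "0 < r i" unfolding r_def using K(1)[of i] len(1)[of i] by (intro mult_pos_pos) auto
      \<comment> \<open>The bound \<open>r i \<le> 1\<close> comes from the interval property
        itself: \<open>r i\<close> is at most the length of an actual cylinder.\<close>
      obtain n a where "full (B i) n a" "K i * (2 * \<rho> / B i - 0) powr \<sigma> \<le> 1 / B i ^ n"
        using K(2)[of 0 "2 * \<rho> / B i" i] len[of i] by auto
      moreover have "1 / B i ^ n \<le> 1" using B[of i] by simp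
      ultimately show "r i \<le> 1" by (simp add: r_def)
    qed
    have "\<exists>H. 1 / B i ^ H \<le> r i \<and> r i / B i < 1 / B i ^ H" for i
      using power_between[OF B r] by metis
    \<comment> \<open>One order for all cylinders, chosen from the guaranteed length alone. The
      cylinder found below may be longer and is then cut down by \<open>full_pad\<close>.\<close>
    then obtain H where H: "\<And>i. 1 / B i ^ H i \<le> r i" "\<And>i. r i / B i < 1 / B i ^ H i" by metis
    define h where "h i = N + H i" for i
    have size: "C / (B i ^ n * exp (\<tau>2 * real n)) \<le> 1 / B i ^ h i" for i
    proof -
      have "2 * \<rho> / B i = (2 * \<eta> / (3 * B i)) * exp (- \<tau>1 * real n)" by (simp add: \<rho>_def)
      then have "(2 * \<rho> / B i) powr \<sigma> = (2 * \<eta> / (3 * B i)) powr \<sigma> * exp (- \<tau>1 * real n) powr \<sigma>"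
        using powr_mult by metis
      then have "r i = K' i * exp (- \<tau>1 * real n) powr \<sigma>"
        unfolding r_def K'_def by (simp only: mult.assoc)
      also have "exp (- \<tau>1 * real n) powr \<sigma> = exp (- (\<tau>2 * real n))"
        using \<tau> by (simp add: powr_def \<sigma>_def)
      finally have ri: "r i = K' i / exp (\<tau>2 * real n)" by (simp add: exp_minus field_simps)
      have "C / (B i ^ n * exp (\<tau>2 * real n)) \<le> K' i / (B i ^ n * exp (\<tau>2 * real n))"
        using C(2) B0[of i] by (intro divide_right_mono) auto
      also have "\<dots> = (1 / B i ^ N) * (r i / B i)" by (simp add: ri Suc)
      also have "\<dots> \<le> (1 / B i ^ N) * (1 / B i ^ H i)" using H(2)[of i] B0[of i] by (intro mult_left_mono) auto
      also have "\<dots> = 1 / B i ^ h i" by (simp add: h_def power_add)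
      finally show ?thesis .
    qed
    have box: "\<exists>e. (\<forall>i. full (B i) (h i) (e i) \<and> a i \<le> e i \<and> e i + 1 / B i ^ h i < a i + 1 / B i ^ (n - 1)) \<and>
          (\<forall>x. (\<forall>i. e i \<le> torus_rep x $ i \<and> torus_rep x $ i \<le> e i + 1 / B i ^ h i) \<longrightarrow>
            x \<in> hit_set B (f n) (\<psi> n) n)" if a: "\<And>i. full (B i) N (a i)" for a
    proof -
      have cN: "c * (2 * real CARD('n)) \<le> \<eta> * b ^ Suc N" using n Suc by (simp add: S_def)
      obtain z where z: "\<And>i. \<rho> \<le> z i" "\<And>i. z i + \<rho> < B i"
        "\<And>x. (\<And>i. \<bar>torus_rep x $ i - (a i + z i / B i ^ Suc N)\<bar> \<le> \<rho> / B i ^ Suc N)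
          \<Longrightarrow> x \<in> hit_set B (f n) (3 * \<rho>) (Suc N)"
        using fixed_point_box[of b B "f n" c \<eta> N \<rho> a, OF b lip c \<eta> cN \<rho> a] Suc by auto
      have "\<exists>w. full (B i) (H i) w \<and> (z i - \<rho>) / B i \<le> w \<and> w + 1 / B i ^ H i \<le> (z i + \<rho>) / B i" for i
      proof -
        have "0 \<le> (z i - \<rho>) / B i" "(z i - \<rho>) / B i < (z i + \<rho>) / B i" "(z i + \<rho>) / B i \<le> 1"
          using z(1,2)[of i] B0[of i] \<rho> by (auto intro: divide_strict_right_mono)
        from K(2)[OF this] obtain m w where w: "full (B i) m w" "(z i - \<rho>) / B i \<le> w"
          "w + 1 / B i ^ m \<le> (z i + \<rho>) / B i" "K i * ((z i + \<rho>) / B i - (z i - \<rho>) / B i) powr \<sigma> \<le> 1 / B i ^ m"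
          by blast
        have "(z i + \<rho>) / B i - (z i - \<rho>) / B i = 2 * \<rho> / B i" by (simp add: diff_divide_distrib[symmetric])
        then have le: "1 / B i ^ H i \<le> 1 / B i ^ m" using w(4) H(1)[of i] by (simp add: r_def)
        then have "B i ^ m \<le> B i ^ H i" using B0[of i] by (simp add: field_simps)
        then have "m \<le> H i" using B[of i] by simp
        then have "full (B i) (H i) w" using full_pad[OF w(1) B] by blast
        moreover have "w + 1 / B i ^ H i \<le> (z i + \<rho>) / B i" using w(3) le by linarith
        ultimately show ?thesis using w(2) by blast
      qed
      then obtain w where w: "\<And>i. full (B i) (H i) (w i)" "\<And>i. (z i - \<rho>) / B i \<le> w i"
        "\<And>i. w i + 1 / B i ^ H i \<le> (z i + \<rho>) / B i" by metis
      define e where "e i = a i + w i / B i ^ N" for i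
      have top: "e i + 1 / B i ^ h i = a i + (w i + 1 / B i ^ H i) / B i ^ N" for i
        by (simp add: e_def h_def power_add add_divide_distrib mult.commute)
      have top_le: "e i + 1 / B i ^ h i \<le> a i + (z i + \<rho>) / B i ^ Suc N" for i
      proof -
        have "(w i + 1 / B i ^ H i) / B i ^ N \<le> (z i + \<rho>) / B i / B i ^ N"
          using w(3) B0[of i] by (intro divide_right_mono) auto
        then show ?thesis unfolding top by simp
      qed
      have bot: "a i + (z i - \<rho>) / B i ^ Suc N \<le> e i" for i
      proof -
        have "(z i - \<rho>) / B i / B i ^ N \<le> w i / B i ^ N"
          using w(2) B0[of i] by (intro divide_right_mono) auto
        then show ?thesis unfolding e_def by simp
      qed
      show ?thesis
      proof (intro exI[of _ e] conjI allI impI)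
        fix i
        show "full (B i) (h i) (e i)" unfolding h_def e_def by (rule full_add[OF a w(1) B])
        show "a i \<le> e i" unfolding e_def using fullD(1)[OF w(1)] B0[of i] by simp
        have "(z i + \<rho>) / B i / B i ^ N < 1 / B i ^ N"
          using z(2)[of i] B0[of i] by (intro divide_strict_right_mono) auto
        then show "e i + 1 / B i ^ h i < a i + 1 / B i ^ (n - 1)" using top_le[of i] Suc by simp
      next
        fix x assume x: "\<forall>i. e i \<le> torus_rep x $ i \<and> torus_rep x $ i \<le> e i + 1 / B i ^ h i"
        have "x \<in> hit_set B (f n) (3 * \<rho>) (Suc N)"
        proof (rule z(3))
          fix i
          have "a i + (z i - \<rho>) / B i ^ Suc N \<le> torus_rep x $ i"
            "torus_rep x $ i \<le> a i + (z i + \<rho>) / B i ^ Suc N"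
            using x bot[of i] top_le[of i] order_trans by blast+
          then show "\<bar>torus_rep x $ i - (a i + z i / B i ^ Suc N)\<bar> \<le> \<rho> / B i ^ Suc N"
            unfolding abs_le_iff add_divide_distrib diff_divide_distrib by linarith
        qed
        then show "x \<in> hit_set B (f n) (\<psi> n) n" using hit_set_mono[OF \<rho>\<psi>] Suc by blast
      qed
    qed
    show ?thesis using size box Suc by (intro conjI exI[of _ h] allI impI) auto
  qed
  show ?thesis by (rule that[OF C(1) infS main])
qed

section \<open>The rate function\<close>

text \<open>In coordinate \<open>j\<close> an interval of length exp (- n x) has mass about exp (- n
  x) as long as it exceeds a cylinder, exp (- n l j) while its length is between those of a cylinder
  and of the box inside, and a proportional part of exp (- n l j) once it is shorter than the box.
  The summand is minus the exponent divided by \<open>n\<close>.\<close>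

definition rate :: "('n::finite \<Rightarrow> real) \<Rightarrow> real \<Rightarrow> real \<Rightarrow> real" where
  "rate l \<tau> x = (\<Sum>j\<in>UNIV. min (l j) x + max 0 (x - l j - \<tau>))"

text \<open>Between consecutive points \<^term>\<open>l i + \<tau>\<close> the function \<^term>\<open>rate l \<tau>\<close> is concave, so that
  a linear lower bound has to be checked at these points only.\<close>

lemma rate_ge_linear:
  fixes l :: "'n::finite \<Rightarrow> real"
  assumes l: "\<And>i. 0 < l i" and \<tau>: "0 \<le> \<tau>" and x: "0 \<le> x"
    and s: "\<And>i. s * (l i + \<tau>) \<le> rate l \<tau> (l i + \<tau>)"
  shows "s * x \<le> rate l \<tau> x"
proof -
  \<comment> \<open>Only at the points l i + \<tau> can a summand bend upwards; 0 is added as a left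
    end.\<close>
  define M where "M = insert 0 (range (\<lambda>i. l i + \<tau>))"
  have fin: "finite M" by (simp add: M_def)
  have sM: "s * y \<le> rate l \<tau> y" if "y \<in> M" for y
  proof (cases "y = 0")
    case True
    have "rate l \<tau> 0 = 0" using l \<tau> unfolding rate_def 
      by (intro sum.neutral ballI) (smt (verit, best))
    then show ?thesis using True by simp
  qed (use that s in \<open>auto simp: M_def\<close>)
  define p where "p = Max (M \<inter> {..x})"
  have "0 \<in> M \<inter> {..x}" using x by (simp add: M_def)
  then have p: "p \<in> M" "p \<le> x" "\<And>y. y \<in> M \<Longrightarrow> y \<le> x \<Longrightarrow> y \<le> p"
  proof -
    have "p \<in> M \<inter> {..x}" unfolding p_def by (rule Max_in) (use fin \<open>0 \<in> M \<inter> {..x}\<close> in auto)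
    then show "p \<in> M" "p \<le> x" by auto
    show "y \<le> p" if "y \<in> M" "y \<le> x" for y unfolding p_def using fin that by (intro Max_ge) auto
  qed
  have p0: "0 \<le> p" using p(3)[of 0] x by (simp add: M_def)
  show ?thesis
  proof (cases "M \<inter> {x<..} = {}")
    case False
    define q where "q = Min (M \<inter> {x<..})"
    have q: "q \<in> M" "x < q" "\<And>y. y \<in> M \<Longrightarrow> x < y \<Longrightarrow> q \<le> y"
    proof -
      have "q \<in> M \<inter> {x<..}" unfolding q_def by (rule Min_in) (use fin False in auto)
      then show "q \<in> M" "x < q" by auto
      show "q \<le> y" if "y \<in> M" "x < y" for y unfolding q_def using fin that by (intro Min_le) auto
    qed
    have pq: "0 < q - p" using p q by linarith
    define u where "u = (x - p) / (q - p)"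
    have u: "0 \<le> u" "u \<le> 1" using p q pq by (auto simp: u_def)
    have xu: "x = (1 - u) * p + u * q"
    proof -
      have "u * (q - p) = x - p" using pq by (simp add: u_def)
      then show ?thesis by (simp add: algebra_simps)
    qed
    have concave: "(1 - u) * (min (l j) p + max 0 (p - l j - \<tau>)) + u * (min (l j) q + max 0 (q - l j - \<tau>))
        \<le> min (l j) x + max 0 (x - l j - \<tau>)" for j
    proof -
      have "(1 - u) * min (l j) p + u * min (l j) q \<le> min (l j) x"
      proof (rule min.boundedI)
        have "(1 - u) * min (l j) p + u * min (l j) q \<le> (1 - u) * l j + u * l j"
          using u by (intro add_mono mult_left_mono) auto
        then show "(1 - u) * min (l j) p + u * min (l j) q \<le> l j" by (simp add: algebra_simps)
        show "(1 - u) * min (l j) p + u * min (l j) q \<le> x"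
          unfolding xu using u by (intro add_mono mult_left_mono) auto
      qed
      \<comment> \<open>No bend of this convex term lies strictly between \<open>p\<close> and
        \<open>q\<close>, so it is affine there.\<close>
      moreover have "(1 - u) * max 0 (p - l j - \<tau>) + u * max 0 (q - l j - \<tau>) \<le> max 0 (x - l j - \<tau>)"
      proof (cases "l j + \<tau> \<le> x")
        case True
        then have "l j + \<tau> \<le> p" using p(3) by (auto simp: M_def)
        then have "max 0 (p - l j - \<tau>) = p - l j - \<tau>" "max 0 (q - l j - \<tau>) = q - l j - \<tau>"
          using p q by auto
        then have "(1 - u) * max 0 (p - l j - \<tau>) + u * max 0 (q - l j - \<tau>) = x - l j - \<tau>"
          unfolding xu by (simp add: algebra_simps)
        then show ?thesis by simp
      next
        case False
        then have "q \<le> l j + \<tau>" using q(3)[of "l j + \<tau>"] by (auto simp: M_def)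
        then have "max 0 (p - l j - \<tau>) = 0" "max 0 (q - l j - \<tau>) = 0" using p q by auto
        then show ?thesis by simp
      qed
      ultimately show ?thesis unfolding distrib_left by linarith
    qed
    have "s * x = (1 - u) * (s * p) + u * (s * q)" unfolding xu by (simp add: algebra_simps)
    also have "\<dots> \<le> (1 - u) * rate l \<tau> p + u * rate l \<tau> q"
      using u sM p(1) q(1) by (intro add_mono mult_left_mono) auto
    also have "\<dots> \<le> rate l \<tau> x"
      unfolding rate_def sum_distrib_left sum.distrib[symmetric] by (intro sum_mono concave)
    finally show ?thesis .
  next
    case True
    \<comment> \<open>Beyond the last bend the rate is \<open>CARD('n) * (y - \<tau>)\<close>, and
      the inequality at \<open>p\<close> forces \<open>s \<le> CARD('n)\<close>, so it persists to
      the right.\<close>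
    have all: "l j + \<tau> \<le> p" for j
    proof -
      have "l j + \<tau> \<in> M" by (simp add: M_def)
      moreover from this have "\<not> x < l j + \<tau>" using True by blast
      ultimately show ?thesis using p(3) by simp
    qed
    have eq: "rate l \<tau> y = real CARD('n) * (y - \<tau>)" if "p \<le> y" for y
    proof -
      have "min (l j) y + max 0 (y - l j - \<tau>) = y - \<tau>" for j
        using all[of j] that \<tau> by auto
      then show ?thesis by (simp add: rate_def)
    qed
    have p1: "0 < p" using all[of undefined] l[of undefined] \<tau> by linarith
    have "s * p \<le> real CARD('n) * (p - \<tau>)" using sM[OF p(1)] eq[of p] by simp
    also have "\<dots> \<le> real CARD('n) * p" using \<tau> by (intro mult_left_mono) auto
    finally have "s \<le> real CARD('n)" using p1 by simp
    then have "s * (x - p) \<le> real CARD('n) * (x - p)" using p(2) by (intro mult_right_mono) auto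
    then show ?thesis using sM[OF p(1)] eq[of p] eq[of x] p(2) by (simp add: algebra_simps)
  qed
qed

lemma rate_0: "rate l 0 (l i) = real CARD('n) * l (i :: 'n::finite)"
proof -
  have "min (l j) (l i) + max 0 (l i - l j - 0) = l i" for j by (simp add: min_def max_def)
  then show ?thesis by (simp add: rate_def)
qed

lemma continuous_rate: "continuous_on UNIV (\<lambda>\<tau>. rate l \<tau> (a + \<tau>))"
  unfolding rate_def by (intro continuous_intros)

section \<open>Lower bound\<close>

lemma circle_dist_le_of_dist:
  assumes "\<And>x y. x \<in> U \<Longrightarrow> y \<in> U \<Longrightarrow> dist x y \<le> r" "x \<in> U" "y \<in> U"
  shows "circle_dist (torus_rep x $ i) (torus_rep y $ i) \<le> r"
  using assms circle_dist_le_dist order_trans by blast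

text \<open>A box of level \<^term>\<open>k\<close> is a product of full cylinders of the orders \<^term>\<open>h k\<close>.  Its
  subcells are all products of full cylinders of the common order \<^term>\<open>t (Suc k)\<close>, and
  \<^term>\<open>e (Suc k)\<close> selects one box of level \<^term>\<open>Suc k\<close> in each of them.\<close>

locale cantor_scheme =
  fixes B :: "'n::finite \<Rightarrow> real" and t :: "nat \<Rightarrow> nat" and h :: "nat \<Rightarrow> 'n \<Rightarrow> nat"
    and e :: "nat \<Rightarrow> ('n \<Rightarrow> real) \<Rightarrow> ('n \<Rightarrow> real)"
  assumes B: "\<And>i. 1 < B i"
    and h_0: "\<And>i. h 0 i = 0"
    and h_le: "\<And>k i. h k i \<le> t (Suc k)"
    and e: "\<And>k a i. (\<And>i. full (B i) (t (Suc k)) (a i)) \<Longrightarrow>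
      full (B i) (h (Suc k) i) (e (Suc k) a i) \<and> a i \<le> e (Suc k) a i \<and>
      e (Suc k) a i + 1 / B i ^ h (Suc k) i < a i + 1 / B i ^ t (Suc k)"
begin

section \<open>Addresses of boxes and cells\<close>

definition digits :: "nat \<Rightarrow> 'n \<Rightarrow> real set" where
  "digits k i = {w. full (B i) (t (Suc k) - h k i) w}"

definition branching :: "nat \<Rightarrow> nat" where
  "branching k = (\<Prod>i\<in>UNIV. card (digits k i))"

definition enum_digits :: "nat \<Rightarrow> nat \<Rightarrow> 'n \<Rightarrow> real" where
  "enum_digits k = (SOME g. bij_betw g {0..<branching k} (PiE UNIV (digits k)))"

primrec num_boxes :: "nat \<Rightarrow> nat" where
  "num_boxes 0 = 1"
| "num_boxes (Suc k) = num_boxes k * branching k"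

definition subcell :: "nat \<Rightarrow> ('n \<Rightarrow> real) \<Rightarrow> nat \<Rightarrow> 'n \<Rightarrow> real" where
  "subcell k a m = (\<lambda>i. a i + enum_digits k m i / B i ^ h k i)"

text \<open>The path to a box is one number in mixed radix: the quotient is the parent and the
  remainder chooses the subcell. In this form the integer part of \<open>u * num_boxes k\<close> is
  the address at level \<open>k\<close> of a parameter \<open>u\<close> in [0, 1).\<close>

primrec box_at :: "nat \<Rightarrow> nat \<Rightarrow> 'n \<Rightarrow> real" where
  "box_at 0 m = (\<lambda>i. 0)"
| "box_at (Suc k) m = e (Suc k) (subcell k (box_at k (m div branching k)) (m mod branching k))"

definition cell :: "nat \<Rightarrow> nat \<Rightarrow> 'n \<Rightarrow> real" where
  "cell k m = subcell k (box_at k (m div branching k)) (m mod branching k)"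

lemma B_pos: "0 < B i" using B[of i] by linarith

lemma finite_digits: "finite (digits k i)"
  unfolding digits_def using finite_full[OF B] .

lemma bij_enum_digits: "bij_betw (enum_digits k) {0..<branching k} (PiE UNIV (digits k))"
proof -
  have "card (PiE UNIV (digits k)) = branching k" by (simp add: card_PiE branching_def)
  moreover have "finite (PiE UNIV (digits k))" using finite_digits by (intro finite_PiE) auto
  ultimately show ?thesis
    unfolding enum_digits_def using ex_bij_betw_nat_finite[of "PiE UNIV (digits k)"] by (metis (full_types) someI)
qed

lemma branching_pos: "0 < branching k"
proof -
  have "0 \<in> digits k i" for i using full_zero[OF B] by (simp add: digits_def)
  then have "0 < card (digits k i)" for i using finite_digits card_gt_0_iff by blast
  then show ?thesis unfolding branching_def by (intro prod_pos) auto
qed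

lemma num_pos: "0 < num_boxes k"
  by (induction k) (use branching_pos in auto)

lemma enum_digits_full: "m < branching k \<Longrightarrow> full (B i) (t (Suc k) - h k i) (enum_digits k m i)"
  using bij_betw_apply[OF bij_enum_digits[of k], of m] by (auto simp: digits_def PiE_def)

lemma subcell_full:
  assumes "full (B i) (h k i) (a i)" "m < branching k"
  shows "full (B i) (t (Suc k)) (subcell k a m i)"
  using full_add[OF assms(1) enum_digits_full[OF assms(2)] B] h_le[of k i] by (simp add: subcell_def)

lemma mod_branching_less: "m mod branching k < branching k"
  using branching_pos by simp

lemma box_full: "full (B i) (h k i) (box_at k m i)"
proof (induction k arbitrary: m i)
  case 0
  then show ?case by (simp add: h_0 full_0)
next
  case (Suc k)
  have "full (B j) (t (Suc k)) (subcell k (box_at k (m div branching k)) (m mod branching k) j)" for j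
    by (rule subcell_full[OF Suc mod_branching_less])
  from e[OF this] show ?case by simp
qed

lemma cell_full: "full (B i) (t (Suc k)) (cell k m i)"
  unfolding cell_def by (rule subcell_full[OF box_full mod_branching_less])

lemma box_Suc: "box_at (Suc k) m = e (Suc k) (cell k m)"
  by (simp add: cell_def)

lemma box_in_cell:
  "cell k m i \<le> box_at (Suc k) m i"
  "box_at (Suc k) m i + 1 / B i ^ h (Suc k) i < cell k m i + 1 / B i ^ t (Suc k)"
  using e[of k "cell k m" i] cell_full[of _ k m] unfolding box_Suc by blast+

lemma cell_in_box:
  "box_at k (m div branching k) i \<le> cell k m i"
  "cell k m i + 1 / B i ^ t (Suc k) \<le> box_at k (m div branching k) i + 1 / B i ^ h k i"
proof -
  define w where "w = enum_digits k (m mod branching k) i"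
  have w: "full (B i) (t (Suc k) - h k i) w"
    unfolding w_def by (rule enum_digits_full[OF mod_branching_less])
  have c: "cell k m i = box_at k (m div branching k) i + w / B i ^ h k i"
    by (simp add: cell_def subcell_def w_def)
  show "box_at k (m div branching k) i \<le> cell k m i"
    unfolding c using fullD(1)[OF w] B_pos[of i] by simp
  have "(w + 1 / B i ^ (t (Suc k) - h k i)) / B i ^ h k i \<le> 1 / B i ^ h k i"
    using fullD(2)[OF w] B_pos[of i] by (intro divide_right_mono) auto
  then show "cell k m i + 1 / B i ^ t (Suc k) \<le> box_at k (m div branching k) i + 1 / B i ^ h k i"
    unfolding c using h_le[of k i] B_pos[of i]
    by (simp add: add_divide_distrib power_add[symmetric] mult.commute)
qed

lemma full_unique:
  assumes "full (B i) n a" "full (B i) n b" "a \<le> x" "x < a + 1 / B i ^ n" "b \<le> x" "x < b + 1 / B i ^ n"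
  shows "a = b"
  using full_separated[OF assms(1,2) B] full_separated[OF assms(2,1) B] assms(3-6)
  by (cases a b rule: linorder_cases) auto

text \<open>Full cylinders of equal order are disjoint, so a cell determines the box around it and a
  box determines the cell around it. Counting addresses is thereby reduced to counting
  cylinders.\<close>

lemma inj_cell_box: "inj_on (box_at k) {..<num_boxes k} \<and> inj_on (cell k) {..<num_boxes (Suc k)}"
proof (induction k)
  have step: "inj_on (cell k) {..<num_boxes (Suc k)}" if inj: "inj_on (box_at k) {..<num_boxes k}" for k
  proof (rule inj_onI)
    fix m m' assume m: "m \<in> {..<num_boxes (Suc k)}" "m' \<in> {..<num_boxes (Suc k)}" and eq: "cell k m = cell k m'"
    have lt: "cell k m i < cell k m i + 1 / B i ^ t (Suc k)" for m i using B_pos[of i] by simp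
    have "box_at k (m div branching k) i = box_at k (m' div branching k) i" for i
      by (rule full_unique[OF box_full box_full, where x = "cell k m i"])
        (use cell_in_box[of k m i] cell_in_box[of k m' i] fun_cong[OF eq, of i] lt[of m i] in linarith)+
    then have "box_at k (m div branching k) = box_at k (m' div branching k)" by blast
    moreover have "m div branching k < num_boxes k" "m' div branching k < num_boxes k"
      using m by (auto simp: less_mult_imp_div_less)
    ultimately have d: "m div branching k = m' div branching k"
      using inj by (auto dest: inj_onD)
    have "enum_digits k (m mod branching k) i = enum_digits k (m' mod branching k) i" for i
      using fun_cong[OF eq, of i] d B_pos[of i] by (simp add: cell_def subcell_def)
    then have "enum_digits k (m mod branching k) = enum_digits k (m' mod branching k)" by blast
    then have "m mod branching k = m' mod branching k"
      using bij_betw_imp_inj_on[OF bij_enum_digits[of k]] mod_branching_less by (auto dest: inj_onD)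
    with d show "m = m'" by (metis div_mult_mod_eq)
  qed
  {
    case 0
    have "inj_on (box_at 0) {..<num_boxes 0}" by (rule inj_onI) simp
    then show ?case using step[of 0] by blast
  next
    case (Suc k)
    have "inj_on (box_at (Suc k)) {..<num_boxes (Suc k)}"
    proof (rule inj_onI)
      fix m m' assume m: "m \<in> {..<num_boxes (Suc k)}" "m' \<in> {..<num_boxes (Suc k)}" and eq: "box_at (Suc k) m = box_at (Suc k) m'"
      have lt: "box_at (Suc k) m i < box_at (Suc k) m i + 1 / B i ^ h (Suc k) i" for m i using B_pos[of i] by simp
      have "cell k m i = cell k m' i" for i
        by (rule full_unique[OF cell_full cell_full, where x = "box_at (Suc k) m i"])
          (use box_in_cell[of k m i] box_in_cell[of k m' i] fun_cong[OF eq, of i] lt[of m i] lt[of m' i] in linarith)+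
      then have "cell k m = cell k m'" by blast
      then show "m = m'" using Suc m by (auto dest: inj_onD)
    qed
    then show ?case using step[of "Suc k"] by blast
  }
qed

section \<open>Parametrisation of the limit set by the unit interval\<close>

definition idx :: "nat \<Rightarrow> real \<Rightarrow> nat" where
  "idx k u = nat \<lfloor>u * real (num_boxes k)\<rfloor>"

lemma idx_div: "0 \<le> u \<Longrightarrow> idx (Suc k) u div branching k = idx k u"
proof -
  assume u: "0 \<le> u"
  have "\<lfloor>u * real (num_boxes k)\<rfloor> = \<lfloor>(u * real (num_boxes (Suc k))) / real_of_int (int (branching k))\<rfloor>"
    using branching_pos[of k] by simp
  also have "\<dots> = \<lfloor>u * real (num_boxes (Suc k))\<rfloor> div int (branching k)" by (rule floor_divide_real_eq_div) simp
  finally show ?thesis using u unfolding idx_def by (simp only: nat_div_distrib[of "\<lfloor>u * real (num_boxes (Suc k))\<rfloor>"] zero_le_floor of_nat_0_le_iff zero_le_mult_iff nat_int simp_thms)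
qed

lemma idx_less: "0 \<le> u \<Longrightarrow> u < 1 \<Longrightarrow> idx k u < num_boxes k"
proof -
  assume u: "0 \<le> u" "u < 1"
  have "u * real (num_boxes k) < 1 * real (num_boxes k)" using u num_pos[of k] by (intro mult_strict_right_mono) auto
  then show ?thesis unfolding idx_def using u num_pos[of k] by (simp add: nat_less_iff floor_less_iff)
qed

definition pt :: "real \<Rightarrow> 'n \<Rightarrow> real" where
  "pt u i = (SUP k. box_at k (idx k u) i)"

definition limit_point :: "real \<Rightarrow> 'n torus" where
  "limit_point u = torus_abs (\<chi> i. pt u i)"

lemma box_mono:
  assumes "0 \<le> u" "k \<le> k'"
  shows "box_at k (idx k u) i \<le> box_at k' (idx k' u) i"
    and "box_at k' (idx k' u) i + 1 / B i ^ h k' i \<le> box_at k (idx k u) i + 1 / B i ^ h k i"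
proof -
  have "box_at k (idx k u) i \<le> box_at k' (idx k' u) i \<and>
    box_at k' (idx k' u) i + 1 / B i ^ h k' i \<le> box_at k (idx k u) i + 1 / B i ^ h k i"
    using assms(2)
  proof (induction k' rule: dec_induct)
    case (step n)
    have "idx (Suc n) u div branching n = idx n u" by (rule idx_div[OF assms(1)])
    then show ?case
      using step.IH box_in_cell[of n "idx (Suc n) u" i] cell_in_box[of n "idx (Suc n) u" i] by simp
  qed auto
  then show "box_at k (idx k u) i \<le> box_at k' (idx k' u) i"
    and "box_at k' (idx k' u) i + 1 / B i ^ h k' i \<le> box_at k (idx k u) i + 1 / B i ^ h k i" by auto
qed

lemma pt_in_box:
  assumes "0 \<le> u"
  shows "box_at k (idx k u) i \<le> pt u i" "pt u i \<le> box_at k (idx k u) i + 1 / B i ^ h k i"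
proof -
  have up: "box_at k' (idx k' u) i \<le> box_at k (idx k u) i + 1 / B i ^ h k i" for k'
  proof -
    have 1: "box_at k' (idx k' u) i \<le> box_at (max k k') (idx (max k k') u) i"
      by (rule box_mono(1)[OF assms]) simp
    have 2: "box_at (max k k') (idx (max k k') u) i + 1 / B i ^ h (max k k') i \<le> box_at k (idx k u) i + 1 / B i ^ h k i"
      by (rule box_mono(2)[OF assms]) simp
    have "0 < 1 / B i ^ h (max k k') i" using B_pos[of i] by simp
    then show ?thesis using 1 2 by linarith
  qed
  then have "bdd_above (range (\<lambda>k. box_at k (idx k u) i))" by (intro bdd_aboveI2)
  then show "box_at k (idx k u) i \<le> pt u i" unfolding pt_def by (intro cSUP_upper) auto
  show "pt u i \<le> box_at k (idx k u) i + 1 / B i ^ h k i"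
    unfolding pt_def by (rule cSUP_least) (use up in auto)
qed

text \<open>A supremum of left ends could be the right end of a box. A box ends strictly before its
  cell does, which keeps the limit point inside the half-open cell, and below 1.\<close>

lemma pt_in_cell:
  assumes "0 \<le> u"
  shows "cell k (idx (Suc k) u) i \<le> pt u i" "pt u i < cell k (idx (Suc k) u) i + 1 / B i ^ t (Suc k)"
  using pt_in_box[OF assms, where k = "Suc k" and i = i] box_in_cell[of k "idx (Suc k) u" i] by linarith+

lemma rep_limit_point:
  assumes "0 \<le> u"
  shows "torus_rep (limit_point u) $ i = pt u i"
  unfolding limit_point_def
proof (rule torus_rep_abs)
  fix i
  show "0 \<le> pt u i \<and> pt u i < 1"
    using pt_in_cell[OF assms, where k = 0 and i = i] fullD(1,2)[OF cell_full[of i 0 "idx (Suc 0) u"]] by linarith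
qed

section \<open>Counting the cells that meet a small set\<close>

definition hits :: "nat \<Rightarrow> 'n torus set \<Rightarrow> nat set" where
  "hits k U = {m. m < num_boxes (Suc k) \<and>
    (\<exists>x\<in>U. \<forall>i. cell k m i \<le> torus_rep x $ i \<and> torus_rep x $ i < cell k m i + 1 / B i ^ t (Suc k))}"

lemma finite_hits: "finite (hits k U)"
  by (rule finite_subset[of _ "{..<num_boxes (Suc k)}"]) (auto simp: hits_def)

lemma card_hits:
  assumes r: "0 < r" and U: "\<And>x y. x \<in> U \<Longrightarrow> y \<in> U \<Longrightarrow> dist x y \<le> r" and "U \<noteq> {}"
  shows "real (card (hits k U)) \<le> (\<Prod>i\<in>UNIV. 3 * (2 * r * B i ^ t (Suc k) + 2))"
proof -
  obtain y where y: "y \<in> U" using assms by blast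
  define S where "S i = {a. full (B i) (t (Suc k)) a \<and> (\<exists>x. a \<le> x \<and> x < a + 1 / B i ^ t (Suc k) \<and>
      circle_dist x (torus_rep y $ i) \<le> r)}" for i
  have "finite (S i)" for i unfolding S_def using finite_full[OF B[of i], of "t (Suc k)"] by (rule rev_finite_subset) auto
  then have fin: "finite (PiE UNIV S)" by (intro finite_PiE) auto
  have "inj_on (cell k) (hits k U)"
    using inj_cell_box[of k] by (rule inj_on_subset[OF conjunct2]) (auto simp: hits_def)
  moreover have "cell k ` hits k U \<subseteq> PiE UNIV S"
  proof clarify
    fix m assume "m \<in> hits k U"
    then obtain x where x: "x \<in> U" "\<And>i. cell k m i \<le> torus_rep x $ i"
      "\<And>i. torus_rep x $ i < cell k m i + 1 / B i ^ t (Suc k)" by (auto simp: hits_def)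
    have "cell k m i \<in> S i" for i
      unfolding S_def using cell_full x circle_dist_le_of_dist[OF U x(1) y] by blast
    then show "cell k m \<in> PiE UNIV S" by auto
  qed
  ultimately have "card (hits k U) \<le> card (PiE UNIV S)" using fin card_inj_on_le by blast
  then have "real (card (hits k U)) \<le> (\<Prod>i\<in>UNIV. real (card (S i)))" by (simp add: card_PiE flip: of_nat_prod)
  also have "\<dots> \<le> (\<Prod>i\<in>UNIV. 3 * (2 * r * B i ^ t (Suc k) + 2))"
    unfolding S_def by (intro prod_mono conjI card_full_near B r torus_rep_bounds) auto
  finally show ?thesis .
qed

text \<open>Under one box each coordinate offers at most all its digits and at most the cells near
  \<open>U\<close>. The minimum is taken coordinate by coordinate, since a box can be longer than
  \<open>r\<close> in some directions and shorter in others.\<close>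

lemma card_hits_Suc:
  assumes r: "0 < r" and U: "\<And>x y. x \<in> U \<Longrightarrow> y \<in> U \<Longrightarrow> dist x y \<le> r" and "U \<noteq> {}"
  shows "real (card (hits (Suc k) U)) \<le> real (card (hits k U)) *
    (\<Prod>i\<in>UNIV. min (real (card (digits (Suc k) i))) (3 * (2 * r * B i ^ t (Suc (Suc k)) + 2)))"
proof -
  let ?K = "\<Prod>i\<in>UNIV. min (real (card (digits (Suc k) i))) (3 * (2 * r * B i ^ t (Suc (Suc k)) + 2))"
  let ?A = "branching (Suc k)"
  obtain y where y: "y \<in> U" using assms by blast
  have sub: "hits (Suc k) U \<subseteq> (\<Union>p\<in>hits k U. {m \<in> hits (Suc k) U. m div ?A = p})"
  proof
    fix m assume m: "m \<in> hits (Suc k) U"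
    then obtain x where x: "x \<in> U" "\<And>i. cell (Suc k) m i \<le> torus_rep x $ i"
      "\<And>i. torus_rep x $ i < cell (Suc k) m i + 1 / B i ^ t (Suc (Suc k))" and lt: "m < num_boxes (Suc (Suc k))"
      by (auto simp: hits_def)
    have "cell k (m div ?A) i \<le> torus_rep x $ i \<and> torus_rep x $ i < cell k (m div ?A) i + 1 / B i ^ t (Suc k)" for i
      using x(2,3)[of i] cell_in_box[of "Suc k" m i] box_in_cell[of k "m div ?A" i] by linarith
    moreover have "m div ?A < num_boxes (Suc k)" using lt by (simp add: less_mult_imp_div_less)
    ultimately have "m div ?A \<in> hits k U" using x(1) by (auto simp: hits_def)
    then show "m \<in> (\<Union>p\<in>hits k U. {m \<in> hits (Suc k) U. m div ?A = p})" using m by blast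
  qed
  have fib: "real (card {m \<in> hits (Suc k) U. m div ?A = p}) \<le> ?K" for p
  proof -
    let ?F = "{m \<in> hits (Suc k) U. m div ?A = p}"
    define S where "S i = {w \<in> digits (Suc k) i. \<exists>x. box_at (Suc k) p i + w / B i ^ h (Suc k) i \<le> x \<and>
      x < box_at (Suc k) p i + w / B i ^ h (Suc k) i + 1 / B i ^ t (Suc (Suc k)) \<and>
      circle_dist x (torus_rep y $ i) \<le> r}" for i
    have finS: "finite (S i)" for i using finite_digits unfolding S_def by (rule rev_finite_subset) auto
    have cS: "real (card (S i)) \<le> min (real (card (digits (Suc k) i))) (3 * (2 * r * B i ^ t (Suc (Suc k)) + 2))" for i
    proof (rule min.boundedI)
      show "real (card (S i)) \<le> real (card (digits (Suc k) i))"
        using finite_digits by (intro of_nat_mono card_mono) (auto simp: S_def)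
      let ?R = "{a. full (B i) (t (Suc (Suc k))) a \<and> (\<exists>x. a \<le> x \<and> x < a + 1 / B i ^ t (Suc (Suc k)) \<and>
        circle_dist x (torus_rep y $ i) \<le> r)}"
      let ?g = "\<lambda>w. box_at (Suc k) p i + w / B i ^ h (Suc k) i"
      have "inj_on ?g (S i)" using B_pos[of i] by (auto simp: inj_on_def)
      moreover have "?g ` S i \<subseteq> ?R"
      proof clarify
        fix w assume w: "w \<in> S i"
        then have "full (B i) (t (Suc (Suc k)) - h (Suc k) i) w" by (simp add: S_def digits_def)
        from full_add[OF box_full[of i "Suc k" p] this B] have "full (B i) (t (Suc (Suc k))) (?g w)"
          using h_le[of "Suc k" i] by (simp del: box_at.simps)
        then show "full (B i) (t (Suc (Suc k))) (?g w) \<and> (\<exists>x. ?g w \<le> x \<and>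
            x < ?g w + 1 / B i ^ t (Suc (Suc k)) \<and> circle_dist x (torus_rep y $ i) \<le> r)"
          using w unfolding S_def by blast
      qed
      moreover have "finite ?R" using finite_full[OF B[of i], of "t (Suc (Suc k))"] by (rule rev_finite_subset) auto
      ultimately have "card (S i) \<le> card ?R" using card_inj_on_le by blast
      then show "real (card (S i)) \<le> 3 * (2 * r * B i ^ t (Suc (Suc k)) + 2)"
        using card_full_near[OF B[of i] r torus_rep_bounds[of y i], of "t (Suc (Suc k))"] by linarith
    qed
    have "inj_on (\<lambda>m. enum_digits (Suc k) (m mod ?A)) ?F"
    proof (rule inj_onI)
      fix m m' assume m: "m \<in> ?F" "m' \<in> ?F" and "enum_digits (Suc k) (m mod ?A) = enum_digits (Suc k) (m' mod ?A)"
      then have "m mod ?A = m' mod ?A"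
        using bij_betw_imp_inj_on[OF bij_enum_digits[of "Suc k"]] mod_branching_less by (auto dest: inj_onD)
      moreover have "m div ?A = m' div ?A" using m by simp
      ultimately show "m = m'" by (metis div_mult_mod_eq)
    qed
    moreover have "(\<lambda>m. enum_digits (Suc k) (m mod ?A)) ` ?F \<subseteq> PiE UNIV S"
    proof clarify
      fix m assume m: "m \<in> hits (Suc k) U" "p = m div ?A"
      then obtain x where x: "x \<in> U" "\<And>i. cell (Suc k) m i \<le> torus_rep x $ i"
        "\<And>i. torus_rep x $ i < cell (Suc k) m i + 1 / B i ^ t (Suc (Suc k))" by (auto simp: hits_def)
      have "enum_digits (Suc k) (m mod ?A) i \<in> S i" for i
      proof -
        have "enum_digits (Suc k) (m mod ?A) i \<in> digits (Suc k) i"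
          using enum_digits_full[OF mod_branching_less] by (simp add: digits_def)
        moreover have "cell (Suc k) m i = box_at (Suc k) p i + enum_digits (Suc k) (m mod ?A) i / B i ^ h (Suc k) i"
          using m(2) by (simp only: cell_def subcell_def)
        ultimately show ?thesis
          unfolding S_def using x(2,3)[of i] circle_dist_le_of_dist[OF U x(1) y, of i]
          by (intro CollectI conjI exI[of _ "torus_rep x $ i"]) (simp_all only:)
      qed
      then show "enum_digits (Suc k) (m mod ?A) \<in> PiE UNIV S" by auto
    qed
    moreover have "finite (PiE UNIV S)" using finS by (intro finite_PiE) auto
    ultimately have "card ?F \<le> card (PiE UNIV S)" using card_inj_on_le by blast
    then have "real (card ?F) \<le> (\<Prod>i\<in>UNIV. real (card (S i)))" by (simp add: card_PiE flip: of_nat_prod)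
    also have "\<dots> \<le> ?K" using cS by (intro prod_mono) auto
    finally show ?thesis .
  qed
  have "card (hits (Suc k) U) \<le> card (\<Union>p\<in>hits k U. {m \<in> hits (Suc k) U. m div ?A = p})"
    by (rule card_mono[OF _ sub]) (use finite_hits in auto)
  also have "\<dots> \<le> (\<Sum>p\<in>hits k U. card {m \<in> hits (Suc k) U. m div ?A = p})"
    by (rule card_UN_le[OF finite_hits])
  finally have "real (card (hits (Suc k) U)) \<le> (\<Sum>p\<in>hits k U. real (card {m \<in> hits (Suc k) U. m div ?A = p}))"
    by (simp flip: of_nat_sum)
  also have "\<dots> \<le> (\<Sum>p\<in>hits k U. ?K)" by (intro sum_mono fib)
  finally show ?thesis by simp
qed

text \<open>All addresses of a level carry equal mass. Of their number only the last two generations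
  are kept, using \<open>1 \<le> num_boxes k\<close>; compared with all cylinders of order
  \<open>t (Suc k)\<close> this loses a factor of about \<open>B i ^ h k i\<close> in each
  coordinate, which sparse times compensate.\<close>

lemma mass_bound:
  assumes r: "0 < r" and U: "\<And>x y. x \<in> U \<Longrightarrow> y \<in> U \<Longrightarrow> dist x y \<le> r" and "U \<noteq> {}"
    and \<kappa>: "\<And>i. 0 < \<kappa> i" "\<And>n i. \<kappa> i * B i ^ n \<le> real (card {a. full (B i) n a})"
  shows "\<exists>S \<in> sets lborel. {u. 0 \<le> u \<and> u < 1 \<and> limit_point u \<in> U} \<subseteq> S \<and> emeasure lborel S \<le>
    ennreal (\<Prod>i\<in>UNIV. 3 * (2 * r * B i ^ t (Suc k) + 2) / (\<kappa> i * B i ^ (t (Suc k) - h k i)) *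
      min 1 (3 * (2 * r * B i ^ t (Suc (Suc k)) + 2) / (\<kappa> i * B i ^ (t (Suc (Suc k)) - h (Suc k) i))))"
proof -
  let ?N = "num_boxes (Suc (Suc k))"
  let ?H = "hits (Suc k) U"
  define I where "I m = {real m / real ?N ..< (real m + 1) / real ?N}" for m
  have N: "0 < real ?N" using num_pos by (simp del: num_boxes.simps)
  have sub: "{u. 0 \<le> u \<and> u < 1 \<and> limit_point u \<in> U} \<subseteq> (\<Union>m\<in>?H. I m)"
  proof clarify
    fix u assume u: "0 \<le> u" "u < 1" "limit_point u \<in> U"
    let ?m = "idx (Suc (Suc k)) u"
    have "?m \<in> ?H"
      unfolding hits_def mem_Collect_eq
      using u(3) idx_less[OF u(1,2)] pt_in_cell[OF u(1), where k = "Suc k"]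
      by (intro conjI bexI[of _ "limit_point u"]) (simp_all only: rep_limit_point[OF u(1)] simp_thms)
    moreover have "u \<in> I ?m"
    proof -
      have "real ?m = of_int \<lfloor>u * real ?N\<rfloor>" unfolding idx_def using u N by (simp del: num_boxes.simps)
      then have "real ?m \<le> u * real ?N" "u * real ?N < real ?m + 1" by linarith+
      then show ?thesis unfolding I_def using N by (simp add: pos_divide_le_eq pos_less_divide_eq del: num_boxes.simps)
    qed
    ultimately show "u \<in> (\<Union>m\<in>?H. I m)" by blast
  qed
  have "emeasure lborel (\<Union>m\<in>?H. I m) \<le> (\<Sum>m\<in>?H. emeasure lborel (I m))"
    by (rule emeasure_subadditive_finite) (use finite_hits in \<open>auto simp: I_def\<close>)
  also have "\<dots> = (\<Sum>m\<in>?H. ennreal (1 / real ?N))"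
    using N by (intro sum.cong) (auto simp: I_def divide_right_mono diff_divide_distrib[symmetric] simp del: num_boxes.simps)
  also have "\<dots> = ennreal (real (card ?H) / real ?N)"
    using N by (simp add: ennreal_of_nat_eq_real_of_nat ennreal_mult[symmetric] del: num_boxes.simps)
  finally have em: "emeasure lborel (\<Union>m\<in>?H. I m) \<le> ennreal (real (card ?H) / real ?N)" .
  have Bp: "0 < B i ^ n" for i n using B_pos by simp
  have wd: "\<kappa> i * B i ^ (t (Suc k) - h k i) \<le> real (card (digits k i))" for k i
    unfolding digits_def by (rule \<kappa>(2))
  have wpos: "0 < real (card (digits k i))" for k i 
    by (rule less_le_trans[OF _ wd]) (use \<kappa> Bp in simp)
  let ?a = "\<lambda>i. 3 * (2 * r * B i ^ t (Suc k) + 2)" and ?b = "\<lambda>i. 3 * (2 * r * B i ^ t (Suc (Suc k)) + 2)"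
  have ab: "0 \<le> ?a i" "0 \<le> ?b i" for i using r Bp[of i] by (simp_all add: less_imp_le)
  have "real (card ?H) \<le> (\<Prod>i\<in>UNIV. ?a i) * (\<Prod>i\<in>UNIV. min (real (card (digits (Suc k) i))) (?b i))"
    using card_hits_Suc[OF r U \<open>U \<noteq> {}\<close>, of k] card_hits[OF r U \<open>U \<noteq> {}\<close>, of k]
    by (rule order_trans[OF _ mult_right_mono]) (use ab in \<open>auto intro!: prod_nonneg\<close>)
  also have "\<dots> = (\<Prod>i\<in>UNIV. ?a i * min (real (card (digits (Suc k) i))) (?b i))" by (simp add: prod.distrib)
  finally have H: "real (card ?H) \<le> \<dots>" .
  have "real (num_boxes (Suc k)) = real (num_boxes k) * (\<Prod>i\<in>UNIV. real (card (digits k i)))" by (simp add: branching_def)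
  moreover have "1 * (\<Prod>i\<in>UNIV. real (card (digits k i))) \<le> real (num_boxes k) * (\<Prod>i\<in>UNIV. real (card (digits k i)))"
    using num_pos[of k] by (intro mult_right_mono prod_nonneg) auto
  ultimately have "(\<Prod>i\<in>UNIV. real (card (digits k i))) \<le> real (num_boxes (Suc k))" by linarith
  then have "(\<Prod>i\<in>UNIV. real (card (digits k i))) * real (branching (Suc k)) \<le> real (num_boxes (Suc k)) * real (branching (Suc k))"
    by (rule mult_right_mono) simp
  then have "(\<Prod>i\<in>UNIV. real (card (digits k i))) * (\<Prod>i\<in>UNIV. real (card (digits (Suc k) i))) \<le> real ?N"
    by (simp add: branching_def)
  then have Nge: "(\<Prod>i\<in>UNIV. real (card (digits k i)) * real (card (digits (Suc k) i))) \<le> real ?N"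
    by (simp add: prod.distrib del: num_boxes.simps)
  have "real (card ?H) / real ?N \<le> (\<Prod>i\<in>UNIV. ?a i * min (real (card (digits (Suc k) i))) (?b i)) /
      (\<Prod>i\<in>UNIV. real (card (digits k i)) * real (card (digits (Suc k) i)))"
    by (rule frac_le[OF _ H _ Nge]) (use ab wpos in \<open>auto intro!: prod_nonneg prod_pos\<close>)
  also have "\<dots> = (\<Prod>i\<in>UNIV. ?a i / real (card (digits k i)) * 
      (min (real (card (digits (Suc k) i))) (?b i) / real (card (digits (Suc k) i))))"
    by (simp add: prod_dividef[symmetric])
  also have "\<dots> \<le> (\<Prod>i\<in>UNIV. ?a i / (\<kappa> i * B i ^ (t (Suc k) - h k i)) *
      min 1 (?b i / (\<kappa> i * B i ^ (t (Suc (Suc k)) - h (Suc k) i))))"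
  proof (intro prod_mono conjI mult_mono)
    fix i
    have \<kappa>B: "0 < \<kappa> i * B i ^ n" for n using \<kappa> Bp by simp
    show "?a i / real (card (digits k i)) \<le> ?a i / (\<kappa> i * B i ^ (t (Suc k) - h k i))"
      by (rule divide_left_mono[OF wd ab(1) mult_pos_pos[OF wpos \<kappa>B]])
    have "min (real (card (digits (Suc k) i))) (?b i) / real (card (digits (Suc k) i))
      = min 1 (?b i / real (card (digits (Suc k) i)))" using wpos[of "Suc k" i]
      by (auto simp: min_def field_simps)
    also have "\<dots> \<le> min 1 (?b i / (\<kappa> i * B i ^ (t (Suc (Suc k)) - h (Suc k) i)))"
      by (rule min.mono[OF order_refl divide_left_mono[OF wd ab(2) mult_pos_pos[OF wpos \<kappa>B]]])
    finally show "min (real (card (digits (Suc k) i))) (?b i) / real (card (digits (Suc k) i)) \<le>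
      min 1 (?b i / (\<kappa> i * B i ^ (t (Suc (Suc k)) - h (Suc k) i)))" .
    show "0 \<le> ?a i / (\<kappa> i * B i ^ (t (Suc k) - h k i))" using ab[of i] \<kappa>B less_imp_le by (intro divide_nonneg_nonneg) auto
    show "0 \<le> min (real (card (digits (Suc k) i))) (?b i) / real (card (digits (Suc k) i))"
      using ab[of i] by (intro divide_nonneg_nonneg) auto
    then show "0 \<le> ?a i / real (card (digits k i)) * (min (real (card (digits (Suc k) i))) (?b i) / real (card (digits (Suc k) i)))"
      using ab[of i] by (intro mult_nonneg_nonneg) auto
  qed
  finally have "ennreal (real (card ?H) / real ?N) \<le> ennreal \<dots>" by (rule ennreal_leI)
  then show ?thesis using em sub by (intro bexI[of _ "\<Union>m\<in>?H. I m"] conjI)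
    (auto simp: I_def finite_hits intro: order_trans simp del: num_boxes.simps)
qed

end

text \<open>Nothing about targets remains here. Every product of full cylinders contains a box of
  controlled size inside \<open>E n\<close>; the Cantor set made of such boxes along sparse times
  lies in the limsup set and satisfies the decay that \<open>mass_distribution\<close> asks
  for.\<close>

lemma hausdorff_measure_limsup_boxes_pos:
  fixes B :: "'n::finite \<Rightarrow> real" and E :: "nat \<Rightarrow> 'n torus set"
  assumes B: "\<And>i. 1 < B i" and \<tau>: "0 \<le> \<tau>" and C: "0 < C" and S: "infinite S"
    and boxes: "\<And>n. n \<in> S \<Longrightarrow> 1 \<le> n \<and> (\<exists>h. (\<forall>i. C / (B i ^ n * exp (\<tau> * real n)) \<le> 1 / B i ^ h i) \<and>
      (\<forall>a. (\<forall>i. full (B i) (n - 1) (a i)) \<longrightarrow>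
        (\<exists>e. (\<forall>i. full (B i) (h i) (e i) \<and> a i \<le> e i \<and> e i + 1 / B i ^ h i < a i + 1 / B i ^ (n - 1)) \<and>
          (\<forall>x. (\<forall>i. e i \<le> torus_rep x $ i \<and> torus_rep x $ i \<le> e i + 1 / B i ^ h i) \<longrightarrow> x \<in> E n))))"
    and s: "0 \<le> s" "s < s1"
    and s1: "\<And>i. s1 * (ln (B i) + \<tau>) \<le> rate (\<lambda>i. ln (B i)) \<tau> (ln (B i) + \<tau>)"
  shows "hausdorff_measure s {x. infinite {n. x \<in> E n}} \<noteq> 0"
proof -
  define l where "l i = ln (B i)" for i
  have l: "0 < l i" for i using B[of i] by (simp add: l_def)
  have B0: "0 < B i" for i using B[of i] by linarith
  have Bexp: "B i ^ n = exp (real n * l i)" for i n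
    using B0[of i] by (simp add: l_def exp_of_nat_mult)
  define b where "b = Min (range B)"
  have b: "1 < b" "\<And>i. b \<le> B i" unfolding b_def using B by (auto simp: Min_gr_iff)
  define s' where "s' = (s + s1) / 2"
  have s': "s < s'" "s' < s1" using s by (auto simp: s'_def)
  \<comment> \<open>For \<open>r < 1 / b ^ n\<close> the factor exp (\<epsilon> n) is at most
    \<open>r powr - (s1 - s')\<close>, so losing it only lowers the exponent from s1 to s'.\<close>
  define \<epsilon> where "\<epsilon> = (s1 - s') * ln b"
  have \<epsilon>: "0 < \<epsilon>" using s' b by (simp add: \<epsilon>_def)
  obtain hh where hh: "\<And>n i. n \<in> S \<Longrightarrow> C / (B i ^ n * exp (\<tau> * real n)) \<le> 1 / B i ^ hh n i"
    "\<And>n a. n \<in> S \<Longrightarrow> (\<And>i. full (B i) (n - 1) (a i)) \<Longrightarrow>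
      (\<exists>e. (\<forall>i. full (B i) (hh n i) (e i) \<and> a i \<le> e i \<and> e i + 1 / B i ^ hh n i < a i + 1 / B i ^ (n - 1)) \<and>
          (\<forall>x. (\<forall>i. e i \<le> torus_rep x $ i \<and> torus_rep x $ i \<le> e i + 1 / B i ^ hh n i) \<longrightarrow> x \<in> E n))"
  proof -
    have "\<forall>n. \<exists>h. n \<in> S \<longrightarrow> (\<forall>i. C / (B i ^ n * exp (\<tau> * real n)) \<le> 1 / B i ^ h i) \<and>
      (\<forall>a. (\<forall>i. full (B i) (n - 1) (a i)) \<longrightarrow>
        (\<exists>e. (\<forall>i. full (B i) (h i) (e i) \<and> a i \<le> e i \<and> e i + 1 / B i ^ h i < a i + 1 / B i ^ (n - 1)) \<and>
          (\<forall>x. (\<forall>i. e i \<le> torus_rep x $ i \<and> torus_rep x $ i \<le> e i + 1 / B i ^ h i) \<longrightarrow> x \<in> E n)))"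
      using boxes by blast
    from choice[OF this] that show thesis by blast
  qed
  define ee where "ee n a = (SOME e. (\<forall>i. full (B i) (hh n i) (e i) \<and> a i \<le> e i \<and>
      e i + 1 / B i ^ hh n i < a i + 1 / B i ^ (n - 1)) \<and>
      (\<forall>x. (\<forall>i. e i \<le> torus_rep x $ i \<and> torus_rep x $ i \<le> e i + 1 / B i ^ hh n i) \<longrightarrow> x \<in> E n))" for n a
  have ee: "full (B i) (hh n i) (ee n a i) \<and> a i \<le> ee n a i \<and> ee n a i + 1 / B i ^ hh n i < a i + 1 / B i ^ (n - 1)"
    "\<And>x. (\<And>i. ee n a i \<le> torus_rep x $ i \<and> torus_rep x $ i \<le> ee n a i + 1 / B i ^ hh n i) \<Longrightarrow> x \<in> E n"
    if "n \<in> S" "\<And>i. full (B i) (n - 1) (a i)" for n a i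
    using someI_ex[OF hh(2)[OF that], folded ee_def] by blast+
  \<comment> \<open>Besides leaving room for the next cylinders, the later time is so late that the
    volume of a box of the earlier time is at least exp (- \<epsilon> n).\<close>
  define Q where "Q m n \<longleftrightarrow> m < n \<and> (\<forall>i. hh m i \<le> n - 1) \<and> (\<Prod>i\<in>UNIV. B i ^ hh m i) \<le> exp (\<epsilon> * real n)" for m n
  have ex: "\<exists>n. n \<in> S \<and> Q m n" for m
  proof -
    obtain n0 :: nat where n0: "(\<Prod>i\<in>UNIV. B i ^ hh m i) / \<epsilon> \<le> real n0" using real_arch_simple by blast
    obtain n where n: "n \<in> S" "n > n0 + m + Suc (\<Sum>i\<in>UNIV. hh m i)"
      using S unfolding infinite_nat_iff_unbounded by blast
    have "hh m i \<le> (\<Sum>i\<in>UNIV. hh m i)" for i by (rule member_le_sum) auto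
    then have "hh m i \<le> n - 1" for i using n(2) order_trans[of "hh m i" "\<Sum>i\<in>UNIV. hh m i" "n - 1"] by simp
    moreover have "(\<Prod>i\<in>UNIV. B i ^ hh m i) \<le> \<epsilon> * real n0"
      using n0 \<epsilon> by (simp add: pos_divide_le_eq mult.commute)
    then have "(\<Prod>i\<in>UNIV. B i ^ hh m i) \<le> \<epsilon> * real n"
      using n(2) \<epsilon> by (smt (verit) mult_left_mono of_nat_less_iff trans_less_add1)
    then have "(\<Prod>i\<in>UNIV. B i ^ hh m i) \<le> exp (\<epsilon> * real n)"
      using exp_ge_add_one_self[of "\<epsilon> * real n"] by linarith
    ultimately show ?thesis using n by (auto simp: Q_def)
  qed
  obtain n1 where n1: "n1 \<in> S" using S by fastforce
  obtain \<nu> where \<nu>: "\<And>k. \<nu> k \<in> S" "\<And>k. Q (\<nu> k) (\<nu> (Suc k))"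
    using dependent_nat_choice[of "\<lambda>_ n. n \<in> S" "\<lambda>_. Q"] n1 ex by blast
  have mono: "strict_mono \<nu>" using \<nu>(2) by (auto simp: strict_mono_Suc_iff Q_def)
  have \<nu>1: "1 \<le> \<nu> k" for k using boxes[OF \<nu>(1)] by blast
  \<comment> \<open>Order n - 1, because the boxes of time n are found in cylinders of that order;
    level 0 is the whole cube.\<close>
  define t where "t k = (case k of 0 \<Rightarrow> 0 | Suc j \<Rightarrow> \<nu> j - 1)" for k
  define h where "h k = (case k of 0 \<Rightarrow> (\<lambda>i. 0) | Suc j \<Rightarrow> hh (\<nu> j))" for k
  define e where "e k = (case k of 0 \<Rightarrow> (\<lambda>a. a) | Suc j \<Rightarrow> ee (\<nu> j))" for k
  have simps [simp]: "t (Suc k) = \<nu> k - 1" "h 0 = (\<lambda>i. 0)" "h (Suc k) = hh (\<nu> k)" "e (Suc k) = ee (\<nu> k)" for k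
    by (auto simp: t_def h_def e_def)
  interpret cantor_scheme B t h e
  proof
    show "h k i \<le> t (Suc k)" for k i
      using \<nu>(2) by (cases k) (auto simp: Q_def)
    show "full (B i) (h (Suc k) i) (e (Suc k) a i) \<and> a i \<le> e (Suc k) a i \<and>
      e (Suc k) a i + 1 / B i ^ h (Suc k) i < a i + 1 / B i ^ t (Suc k)"
      if "\<And>i. full (B i) (t (Suc k)) (a i)" for k a i
      using ee(1)[OF \<nu>(1)] that by simp
  qed (use B in auto)
  have inW: "limit_point u \<in> {x. infinite {n. x \<in> E n}}" if u: "0 \<le> u" "u < 1" for u
  proof -
    have "limit_point u \<in> E (\<nu> k)" for k
    proof (rule ee(2)[OF \<nu>(1)])
      show "full (B i) (\<nu> k - 1) (cell k (idx (Suc k) u) i)" for i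
        using cell_full[of i k "idx (Suc k) u"] by simp
      show "ee (\<nu> k) (cell k (idx (Suc k) u)) i \<le> torus_rep (limit_point u) $ i \<and>
        torus_rep (limit_point u) $ i \<le> ee (\<nu> k) (cell k (idx (Suc k) u)) i + 1 / B i ^ hh (\<nu> k) i" for i
        using pt_in_box[OF u(1), where k = "Suc k" and i = i] unfolding rep_limit_point[OF u(1)] box_Suc by simp
    qed
    then have "range \<nu> \<subseteq> {n. limit_point u \<in> E n}" by auto
    moreover have "infinite (range \<nu>)" using mono by (simp add: finite_image_iff strict_mono_imp_inj_on)
    ultimately show ?thesis using infinite_super by blast
  qed
  have "\<exists>\<kappa>>0. \<forall>n. \<kappa> * B i ^ n \<le> real (card {a. full (B i) n a})" for i
    using card_full_ge[OF B, of i] by metis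
  then obtain \<kappa> where \<kappa>: "\<And>i. 0 < \<kappa> i" "\<And>n i. \<kappa> i * B i ^ n \<le> real (card {a. full (B i) n a})"
    by metis
  define K1 where "K1 i = 12 * B i / \<kappa> i" for i
  define K2 where "K2 i = max 1 (K1 i / C)" for i
  define K where "K = (\<Prod>i\<in>UNIV. K1 i * K2 i)"
  have K1: "0 < K1 i" for i using \<kappa>(1)[of i] B0[of i] by (simp add: K1_def)
  have K2: "0 < K2 i" for i by (simp add: K2_def)
  have K: "0 < K" unfolding K_def using K1 K2 by (intro prod_pos) auto
  show ?thesis
  proof (rule mass_distribution[OF s(1) s'(1) K, of "1 / b ^ \<nu> 0" limit_point])
    show "0 < 1 / b ^ \<nu> 0" "1 / b ^ \<nu> 0 \<le> 1" using b by auto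
    show "limit_point u \<in> {x. infinite {n. x \<in> E n}}" if "0 \<le> u" "u < 1" for u using inW[OF that] .
    fix U :: "'n torus set" and r :: real
    assume r: "0 < r" "r < 1 / b ^ \<nu> 0" and U: "\<And>x y. x \<in> U \<Longrightarrow> y \<in> U \<Longrightarrow> dist x y \<le> r" "U \<noteq> {}"
    have "\<exists>k. 1 / b ^ \<nu> k \<le> r"
    proof -
      obtain k where k: "1 / r < b ^ k" using real_arch_pow[OF b(1)] by blast
      have "b ^ k \<le> b ^ \<nu> k" using b strict_mono_imp_increasing[OF mono] by (intro power_increasing) auto
      then have "1 / r < b ^ \<nu> k" using k by linarith
      then have "1 / b ^ \<nu> k \<le> r" using r b by (simp add: field_simps)
      then show ?thesis by blast
    qed
    \<comment> \<open>\<open>r\<close> is placed between two consecutive chosen times, measured by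
      the weakest expansion \<open>b\<close>. Up to a constant, the cells of the later time are then
      no longer than \<open>r\<close> in any coordinate.\<close>
    then have ex: "\<exists>k. 1 / b ^ \<nu> (Suc k) \<le> r \<and> r < 1 / b ^ \<nu> k"
      using ex_least_nat_less[of "\<lambda>k. 1 / b ^ \<nu> k \<le> r"] r(2) by (metis not_le order_refl)
    then obtain k where k: "1 / b ^ \<nu> (Suc k) \<le> r" "r < 1 / b ^ \<nu> k" by blast
    define n where "n = \<nu> k"
    define n' where "n' = \<nu> (Suc k)"
    have n: "1 \<le> n" "1 \<le> n'" "0 < real n" using \<nu>1[of k] \<nu>1[of "Suc k"] by (auto simp: n_def n'_def)
    define x where "x = - ln r / real n"
    have rx: "r = exp (- real n * x)" using r n by (simp add: x_def)
    have bn: "b ^ n = exp (real n * ln b)" using b by (simp add: exp_of_nat_mult)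
    have xb: "ln b * real n \<le> - ln r"
    proof -
      have "r \<le> exp (- (real n * ln b))" using k(2) unfolding n_def[symmetric] bn by (simp add: exp_minus inverse_eq_divide)
      then have "ln r \<le> ln (exp (- (real n * ln b)))" using r by (subst ln_le_cancel_iff) auto
      then show ?thesis by (simp add: mult.commute)
    qed
    have "0 \<le> ln b * real n" using b by simp
    then have x0: "0 \<le> x" unfolding x_def using xb by (intro divide_nonneg_nonneg) linarith+
    have pd: "B i ^ (m - 1 - q) = B i ^ m / (B i * B i ^ q)" if "1 \<le> m" "q \<le> m - 1" for m q i
    proof -
      define j where "j = m - 1 - q"
      then have "m = Suc (q + j)" using that by simp
      then show ?thesis using B0[of i] by (simp add: power_add)
    qed
    \<comment> \<open>The earlier level yields the term \<open>min (l i) x\<close> of the rate;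
      \<open>B i ^ h k i\<close> is the loss from counting digits in place of cylinders.\<close>
    have F1: "3 * (2 * r * B i ^ t (Suc k) + 2) / (\<kappa> i * B i ^ (t (Suc k) - h k i))
      \<le> K1 i * B i ^ h k i * exp (- (real n * min (l i) x))" for i
    proof -
      have eq: "B i ^ (t (Suc k) - h k i) = B i ^ n / (B i * B i ^ h k i)"
        using pd[OF n(1), of "h k i" i] h_le[of k i] by (simp add: n_def)
      have "r * B i ^ (n - 1) \<le> r * B i ^ n" using r B[of i] by (intro mult_left_mono power_increasing) auto
      then have "2 * r * B i ^ (n - 1) + 2 \<le> 4 * max 1 (r * B i ^ n)" by linarith
      then have "3 * (2 * r * B i ^ t (Suc k) + 2) / (\<kappa> i * B i ^ (t (Suc k) - h k i))
        \<le> 3 * (4 * max 1 (r * B i ^ n)) / (\<kappa> i * (B i ^ n / (B i * B i ^ h k i)))"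
        unfolding eq using \<kappa>(1)[of i] B0[of i] by (intro divide_right_mono mult_left_mono) (auto simp: n_def less_imp_le)
      also have "\<dots> = K1 i * B i ^ h k i * (max 1 (r * B i ^ n) / B i ^ n)"
        using \<kappa>(1)[of i] B0[of i] by (simp add: K1_def field_simps)
      also have "max 1 (r * B i ^ n) / B i ^ n = exp (- (real n * min (l i) x))"
      proof -
        have "r * B i ^ n = exp (real n * (l i - x))"
          unfolding rx Bexp by (simp add: exp_add[symmetric] algebra_simps)
        then have "max 1 (r * B i ^ n) = exp (max 0 (real n * (l i - x)))" by (simp add: max_def)
        then have "max 1 (r * B i ^ n) / B i ^ n = exp (max 0 (real n * (l i - x)) - real n * l i)"
          unfolding Bexp by (simp add: exp_diff)
        also have "max 0 (real n * (l i - x)) - real n * l i = - (real n * min (l i) x)"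
          using n by (auto simp: max_def min_def algebra_simps mult_le_cancel_left)
        finally show ?thesis .
      qed
      finally show ?thesis .
    qed
    \<comment> \<open>The later level yields the other term, the share that an interval of length
      \<open>r\<close> can take of a box of length at least \<open>C\<close> exp (- n (l i +
      \<tau>)).\<close>
    have F2: "min 1 (3 * (2 * r * B i ^ t (Suc (Suc k)) + 2) / (\<kappa> i * B i ^ (t (Suc (Suc k)) - h (Suc k) i)))
      \<le> K2 i * exp (- (real n * max 0 (x - l i - \<tau>)))" for i
    proof -
      have eq: "B i ^ (t (Suc (Suc k)) - h (Suc k) i) = B i ^ n' / (B i * B i ^ hh n i)"
        using pd[OF n(2), of "hh n i" i] h_le[of "Suc k" i] by (simp add: n'_def n_def)
      have 1: "1 \<le> r * B i ^ n'"
      proof -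
        have "1 \<le> r * b ^ n'" using k(1) b by (simp add: n'_def pos_divide_le_eq)
        also have "\<dots> \<le> r * B i ^ n'" using r b by (intro mult_left_mono power_mono) auto
        finally show ?thesis .
      qed
      have "r * B i ^ (n' - 1) \<le> r * B i ^ n'" using r B[of i] by (intro mult_left_mono power_increasing) auto
      then have "2 * r * B i ^ (n' - 1) + 2 \<le> 4 * (r * B i ^ n')" using 1 by linarith
      then have "3 * (2 * r * B i ^ t (Suc (Suc k)) + 2) / (\<kappa> i * B i ^ (t (Suc (Suc k)) - h (Suc k) i))
        \<le> 3 * (4 * (r * B i ^ n')) / (\<kappa> i * (B i ^ n' / (B i * B i ^ hh n i)))"
        unfolding eq using \<kappa>(1)[of i] B0[of i] by (intro divide_right_mono mult_left_mono) (auto simp: n'_def less_imp_le)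
      also have "\<dots> = K1 i * r * B i ^ hh n i"
        using \<kappa>(1)[of i] B0[of i] by (simp add: K1_def field_simps)
      also have "\<dots> \<le> K1 i * r * (B i ^ n * exp (\<tau> * real n) / C)"
      proof (rule mult_left_mono)
        have "C * B i ^ hh n i \<le> B i ^ n * exp (\<tau> * real n)"
          using hh(1)[OF \<nu>(1)[of k], of i] B0[of i] by (simp add: n_def field_simps)
        then show "B i ^ hh n i \<le> B i ^ n * exp (\<tau> * real n) / C" using C by (simp add: field_simps)
      qed (use K1[of i] r in auto)
      also have "\<dots> = K1 i / C * exp (real n * (l i + \<tau> - x))"
        unfolding rx Bexp by (simp add: exp_add[symmetric] algebra_simps)
      finally have "min 1 (3 * (2 * r * B i ^ t (Suc (Suc k)) + 2) / (\<kappa> i * B i ^ (t (Suc (Suc k)) - h (Suc k) i)))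
        \<le> min 1 (K1 i / C * exp (real n * (l i + \<tau> - x)))" by (rule min.mono[OF order_refl])
      also have "\<dots> \<le> K2 i * min 1 (exp (real n * (l i + \<tau> - x)))"
      proof -
        have "min 1 (c * z) \<le> max 1 c * min 1 z" if "0 < z" "0 < c" for c z :: real
        proof (cases "1 \<le> z")
          case False
          then have "c * z \<le> max 1 c * z" using that by (intro mult_right_mono) auto
          then show ?thesis using False by simp
        qed simp
        from this[OF exp_gt_zero divide_pos_pos[OF K1 C]] show ?thesis unfolding K2_def .
      qed
      also have "min 1 (exp (real n * (l i + \<tau> - x))) = exp (- (real n * max 0 (x - l i - \<tau>)))"
      proof (cases "x \<le> l i + \<tau>")
        case True
        then have "0 \<le> real n * (l i + \<tau> - x)" by simp
        then show ?thesis using True by simp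
      next
        case False
        then have "real n * (l i + \<tau> - x) \<le> 0" by (simp add: mult_nonneg_nonpos)
        then have "min 1 (exp (real n * (l i + \<tau> - x))) = exp (real n * (l i + \<tau> - x))" by simp
        moreover have "real n * (l i + \<tau> - x) = - (real n * max 0 (x - l i - \<tau>))"
          using False by (simp add: algebra_simps)
        ultimately show ?thesis by metis
      qed
      finally show ?thesis .
    qed
    have prodh: "(\<Prod>i\<in>UNIV. B i ^ h k i) \<le> exp (\<epsilon> * real n)"
    proof (cases k)
      case 0
      then show ?thesis using \<epsilon> by simp
    next
      case (Suc j)
      then show ?thesis using \<nu>(2)[of j] by (simp add: Q_def n_def)
    qed
    have nonneg: "0 \<le> 3 * (2 * r * B i ^ t (Suc k) + 2) / (\<kappa> i * B i ^ (t (Suc k) - h k i)) *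
        min 1 (3 * (2 * r * B i ^ t (Suc (Suc k)) + 2) / (\<kappa> i * B i ^ (t (Suc (Suc k)) - h (Suc k) i)))" for i
      using r B0[of i] \<kappa>(1)[of i] by (intro mult_nonneg_nonneg divide_nonneg_nonneg min.boundedI) (auto intro!: add_nonneg_nonneg less_imp_le)
    have "(\<Prod>i\<in>UNIV. 3 * (2 * r * B i ^ t (Suc k) + 2) / (\<kappa> i * B i ^ (t (Suc k) - h k i)) *
        min 1 (3 * (2 * r * B i ^ t (Suc (Suc k)) + 2) / (\<kappa> i * B i ^ (t (Suc (Suc k)) - h (Suc k) i))))
      \<le> (\<Prod>i\<in>UNIV. (K1 i * B i ^ h k i * exp (- (real n * min (l i) x))) * (K2 i * exp (- (real n * max 0 (x - l i - \<tau>)))))"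
    proof (intro prod_mono conjI nonneg mult_mono F1 F2)
      fix i
      show "0 \<le> K1 i * B i ^ h k i * exp (- (real n * min (l i) x))" using K1[of i] B0[of i] by simp
      show "0 \<le> min 1 (3 * (2 * r * B i ^ t (Suc (Suc k)) + 2) / (\<kappa> i * B i ^ (t (Suc (Suc k)) - h (Suc k) i)))"
        using r B0[of i] \<kappa>(1)[of i] by (intro divide_nonneg_nonneg min.boundedI) (auto intro!: add_nonneg_nonneg less_imp_le)
    qed
    also have "\<dots> = (\<Prod>i\<in>UNIV. (K1 i * K2 i) * B i ^ h k i * exp (- (real n * (min (l i) x + max 0 (x - l i - \<tau>)))))"
      by (intro prod.cong refl) (simp add: exp_add[symmetric] distrib_left algebra_simps)
    also have "\<dots> = K * (\<Prod>i\<in>UNIV. B i ^ h k i) * exp (- real n * rate l \<tau> x)"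
      unfolding prod.distrib K_def rate_def by (simp add: exp_sum[symmetric] sum_negf sum_distrib_left)
    also have "\<dots> \<le> K * exp (\<epsilon> * real n) * exp (- real n * (s1 * x))"
    proof (intro mult_mono mult_left_mono prodh)
      have "s1 * x \<le> rate l \<tau> x"
        by (rule rate_ge_linear[OF l \<tau> x0]) (use s1 in \<open>simp add: l_def\<close>)
      then show "exp (- real n * rate l \<tau> x) \<le> exp (- real n * (s1 * x))" using n by simp
    qed (use K B0 in \<open>auto intro!: prod_pos prod_nonneg mult_nonneg_nonneg less_imp_le\<close>)
    also have "\<dots> \<le> K * exp ((s1 - s') * (- ln r)) * exp (- real n * (s1 * x))"
    proof -
      have "\<epsilon> * real n \<le> (s1 - s') * (- ln r)"
        unfolding \<epsilon>_def using mult_left_mono[OF xb, of "s1 - s'"] s' by (simp add: mult.assoc)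
      then show ?thesis using K by simp
    qed
    also have "exp (- real n * (s1 * x)) = exp (s1 * ln r)" using n by (simp add: x_def)
    also have "K * exp ((s1 - s') * (- ln r)) * exp (s1 * ln r) = K * r powr s'"
      using r by (simp add: powr_def mult.assoc exp_add[symmetric] algebra_simps)
    finally have fin: "ennreal (\<Prod>i\<in>UNIV. 3 * (2 * r * B i ^ t (Suc k) + 2) / (\<kappa> i * B i ^ (t (Suc k) - h k i)) *
        min 1 (3 * (2 * r * B i ^ t (Suc (Suc k)) + 2) / (\<kappa> i * B i ^ (t (Suc (Suc k)) - h (Suc k) i))))
        \<le> ennreal (K * r powr s')" by (rule ennreal_leI)
    show "\<exists>S\<in>sets lborel. {t. 0 \<le> t \<and> t < 1 \<and> limit_point t \<in> U} \<subseteq> S \<and> emeasure lborel S \<le> ennreal (K * r powr s')"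
      using mass_bound[OF r(1) U \<kappa>, of k] order_trans[OF _ fin] by blast
  qed
qed

section \<open>Upper bound\<close>

lemma same_floor_abs_diff:
  fixes x y r :: real
  assumes "0 < r" "\<lfloor>x / r\<rfloor> = \<lfloor>y / r\<rfloor>"
  shows "\<bar>x - y\<bar> \<le> r"
proof -
  have "\<bar>x / r - y / r\<bar> < 1" using assms(2) by linarith
  then have "\<bar>(x - y) / r\<bar> < 1" by (simp add: diff_divide_distrib)
  then show ?thesis using assms(1) by (simp add: pos_divide_less_eq)
qed

text \<open>The first code of a point records its branch in the coordinates in which cylinders are
  longer than \<open>r = exp (- n (l i + \<tau>))\<close>, and a cell of length \<open>r\<close> in the others.  The hitting set inside
  one such class has sides at most \<open>3 \<rho> / B j ^ n\<close>; where this exceeds \<open>r\<close>, the second code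
  subdivides it.\<close>

lemma hit_set_cover:
  fixes B :: "'n::finite \<Rightarrow> real" and g :: "'n torus \<Rightarrow> 'n torus"
  assumes B: "\<And>i. 1 < B i" and b: "1 < b" "\<And>i. b \<le> B i"
    and lip: "\<And>x y. dist (g x) (g y) \<le> c * dist x y" and c: "0 < c"
    and n: "4 * c * real CARD('n) \<le> b ^ n" and \<tau>: "0 \<le> \<tau>"
  defines "l \<equiv> \<lambda>i. ln (B i)"
  shows "\<exists>F. finite F \<and> hit_set B g (exp (- (\<tau> * real n))) n \<subseteq> \<Union> F \<and>
    real (card F) \<le> (\<Prod>j\<in>UNIV. 16 * (B j / (B j - 1) + 1)) * exp (real n * rate l \<tau> (l i + \<tau>)) \<and>
    (\<forall>U\<in>F. \<forall>x\<in>U. \<forall>y\<in>U. dist x y \<le> 3 * real CARD('n) * exp (- (real n * (l i + \<tau>))))"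
proof -
  let ?d = "real CARD('n)"
  define \<rho> where "\<rho> = exp (- (\<tau> * real n))"
  have \<rho>: "0 < \<rho>" "\<rho> \<le> 1" using \<tau> by (auto simp: \<rho>_def)
  have B0: "0 < B j" for j using B[of j] by linarith
  have Bn: "0 < B j ^ n" for j using B0[of j] by simp
  have Bexp: "B j ^ n = exp (real n * l j)" for j
    using B0[of j] by (simp add: l_def exp_of_nat_mult)
  have bn: "0 < b ^ n" "b ^ n \<le> B j ^ n" for j using b by (auto intro: power_mono)
  define r where "r = \<rho> / B i ^ n"
  have r_exp: "r = exp (- (real n * (l i + \<tau>)))"
    unfolding r_def \<rho>_def Bexp by (simp add: exp_diff[symmetric] algebra_simps)
  have r: "0 < r" "r \<le> 1" "r \<le> \<rho> / b ^ n"
  proof -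
    show "0 < r" using \<rho> Bn by (simp add: r_def)
    show "r \<le> \<rho> / b ^ n" unfolding r_def using \<rho> bn Bn[of i] by (intro divide_left_mono mult_pos_pos) auto
    have "1 \<le> B i ^ n" using B[of i] by simp
    then show "r \<le> 1" using \<rho> Bn[of i] unfolding r_def by (subst pos_divide_le_eq) auto
  qed
  define A where "A = hit_set B g \<rho> n"
  \<comment> \<open>The coordinates in which a cylinder is at least as long as \<open>r\<close>;
    there it is cheaper to list branches than cells of length \<open>r\<close>.\<close>
  define G where "G = {j. B j ^ n * r \<le> 1}"
  have low_G: "j \<in> G" if "B j \<le> B i" for j
  proof -
    have "B j ^ n * r \<le> B i ^ n * r" using that B0[of j] r by (intro mult_right_mono power_mono) auto
    also have "\<dots> = \<rho>" using B0[of i] by (simp add: r_def)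
    finally show ?thesis using \<rho> by (simp add: G_def)
  qed
  define T where "T x j = (beta_map (B j) ^^ n) (torus_rep x $ j)" for x :: "'n torus" and j
  have T: "0 \<le> T x j" "T x j < 1" for x j
    unfolding T_def using funpow_beta_map_range torus_rep_bounds by blast+
  \<comment> \<open>The extra bit \<open>\<lfloor>2 * T x j\<rfloor>\<close> puts two images into
    the same half of the unit interval, where the distance on the circle is the ordinary
    one.\<close>
  define code1 where "code1 x j = (if j \<in> G then (branch (B j) n (torus_rep x $ j), \<lfloor>2 * T x j\<rfloor>)
    else (0, \<lfloor>torus_rep x $ j / r\<rfloor>))" for x :: "'n torus" and j
  \<comment> \<open>No subdivision is made for \<open>B j > B i\<close>: there the first code
    already confines a class to length \<open>r\<close>, or to 3 \<rho> / \<open>B j ^ n\<close>,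
    which is at most 3 r.\<close>
  define code2 where "code2 x j = (if B j \<le> B i then \<lfloor>torus_rep x $ j / r\<rfloor> else 0)" for x :: "'n torus" and j
  have diff_G: "\<bar>torus_rep x $ j - torus_rep y $ j\<bar> \<le> (2 * \<rho> + c * dist x y) / B j ^ n"
    if xy: "x \<in> A" "y \<in> A" "code1 x = code1 y" and j: "j \<in> G" for x y j
  proof -
    have eq: "branch (B j) n (torus_rep x $ j) = branch (B j) n (torus_rep y $ j)"
      "\<lfloor>2 * T x j\<rfloor> = \<lfloor>2 * T y j\<rfloor>"
      using fun_cong[OF xy(3), of j] j by (auto simp: code1_def)
    have TT: "T x j - T y j = B j ^ n * (torus_rep x $ j - torus_rep y $ j)"
      using eq(1) by (simp add: branch_def T_def right_diff_distrib)
    have "\<bar>T x j - T y j\<bar> < 1/2" using eq(2) by linarith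
    then have "\<bar>(T x j - T y j) - of_int 0\<bar> < 1/2" by simp
    from round_unique'[OF this] have "circle_dist (T x j) (T y j) = \<bar>T x j - T y j\<bar>"
      by (simp add: circle_dist_def)
    also have "\<dots> = B j ^ n * \<bar>torus_rep x $ j - torus_rep y $ j\<bar>"
      unfolding TT abs_mult using Bn[of j] by simp
    finally have 1: "B j ^ n * \<bar>torus_rep x $ j - torus_rep y $ j\<bar> = circle_dist (T x j) (T y j)" ..
    have "circle_dist (T x j) (T y j) \<le> circle_dist (T x j) (torus_rep (g x) $ j) +
        (circle_dist (torus_rep (g x) $ j) (torus_rep (g y) $ j) + circle_dist (torus_rep (g y) $ j) (T y j))"
      using circle_dist_triangle by (meson add_left_mono order_trans)
    also have "\<dots> \<le> \<rho> + (c * dist x y + \<rho>)"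
      using xy(1,2) order_trans[OF circle_dist_le_dist lip]
      by (intro add_mono) (auto simp: A_def hit_set_def T_def circle_dist_commute[of "torus_rep (g y) $ j"] less_imp_le)
    finally have "B j ^ n * \<bar>torus_rep x $ j - torus_rep y $ j\<bar> \<le> 2 * \<rho> + c * dist x y" unfolding 1 by simp
    then show ?thesis using Bn[of j] by (simp add: pos_le_divide_eq mult.commute)
  qed
  have diff_nG: "\<bar>torus_rep x $ j - torus_rep y $ j\<bar> \<le> r" if "code1 x = code1 y" "j \<notin> G" for x y j
    using fun_cong[OF that(1), of j] that(2) by (intro same_floor_abs_diff r) (simp add: code1_def)
  \<comment> \<open>Through the moving centre the bound on the sides contains the very distance to
    be estimated. By the hypothesis on \<open>n\<close> it comes back with the factor 1/4 and is
    absorbed.\<close>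
  have cdist: "c * dist x y \<le> \<rho>" if xy: "x \<in> A" "y \<in> A" "code1 x = code1 y" for x y
  proof -
    have nn: "0 \<le> 3 * \<rho> + c * dist x y" using \<rho> c by simp
    have "\<bar>torus_rep x $ j - torus_rep y $ j\<bar> \<le> (3 * \<rho> + c * dist x y) / b ^ n" for j
    proof (cases "j \<in> G")
      case True
      have "\<bar>torus_rep x $ j - torus_rep y $ j\<bar> \<le> (2 * \<rho> + c * dist x y) / B j ^ n"
        by (rule diff_G[OF xy True])
      also have "\<dots> \<le> (3 * \<rho> + c * dist x y) / b ^ n" using \<rho> nn bn by (intro frac_le) auto
      finally show ?thesis .
    next
      case False
      have "\<bar>torus_rep x $ j - torus_rep y $ j\<bar> \<le> \<rho> / b ^ n" using diff_nG[OF xy(3) False] r(3) by linarith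
      also have "\<dots> \<le> (3 * \<rho> + c * dist x y) / b ^ n" using \<rho> c bn by (intro divide_right_mono) auto
      finally show ?thesis .
    qed
    then have "dist x y \<le> (\<Sum>j\<in>(UNIV::'n set). (3 * \<rho> + c * dist x y) / b ^ n)"
      by (intro order_trans[OF dist_torus_le_sum] sum_mono)
    then have "dist x y \<le> ?d * (3 * \<rho> + c * dist x y) / b ^ n" by simp
    then have "c * dist x y \<le> c * (?d * (3 * \<rho> + c * dist x y) / b ^ n)" using c by (intro mult_left_mono) auto
    also have "\<dots> = (c * ?d / b ^ n) * (3 * \<rho> + c * dist x y)" by simp
    also have "\<dots> \<le> (1/4) * (3 * \<rho> + c * dist x y)"
      using n bn(1) nn by (intro mult_right_mono) (simp_all add: pos_divide_le_eq)
    finally show ?thesis by simp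
  qed
  have diff_G': "\<bar>torus_rep x $ j - torus_rep y $ j\<bar> \<le> 3 * \<rho> / B j ^ n"
    if xy: "x \<in> A" "y \<in> A" "code1 x = code1 y" and j: "j \<in> G" for x y j
  proof -
    have "(2 * \<rho> + c * dist x y) / B j ^ n \<le> 3 * \<rho> / B j ^ n"
      using cdist[OF xy] Bn[of j] by (intro divide_right_mono) auto
    then show ?thesis using diff_G[OF that] by linarith
  qed
  define code where "code x = (code1 x, code2 x)" for x
  define F where "F = (\<lambda>p. {x \<in> A. code x = p}) ` code ` A"
  have diam: "dist x y \<le> 3 * ?d * r" if xy: "x \<in> A" "y \<in> A" "code x = code y" for x y
  proof -
    have c1: "code1 x = code1 y" and c2: "code2 x = code2 y" using xy(3) by (auto simp: code_def)
    have "\<bar>torus_rep x $ j - torus_rep y $ j\<bar> \<le> 3 * r" for j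
    proof (cases "B j \<le> B i")
      case True
      then have "\<bar>torus_rep x $ j - torus_rep y $ j\<bar> \<le> r"
        using fun_cong[OF c2, of j] by (intro same_floor_abs_diff r) (simp add: code2_def)
      then show ?thesis using r by linarith
    next
      case False
      show ?thesis
      proof (cases "j \<in> G")
        case True
        have "3 * \<rho> / B j ^ n \<le> 3 * \<rho> / B i ^ n"
          using False \<rho> B0[of i] B0[of j] by (intro divide_left_mono power_mono) auto
        then show ?thesis using diff_G'[OF xy(1,2) c1 True] by (simp add: r_def)
      next
        case F2: False
        then show ?thesis using diff_nG[OF c1 F2] r by linarith
      qed
    qed
    then have "dist x y \<le> (\<Sum>j\<in>(UNIV::'n set). 3 * r)"
      by (intro order_trans[OF dist_torus_le_sum] sum_mono)
    then show ?thesis by simp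
  qed
  define K where "K j = B j / (B j - 1) + 1" for j
  have K: "1 \<le> K j" for j using B[of j] by (simp add: K_def)
  define S1 where "S1 j = (if j \<in> G then branch (B j) n ` {0..<1} \<times> {0..1} else {0} \<times> {0..\<lfloor>1 / r\<rfloor>})" for j
  have finS1: "finite (S1 j)" for j using card_branch(1)[OF B] by (simp add: S1_def)
  have cS1: "real (card (S1 j)) \<le> 2 * K j * exp (real n * min (l j) (l i + \<tau>))" for j
  proof -
    have ir: "1 / r = exp (real n * (l i + \<tau>))" unfolding r_exp by (simp add: exp_minus inverse_eq_divide)
    have min_exp: "min (B j ^ n) (1 / r) = exp (real n * min (l j) (l i + \<tau>))"
    proof (cases "l j \<le> l i + \<tau>")
      case True
      then have "real n * l j \<le> real n * (l i + \<tau>)" by (intro mult_left_mono) auto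
      then show ?thesis unfolding ir Bexp using True by simp
    next
      case False
      then have "real n * (l i + \<tau>) \<le> real n * l j" by (intro mult_left_mono) auto
      then show ?thesis unfolding ir Bexp using False by simp
    qed
    show ?thesis
    proof (cases "j \<in> G")
      case True
      then have "B j ^ n \<le> 1 / r" using r by (simp add: G_def pos_le_divide_eq)
      then have m: "exp (real n * min (l j) (l i + \<tau>)) = B j ^ n" using min_exp by simp
      have "real (card (S1 j)) = 2 * real (card (branch (B j) n ` {0..<1}))"
        using True by (simp add: S1_def card_cartesian_product)
      also have "\<dots> \<le> 2 * (K j * B j ^ n)" unfolding K_def
        using card_branch(2)[OF B[of j], of n] by (intro mult_left_mono) auto
      finally show ?thesis unfolding m by simp
    next
      case False
      then have "1 / r \<le> B j ^ n" using r by (simp add: G_def pos_divide_le_eq)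
      then have m: "exp (real n * min (l j) (l i + \<tau>)) = 1 / r" using min_exp by simp
      have r1: "1 \<le> 1 / r" "0 \<le> \<lfloor>1 / r\<rfloor>" using r by simp_all
      have "real (card (S1 j)) = of_int (\<lfloor>1 / r\<rfloor> + 1)" using False r1
        by (simp add: S1_def card_cartesian_product)
      also have "\<dots> \<le> 2 * 1 * (1 / r)" using r1(1) by linarith
      also have "\<dots> \<le> 2 * K j * (1 / r)" using K[of j] r by (intro mult_right_mono mult_left_mono) auto
      finally show ?thesis unfolding m .
    qed
  qed
  have code1_S1: "code1 ` A \<subseteq> PiE UNIV S1"
  proof clarify
    fix x
    have "code1 x j \<in> S1 j" for j
    proof (cases "j \<in> G")
      case True
      have "0 \<le> \<lfloor>2 * T x j\<rfloor>" "\<lfloor>2 * T x j\<rfloor> \<le> 1" using T[of x j] by linarith+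
      then show ?thesis using True torus_rep_bounds[of x j] by (auto simp: code1_def S1_def)
    next
      case False
      have "torus_rep x $ j / r \<le> 1 / r" using torus_rep_bounds[of x j] r by (intro divide_right_mono) auto
      then have "\<lfloor>torus_rep x $ j / r\<rfloor> \<le> \<lfloor>1 / r\<rfloor>" by (rule floor_mono)
      moreover have "0 \<le> \<lfloor>torus_rep x $ j / r\<rfloor>" using torus_rep_bounds[of x j] r by simp
      ultimately show ?thesis using False by (simp add: code1_def S1_def)
    qed
    then show "code1 x \<in> PiE UNIV S1" by auto
  qed
  have fin1: "finite (code1 ` A)"
    using finite_subset[OF code1_S1] finS1 by (simp add: finite_PiE)
  have card1: "real (card (code1 ` A)) \<le> (\<Prod>j\<in>UNIV. 2 * K j * exp (real n * min (l j) (l i + \<tau>)))"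
  proof -
    have "card (code1 ` A) \<le> card (PiE UNIV S1)"
      using finS1 by (intro card_mono[OF _ code1_S1] finite_PiE) auto
    then have "real (card (code1 ` A)) \<le> (\<Prod>j\<in>UNIV. real (card (S1 j)))" by (simp add: card_PiE flip: of_nat_prod)
    also have "\<dots> \<le> (\<Prod>j\<in>UNIV. 2 * K j * exp (real n * min (l j) (l i + \<tau>)))"
      by (intro prod_mono conjI cS1) simp
    finally show ?thesis .
  qed
  \<comment> \<open>At x = l i + \<tau> the second term of the rate is max 0 (l i - l j). An
    interval of half-length q r with q = 3 exp (n (l i - l j)) meets at most 2 q + 2 cells, whence
    the 8.\<close>
  let ?M = "\<Prod>j\<in>UNIV. 8 * exp (real n * max 0 (l i - l j))"
  have card2: "finite (code2 ` {x \<in> A. code1 x = p}) \<and> real (card (code2 ` {x \<in> A. code1 x = p})) \<le> ?M" for p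
  proof (cases "{x \<in> A. code1 x = p} = {}")
    case True
    have "0 \<le> ?M" by (intro prod_nonneg) simp
    then show ?thesis unfolding True by simp
  next
    case False
    then obtain y where y: "y \<in> A" "code1 y = p" by blast
    define S2 where "S2 j = (if B j \<le> B i then
      {\<lfloor>(torus_rep y $ j - 3 * \<rho> / B j ^ n) / r\<rfloor> .. \<lfloor>(torus_rep y $ j + 3 * \<rho> / B j ^ n) / r\<rfloor>} else {0})" for j
    have sub: "code2 ` {x \<in> A. code1 x = p} \<subseteq> PiE UNIV S2"
    proof clarify
      fix x assume x: "x \<in> A" "p = code1 x"
      have "code2 x j \<in> S2 j" for j
      proof (cases "B j \<le> B i")
        case True
        have "\<bar>torus_rep x $ j - torus_rep y $ j\<bar> \<le> 3 * \<rho> / B j ^ n"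
          by (rule diff_G'[OF x(1) y(1) _ low_G[OF True]]) (use x y in simp)
        then have "(torus_rep y $ j - 3 * \<rho> / B j ^ n) / r \<le> torus_rep x $ j / r"
          "torus_rep x $ j / r \<le> (torus_rep y $ j + 3 * \<rho> / B j ^ n) / r"
          using r by (intro divide_right_mono; linarith)+
        then show ?thesis using True by (simp add: code2_def S2_def floor_mono)
      qed (simp add: code2_def S2_def)
      then show "code2 x \<in> PiE UNIV S2" by auto
    qed
    have finS2: "finite (PiE UNIV S2)" by (intro finite_PiE) (auto simp: S2_def)
    have cS2: "real (card (S2 j)) \<le> 8 * exp (real n * max 0 (l i - l j))" for j
    proof (cases "B j \<le> B i")
      case True
      let ?q = "3 * \<rho> / B j ^ n / r"
      have lij: "l j \<le> l i" using True B0[of i] B0[of j] by (simp add: l_def)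
      have q: "?q = 3 * exp (real n * (l i - l j))"
        using \<rho> Bn[of i] by (simp add: r_def) (simp add: Bexp exp_diff right_diff_distrib)
      have ge: "1 \<le> exp (real n * (l i - l j))" using lij by simp
      have "real (card (S2 j)) = real (nat (\<lfloor>torus_rep y $ j / r + ?q\<rfloor> - \<lfloor>torus_rep y $ j / r - ?q\<rfloor> + 1))"
        using True by (simp add: S2_def add_divide_distrib diff_divide_distrib)
      also have "\<dots> \<le> 2 * ?q + 2" using q ge by linarith
      also have "\<dots> \<le> 8 * exp (real n * (l i - l j))" unfolding q using ge by simp
      finally show ?thesis using lij by simp
    next
      case False
      have "1 \<le> exp (real n * max 0 (l i - l j))" by simp
      then have "1 \<le> 8 * exp (real n * max 0 (l i - l j))" by linarith
      then show ?thesis using False by (simp add: S2_def)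
    qed
    have "card (code2 ` {x \<in> A. code1 x = p}) \<le> card (PiE UNIV S2)" by (rule card_mono[OF finS2 sub])
    then have "real (card (code2 ` {x \<in> A. code1 x = p})) \<le> (\<Prod>j\<in>UNIV. real (card (S2 j)))"
      by (simp add: card_PiE flip: of_nat_prod)
    also have "\<dots> \<le> ?M" by (intro prod_mono conjI cS2) simp
    finally show ?thesis using finite_subset[OF sub finS2] by blast
  qed
  have sub: "code ` A \<subseteq> Sigma (code1 ` A) (\<lambda>p. code2 ` {x \<in> A. code1 x = p})"
    by (auto simp: code_def)
  have finS: "finite (Sigma (code1 ` A) (\<lambda>p. code2 ` {x \<in> A. code1 x = p}))"
    using fin1 card2 by (intro finite_SigmaI) auto
  have finC: "finite (code ` A)" by (rule finite_subset[OF sub finS])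
  have "card (code ` A) \<le> (\<Sum>p\<in>code1 ` A. card (code2 ` {x \<in> A. code1 x = p}))"
    using card_mono[OF finS sub] fin1 card2 by (subst (asm) card_SigmaI) auto
  then have "real (card (code ` A)) \<le> (\<Sum>p\<in>code1 ` A. real (card (code2 ` {x \<in> A. code1 x = p})))"
    by (simp flip: of_nat_sum)
  also have "\<dots> \<le> (\<Sum>p\<in>code1 ` A. ?M)" using card2 by (intro sum_mono) auto
  also have "\<dots> = real (card (code1 ` A)) * ?M" by simp
  also have "\<dots> \<le> (\<Prod>j\<in>UNIV. 2 * K j * exp (real n * min (l j) (l i + \<tau>))) * ?M"
    using card1 by (intro mult_right_mono prod_nonneg) auto
  also have "\<dots> = (\<Prod>j\<in>UNIV. 16 * K j * exp (real n * (min (l j) (l i + \<tau>) + max 0 (l i + \<tau> - l j - \<tau>))))"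
    unfolding prod.distrib[symmetric] by (intro prod.cong refl) (simp add: distrib_left exp_add)
  also have "\<dots> = (\<Prod>j\<in>UNIV. 16 * K j) * exp (real n * rate l \<tau> (l i + \<tau>))"
    unfolding rate_def sum_distrib_left by (simp add: prod.distrib exp_sum)
  finally have cardC: "real (card (code ` A)) \<le> \<dots>" .
  have "card F \<le> card (code ` A)" unfolding F_def by (rule card_image_le[OF finC])
  then have "real (card F) \<le> (\<Prod>j\<in>UNIV. 16 * K j) * exp (real n * rate l \<tau> (l i + \<tau>))"
    using cardC by linarith
  then show ?thesis
    unfolding \<rho>_def[symmetric] A_def[symmetric] r_exp[symmetric] K_def
    by (intro exI[of _ F] conjI) (use finC diam in \<open>auto simp: F_def\<close>)
qed

text \<open>Up to a constant, the number of covering sets times the \<open>s\<close>-th power of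
  their diameter is \<open>exp (- q) ^ n\<close>, and q > 0 says that \<open>s\<close> exceeds the
  quotient at \<open>i\<close>. One coordinate \<open>i\<close> suffices.\<close>

lemma hausdorff_measure_hit_limsup_eq_0:
  fixes B :: "'n::finite \<Rightarrow> real" and f :: "nat \<Rightarrow> 'n torus \<Rightarrow> 'n torus"
  assumes B: "\<And>i. 1 < B i"
    and lip: "\<And>n x y. 1 \<le> n \<Longrightarrow> dist (f n x) (f n y) \<le> c * dist x y" and c: "0 < c"
    and \<tau>: "0 \<le> \<tau>" and \<psi>: "eventually (\<lambda>n. \<psi> n \<le> exp (- (\<tau> * real n))) sequentially"
    and s: "rate (\<lambda>i. ln (B i)) \<tau> (ln (B i) + \<tau>) < s * (ln (B i) + \<tau>)"
  shows "hausdorff_measure s {x. infinite {n. 1 \<le> n \<and> x \<in> hit_set B (f n) (\<psi> n) n}} = 0"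
proof -
  define l where "l = (\<lambda>i. ln (B i))"
  have l: "0 < l i" for i using B[of i] by (simp add: l_def)
  define R where "R = rate l \<tau> (l i + \<tau>)"
  define q where "q = s * (l i + \<tau>) - R"
  have q: "0 < q" using s by (simp add: q_def R_def l_def)
  have "0 \<le> R" unfolding R_def rate_def using l \<tau> 
    by (intro sum_nonneg add_nonneg_nonneg) (auto simp: less_imp_le add_nonneg_nonneg)
  then have "0 < s * (l i + \<tau>)" using q by (simp add: q_def)
  moreover have li: "0 < l i + \<tau>" using l[of i] \<tau> by linarith
  ultimately have s0: "0 < s" by (simp add: zero_less_mult_iff)
  define b where "b = Min (range B)"
  have b: "1 < b" "\<And>i. b \<le> B i" unfolding b_def using B by (auto simp: Min_gr_iff)
  define K where "K = (\<Prod>j\<in>UNIV. 16 * (B j / (B j - 1) + 1))"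
  have "0 \<le> B j / (B j - 1)" for j using B[of j] by simp
  then have K: "0 \<le> K" unfolding K_def by (intro prod_nonneg ballI mult_nonneg_nonneg add_nonneg_nonneg) auto
  define N where "N n = K * exp (real n * R)" for n
  define \<delta> where "\<delta> n = 3 * real CARD('n) * exp (- (real n * (l i + \<tau>)))" for n
  have exp_pow: "exp (- (real n * z)) = exp (- z) ^ n" for n and z :: real
    by (simp add: exp_of_nat_mult[symmetric])
  show ?thesis
  proof (rule hausdorff_measure_limsup_eq_0[where E = "\<lambda>n. {x. 1 \<le> n \<and> x \<in> hit_set B (f n) (\<psi> n) n}" and N = N and \<delta> = \<delta>])
    show "0 < s" by (rule s0)
    obtain n0 where n0: "4 * c * real CARD('n) < b ^ n0" using real_arch_pow[OF b(1)] by blast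
    have cov: "\<exists>F. finite F \<and> real (card F) \<le> N n \<and> {x. 1 \<le> n \<and> x \<in> hit_set B (f n) (\<psi> n) n} \<subseteq> \<Union> F \<and>
      (\<forall>U\<in>F. \<forall>x\<in>U. \<forall>y\<in>U. dist x y \<le> \<delta> n)"
      if n: "n0 \<le> n" "1 \<le> n" "\<psi> n \<le> exp (- (\<tau> * real n))" for n
    proof -
      have "4 * c * real CARD('n) \<le> b ^ n" using n0 power_increasing[OF n(1), of b] b by linarith
      from hit_set_cover[of B b "f n" c n \<tau> i, OF B b lip[OF n(2)] c this \<tau>]
      obtain F where F: "finite F" "hit_set B (f n) (exp (- (\<tau> * real n))) n \<subseteq> \<Union> F"
        "real (card F) \<le> N n" "\<forall>U\<in>F. \<forall>x\<in>U. \<forall>y\<in>U. dist x y \<le> \<delta> n"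
        unfolding N_def K_def \<delta>_def R_def l_def by blast
      then show ?thesis using hit_set_mono[OF n(3), of B "f n" n] by (intro exI[of _ F]) auto
    qed
    show "eventually (\<lambda>n. \<exists>F. finite F \<and> real (card F) \<le> N n \<and> 
        {x. 1 \<le> n \<and> x \<in> hit_set B (f n) (\<psi> n) n} \<subseteq> \<Union> F \<and>
        (\<forall>U\<in>F. \<forall>x\<in>U. \<forall>y\<in>U. dist x y \<le> \<delta> n)) sequentially"
      using \<psi> eventually_ge_at_top[of n0] eventually_ge_at_top[of 1]
      by eventually_elim (rule cov)
    show "0 \<le> \<delta> n" for n by (simp add: \<delta>_def)
    show "\<delta> \<longlonglongrightarrow> 0"
    proof -
      have "(\<lambda>n. 3 * real CARD('n) * exp (- (l i + \<tau>)) ^ n) \<longlonglongrightarrow> 3 * real CARD('n) * 0"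
        using li by (intro tendsto_mult tendsto_const LIMSEQ_power_zero) auto
      then show ?thesis unfolding \<delta>_def exp_pow by simp
    qed
    have "N n * \<delta> n powr s = K * (3 * real CARD('n)) powr s * exp (- q) ^ n" for n
    proof -
      have "\<delta> n powr s = (3 * real CARD('n)) powr s * exp (- (real n * (l i + \<tau>))) powr s"
        unfolding \<delta>_def by (rule powr_mult)
      also have "exp (- (real n * (l i + \<tau>))) powr s = exp (- (real n * (s * (l i + \<tau>))))"
        by (simp add: powr_def algebra_simps)
      finally have "N n * \<delta> n powr s = K * (3 * real CARD('n)) powr s * (exp (real n * R) * exp (- (real n * (s * (l i + \<tau>)))))"
        by (simp add: N_def)
      also have "exp (real n * R) * exp (- (real n * (s * (l i + \<tau>)))) = exp (- (real n * q))"
        by (simp add: q_def exp_add[symmetric] algebra_simps)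
      finally show ?thesis unfolding exp_pow .
    qed
    then show "summable (\<lambda>n. N n * \<delta> n powr s)" using q by (simp add: summable_mult summable_geometric)
    show "0 \<le> N n" for n using K by (simp add: N_def)
  qed simp
qed

text \<open>The torus is itself a limsup set of hitting sets: with radius 1 every point hits at
  every time. The upper bound at \<tau> = 0 with all eigenvalues equal to 2 then applies to every
  \<open>s > CARD('n)\<close>.\<close>

lemma hausdorff_dim_torus_le: "hausdorff_dim (A :: 'n::finite torus set) \<le> ereal (real CARD('n))"
proof (rule hausdorff_dim_leI)
  fix s assume s: "real CARD('n) < s"
  define x0 :: "'n torus" where "x0 = undefined"
  have "circle_dist a b < 1" for a b
    using of_int_round_abs_le[of "a - b"] by (simp add: circle_dist_def abs_minus_commute)
  then have "x \<in> hit_set (\<lambda>_. 2) (\<lambda>_. x0) 1 n" for x n by (simp add: hit_set_def)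
  then have "{n. 1 \<le> n \<and> x \<in> hit_set (\<lambda>_. 2) (\<lambda>_. x0) 1 n} = {1..}" for x by auto
  then have eq: "{x. infinite {n. 1 \<le> n \<and> x \<in> hit_set (\<lambda>_. 2) (\<lambda>_. x0) 1 n}} = UNIV"
    by (simp add: infinite_Ici)
  have "hausdorff_measure s {x. infinite {n. 1 \<le> n \<and> x \<in> hit_set (\<lambda>_. 2) (\<lambda>_. x0) 1 n}} = 0"
  proof (rule hausdorff_measure_hit_limsup_eq_0[where \<tau> = 0 and c = 1])
    show "rate (\<lambda>i::'n. ln 2) 0 (ln 2 + 0) < s * (ln 2 + 0)"
      using rate_0[of "\<lambda>_::'n. ln 2" undefined] s by simp
  qed auto
  then have "hausdorff_measure s (UNIV :: 'n torus set) = 0" unfolding eq .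
  then show "hausdorff_measure s A = 0"
    using hausdorff_measure_mono[of A UNIV s] by simp
qed simp

section \<open>The dimension formula\<close>

text \<open>Both sides are the roots of the characteristic polynomial with multiplicity. Equality of
  multisets carries sums over coordinates to sums over the ordered list without choosing a
  permutation.\<close>

lemma eigenvalues_of_diagonal:
  fixes T :: "real ^ 'n ^ 'n"
  assumes diagonal: "\<And>i j. i \<noteq> j \<Longrightarrow> T $ i $ j = 0" and "eigenvalue_list T \<beta>"
  shows "image_mset (\<lambda>i. T $ i $ i) (mset_set UNIV) = image_mset \<beta> (mset_set {1..CARD('n)})"
proof -
  have "poly (\<Prod>i\<in>(UNIV::'n set). [:- (T $ i $ i), 1:]) t = poly (\<Prod>k\<in>{1..CARD('n)}. [:- \<beta> k, 1:]) t" for t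
  proof -
    have "det (mat t - T) = (\<Prod>i\<in>UNIV. (mat t - T) $ i $ i)"
      using diagonal by (intro det_diagonal) (simp add: mat_def)
    also have "\<dots> = (\<Prod>i\<in>UNIV. t - T $ i $ i)" by (simp add: mat_def)
    finally have "(\<Prod>i\<in>UNIV. t - T $ i $ i) = (\<Prod>k = 1..CARD('n). t - \<beta> k)"
      using assms(2) by (simp add: eigenvalue_list_def)
    then show ?thesis by (simp add: poly_prod)
  qed
  then have eq: "(\<Prod>i\<in>(UNIV::'n set). [:- (T $ i $ i), 1:]) = (\<Prod>k\<in>{1..CARD('n)}. [:- \<beta> k, 1:])"
    by (simp add: poly_eq_poly_eq_iff[symmetric] fun_eq_iff)
  have single: "(\<Sum>x\<in>A. {#h x#}) = image_mset h (mset_set A)" if "finite A" for A :: "'b set" and h :: "'b \<Rightarrow> real"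
    using that by (induction A rule: finite_induct) auto
  have "proots (\<Prod>i\<in>(UNIV::'n set). [:- (T $ i $ i), 1:]) = image_mset (\<lambda>i. T $ i $ i) (mset_set UNIV)"
    by (subst proots_prod) (simp_all add: single)
  moreover have "proots (\<Prod>k\<in>{1..CARD('n)}. [:- \<beta> k, 1:]) = image_mset \<beta> (mset_set {1..CARD('n)})"
    by (subst proots_prod) (simp_all add: single)
  ultimately show ?thesis using eq by simp
qed

lemma torus_rep_funpow_torus_map:
  fixes T :: "real ^ 'n ^ 'n"
  assumes "\<And>i j. i \<noteq> j \<Longrightarrow> T $ i $ j = 0"
  shows "torus_rep ((torus_map T ^^ n) x) $ i = (beta_map (T $ i $ i) ^^ n) (torus_rep x $ i)"
proof (induction n)
  case (Suc n)
  have "(T *v v) $ i = T $ i $ i * v $ i" for v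
  proof -
    have "(T *v v) $ i = (\<Sum>j\<in>UNIV. if j = i then T $ i $ i * v $ i else 0)"
      unfolding matrix_vector_mult_def vec_lambda_beta using assms by (intro sum.cong) auto
    then show ?thesis by simp
  qed
  then show ?case using Suc by (simp add: torus_rep_torus_map beta_map_def)
qed simp

lemma shrinking_target_set_eq:
  fixes T :: "real ^ 'n ^ 'n"
  assumes "\<And>i j. i \<noteq> j \<Longrightarrow> T $ i $ j = 0"
  shows "shrinking_target_set T \<psi> f =
    {x. infinite {n. 1 \<le> n \<and> x \<in> hit_set (\<lambda>i. T $ i $ i) (f n) (\<psi> n) n}}"
  by (simp add: shrinking_target_set_def hit_set_def target_def torus_rep_funpow_torus_map[OF assms])

text \<open>Large targets are available only for exponents above \<tau>, and the boxes cost a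
  further increase. By continuity of the rate, the inequality with a smaller s1 is strict in a right
  neighbourhood of \<tau>, where there is room for both.\<close>

lemma hausdorff_dim_hit_limsup_ge:
  fixes B :: "'n::finite \<Rightarrow> real" and f :: "nat \<Rightarrow> 'n torus \<Rightarrow> 'n torus"
  assumes B: "\<And>i. 1 < B i"
    and lip: "\<And>n x y. 1 \<le> n \<Longrightarrow> dist (f n x) (f n y) \<le> c * dist x y" and c: "0 < c"
    and \<tau>: "0 \<le> \<tau>"
    and inf: "\<And>\<tau>'. \<tau> < \<tau>' \<Longrightarrow> infinite {n. 1 \<le> n \<and> exp (- \<tau>' * real n) \<le> \<psi> n}"
    and a: "\<And>i. a * (ln (B i) + \<tau>) \<le> rate (\<lambda>i. ln (B i)) \<tau> (ln (B i) + \<tau>)"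
  shows "ereal a \<le> hausdorff_dim {x. infinite {n. 1 \<le> n \<and> x \<in> hit_set B (f n) (\<psi> n) n}}"
proof (rule hausdorff_dim_geI)
  fix s assume s: "0 \<le> s" "s < a"
  define l where "l = (\<lambda>i. ln (B i))"
  have l: "0 < l i" for i using B[of i] by (simp add: l_def)
  obtain s1 where s1: "s < s1" "s1 < a" using s dense by blast
  have ev: "eventually (\<lambda>u. s1 * (l i + u) < rate l u (l i + u)) (at_right \<tau>)" for i
  proof -
    have "((\<lambda>u. rate l u (l i + u) - s1 * (l i + u)) \<longlongrightarrow> rate l \<tau> (l i + \<tau>) - s1 * (l i + \<tau>)) (at_right \<tau>)"
      using continuous_rate[of l "l i"] unfolding continuous_on_def
      by (intro tendsto_intros) (auto intro: tendsto_within_subset)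
    moreover have "s1 * (l i + \<tau>) < a * (l i + \<tau>)" using s1 l[of i] \<tau> by (intro mult_strict_right_mono) auto
    then have "0 < rate l \<tau> (l i + \<tau>) - s1 * (l i + \<tau>)" using a[of i] by (simp add: l_def)
    ultimately have "eventually (\<lambda>u. 0 < rate l u (l i + u) - s1 * (l i + u)) (at_right \<tau>)"
      by (rule order_tendstoD)
    then show ?thesis by simp
  qed
  have "eventually (\<lambda>u. \<forall>i. s1 * (l i + u) < rate l u (l i + u)) (at_right \<tau>)"
    using ev by (simp add: eventually_all_finite)
  then obtain w where w: "\<tau> < w" "\<And>u i. \<tau> < u \<Longrightarrow> u < w \<Longrightarrow> s1 * (l i + u) < rate l u (l i + u)"
    unfolding eventually_at_right_field by blast
  define \<tau>1 where "\<tau>1 = (2 * \<tau> + w) / 3"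
  define \<tau>2 where "\<tau>2 = (\<tau> + 2 * w) / 3"
  have \<tau>12: "0 < \<tau>1" "\<tau> < \<tau>1" "\<tau>1 < \<tau>2" "\<tau>2 < w" using w(1) \<tau> by (auto simp: \<tau>1_def \<tau>2_def)
  obtain C S where CS: "0 < C" "infinite S"
    "\<And>n. n \<in> S \<Longrightarrow> 1 \<le> n \<and> (\<exists>h. (\<forall>i. C / (B i ^ n * exp (\<tau>2 * real n)) \<le> 1 / B i ^ h i) \<and>
      (\<forall>a. (\<forall>i. full (B i) (n - 1) (a i)) \<longrightarrow>
        (\<exists>e. (\<forall>i. full (B i) (h i) (e i) \<and> a i \<le> e i \<and> e i + 1 / B i ^ h i < a i + 1 / B i ^ (n - 1)) \<and>
          (\<forall>x. (\<forall>i. e i \<le> torus_rep x $ i \<and> torus_rep x $ i \<le> e i + 1 / B i ^ h i) \<longrightarrow>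
            x \<in> hit_set B (f n) (\<psi> n) n))))"
    using full_box_in_hit_set[where B = B and f = f, OF B lip c \<tau>12(1,3) inf[OF \<tau>12(2)]] by blast
  let ?E = "\<lambda>n. {x. 1 \<le> n \<and> x \<in> hit_set B (f n) (\<psi> n) n}"
  have "hausdorff_measure s {x. infinite {n. x \<in> ?E n}} \<noteq> 0"
  proof (rule hausdorff_measure_limsup_boxes_pos[OF B _ CS(1,2) _ s(1) s1(1)])
    show "0 \<le> \<tau>2" using \<tau>12 by simp
    show "s1 * (ln (B i) + \<tau>2) \<le> rate (\<lambda>i. ln (B i)) \<tau>2 (ln (B i) + \<tau>2)" for i
      using w(2)[of \<tau>2 i] \<tau>12 by (simp add: l_def)
    fix n assume "n \<in> S"
    from CS(3)[OF this] show "1 \<le> n \<and> (\<exists>h. (\<forall>i. C / (B i ^ n * exp (\<tau>2 * real n)) \<le> 1 / B i ^ h i) \<and>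
      (\<forall>a. (\<forall>i. full (B i) (n - 1) (a i)) \<longrightarrow>
        (\<exists>e. (\<forall>i. full (B i) (h i) (e i) \<and> a i \<le> e i \<and> e i + 1 / B i ^ h i < a i + 1 / B i ^ (n - 1)) \<and>
          (\<forall>x. (\<forall>i. e i \<le> torus_rep x $ i \<and> torus_rep x $ i \<le> e i + 1 / B i ^ h i) \<longrightarrow> x \<in> ?E n))))"
      by simp
  qed
  then show "hausdorff_measure s {x. infinite {n. 1 \<le> n \<and> x \<in> hit_set B (f n) (\<psi> n) n}} \<noteq> 0" by simp
qed

text \<open>Continuity carries the inequality at \<tau> to some u < \<tau>, where \<psi> is
  eventually small enough. As the covering needs u >= 0, this requires \<tau> > 0.\<close>

lemma hausdorff_dim_hit_limsup_le:
  fixes B :: "'n::finite \<Rightarrow> real" and f :: "nat \<Rightarrow> 'n torus \<Rightarrow> 'n torus"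
  assumes B: "\<And>i. 1 < B i"
    and lip: "\<And>n x y. 1 \<le> n \<Longrightarrow> dist (f n x) (f n y) \<le> c * dist x y" and c: "0 < c"
    and \<tau>: "0 < \<tau>"
    and ev: "\<And>\<tau>'. \<tau>' < \<tau> \<Longrightarrow> eventually (\<lambda>n. \<psi> n \<le> exp (- (\<tau>' * real n))) sequentially"
    and a: "0 \<le> a" "rate (\<lambda>i. ln (B i)) \<tau> (ln (B i) + \<tau>) \<le> a * (ln (B i) + \<tau>)"
  shows "hausdorff_dim {x. infinite {n. 1 \<le> n \<and> x \<in> hit_set B (f n) (\<psi> n) n}} \<le> ereal a"
proof (rule hausdorff_dim_leI[OF a(1)])
  fix s assume s: "a < s"
  define l where "l = (\<lambda>i. ln (B i))"
  have l: "0 < l i" for i using B[of i] by (simp add: l_def)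
  have "((\<lambda>u. s * (l i + u) - rate l u (l i + u)) \<longlongrightarrow> s * (l i + \<tau>) - rate l \<tau> (l i + \<tau>)) (at_left \<tau>)"
    using continuous_rate[of l "l i"] unfolding continuous_on_def
    by (intro tendsto_intros) (auto intro: tendsto_within_subset)
  moreover have "a * (l i + \<tau>) < s * (l i + \<tau>)" using s l[of i] \<tau> by (intro mult_strict_right_mono) auto
  then have "0 < s * (l i + \<tau>) - rate l \<tau> (l i + \<tau>)" using a(2) by (simp add: l_def)
  ultimately have "eventually (\<lambda>u. 0 < s * (l i + u) - rate l u (l i + u)) (at_left \<tau>)"
    by (rule order_tendstoD)
  then obtain w where w: "w < \<tau>" "\<And>u. w < u \<Longrightarrow> u < \<tau> \<Longrightarrow> 0 < s * (l i + u) - rate l u (l i + u)"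
    unfolding eventually_at_left_field by blast
  define u where "u = (max w 0 + \<tau>) / 2"
  have u: "w < u" "0 \<le> u" "u < \<tau>" using w(1) \<tau> by (auto simp: u_def)
  have "rate l u (l i + u) < s * (l i + u)" using w(2)[OF u(1,3)] by linarith
  then show "hausdorff_measure s {x. infinite {n. 1 \<le> n \<and> x \<in> hit_set B (f n) (\<psi> n) n}} = 0"
    unfolding l_def
    by (intro hausdorff_measure_hit_limsup_eq_0[OF B _ c u(2) ev[OF u(3)]] lip)
qed

lemma hausdorff_dim_hit_limsup_eq_0:
  fixes B :: "'n::finite \<Rightarrow> real" and f :: "nat \<Rightarrow> 'n torus \<Rightarrow> 'n torus"
  assumes B: "\<And>i. 1 < B i"
    and lip: "\<And>n x y. 1 \<le> n \<Longrightarrow> dist (f n x) (f n y) \<le> c * dist x y" and c: "0 < c"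
    and ev: "\<And>\<tau>'. eventually (\<lambda>n. \<psi> n \<le> exp (- (\<tau>' * real n))) sequentially"
  shows "hausdorff_dim {x. infinite {n. 1 \<le> n \<and> x \<in> hit_set B (f n) (\<psi> n) n}} = 0"
proof (rule antisym)
  define l where "l = (\<lambda>i. ln (B i))"
  have l: "0 < l i" for i using B[of i] by (simp add: l_def)
  show "hausdorff_dim {x. infinite {n. 1 \<le> n \<and> x \<in> hit_set B (f n) (\<psi> n) n}} \<le> 0"
    unfolding zero_ereal_def
  proof (rule hausdorff_dim_leI)
    fix s :: real assume s: "0 < s"
    define i :: 'n where "i = undefined"
    \<comment> \<open>The rate at l i + u is at most \<open>M\<close> for every u >= 0, so a large
      \<open>u\<close> makes the quotient smaller than any s > 0.\<close>
    define M where "M = (\<Sum>j\<in>UNIV. l j + l i)"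
    have M: "0 \<le> M" unfolding M_def using l by (intro sum_nonneg) (auto simp: less_imp_le add_nonneg_nonneg)
    define u where "u = M / s"
    have u: "0 \<le> u" "M = s * u" using M s by (auto simp: u_def)
    have "rate l u (l i + u) \<le> M"
      unfolding rate_def M_def using l by (intro sum_mono add_mono) (auto simp: less_imp_le)
    also have "\<dots> < s * (l i + u)" using u s l by (simp add: distrib_left)
    finally show "hausdorff_measure s {x. infinite {n. 1 \<le> n \<and> x \<in> hit_set B (f n) (\<psi> n) n}} = 0"
      by (intro hausdorff_measure_hit_limsup_eq_0[where B = B and f = f and i = i, OF B lip c u(1) ev]) (auto simp: l_def)
  qed simp
  show "0 \<le> hausdorff_dim {x. infinite {n. 1 \<le> n \<and> x \<in> hit_set B (f n) (\<psi> n) n}}"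
    unfolding zero_ereal_def by (rule hausdorff_dim_geI) simp
qed

lemma Min_divide_le_iff:
  fixes N D :: "'a \<Rightarrow> real"
  assumes "finite A" "A \<noteq> {}" "\<And>i. i \<in> A \<Longrightarrow> 0 < D i"
  shows "a \<le> (MIN i\<in>A. N i / D i) \<longleftrightarrow> (\<forall>i\<in>A. a * D i \<le> N i)"
  using assms by (auto simp: pos_le_divide_eq)

theorem corollary1p4:
  fixes T :: "real ^ 'n ^ 'n"
    and f :: "nat \<Rightarrow> 'n::finite torus \<Rightarrow> 'n torus"
    and \<psi> :: "nat \<Rightarrow> real"
    and \<beta> :: "nat \<Rightarrow> real"
    and c :: real and \<tau> :: ereal and d :: nat
  assumes d: "d = CARD('n)"
    and c: "c > 0"
    and lipschitz: "\<And>n x y. 1 \<le> n \<Longrightarrow> dist (f n x) (f n y) \<le> c * dist x y"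
    and nonsingular: "invertible T"
    and diagonal: "\<And>i j. i \<noteq> j \<Longrightarrow> T $ i $ j = 0"
    and eigenvalues: "eigenvalue_list T \<beta>"
    and beta_gt_1: "\<And>i. i \<in> {1..d} \<Longrightarrow> 1 < \<beta> i"
    and beta_mono: "mono_on {1..d} \<beta>"
    and psi_pos: "\<And>n. 1 \<le> n \<Longrightarrow> \<psi> n > 0"
    and tau: "\<tau> = liminf (\<lambda>n. ereal (- ln (\<psi> n) / real n))"
    and denominators_pos: "\<And>i. i \<in> {1..d} \<Longrightarrow> 0 < \<tau> + ereal (ln (\<beta> i))"
  shows "hausdorff_dim (shrinking_target_set T \<psi> f) =
    (if \<tau> = \<infinity> then 0
     else let t = real_of_ereal \<tau> in
       ereal (MIN i\<in>{1..d}.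
         (real i * ln (\<beta> i)
           - (\<Sum>j | j \<in> {1..d} \<and> \<beta> j > \<beta> i * exp t. ln (\<beta> j) - ln (\<beta> i) - t)
           + (\<Sum>j\<in>{i<..d}. ln (\<beta> j)))
         / (t + ln (\<beta> i))))"
proof -
  define B where "B i = T $ i $ i" for i
  have d1: "1 \<in> {1..d}" using d by (simp add: Suc_leI)
  have mset: "image_mset B (mset_set UNIV) = image_mset \<beta> (mset_set {1..d})"
    using eigenvalues_of_diagonal[OF diagonal eigenvalues] by (simp add: d B_def[abs_def])
  have range: "range B = \<beta> ` {1..d}" using arg_cong[OF mset, of set_mset] by simp
  \<comment> \<open>The rate is symmetric in the coordinates, so the equality of multisets is all
    that is needed to evaluate it on the ordered eigenvalues.\<close>
  have sumB: "(\<Sum>i\<in>UNIV. g (B i)) = (\<Sum>k\<in>{1..d}. g (\<beta> k))" for g :: "real \<Rightarrow> real"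
    using arg_cong[OF mset, of "\<lambda>M. sum_mset (image_mset g M)"]
    by (simp add: sum_unfold_sum_mset image_mset.compositionality o_def)
  have B: "1 < B i" for i
  proof -
    have "B i \<in> \<beta> ` {1..d}" using range by blast
    then show ?thesis using beta_gt_1 by auto
  qed
  define W where "W = {x. infinite {n. 1 \<le> n \<and> x \<in> hit_set B (f n) (\<psi> n) n}}"
  have W: "shrinking_target_set T \<psi> f = W"
    unfolding W_def B_def[abs_def] by (rule shrinking_target_set_eq[OF diagonal])
  have ev: "eventually (\<lambda>n. \<psi> n \<le> exp (- (u * real n))) sequentially" if "ereal u < \<tau>" for u
  proof -
    have "eventually (\<lambda>n. ereal u < ereal (- ln (\<psi> n) / real n)) sequentially"
      using that unfolding tau by (rule less_LiminfD)
    then show ?thesis using eventually_ge_at_top[of 1]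
    proof eventually_elim
      case (elim n)
      then have "u < - ln (\<psi> n) / real n" "0 < real n" by auto
      then have "u * real n < - ln (\<psi> n)" by (simp only: pos_less_divide_eq)
      then have "ln (\<psi> n) \<le> - (u * real n)" by simp
      then have "exp (ln (\<psi> n)) \<le> exp (- (u * real n))" by simp
      then show ?case using psi_pos[OF elim(2)] by simp
    qed
  qed
  have inf: "infinite {n. 1 \<le> n \<and> exp (- u * real n) \<le> \<psi> n}" if u: "\<tau> < ereal u" for u
  proof
    assume "finite {n. 1 \<le> n \<and> exp (- u * real n) \<le> \<psi> n}"
    then obtain m where m: "\<And>n. n \<in> {n. 1 \<le> n \<and> exp (- u * real n) \<le> \<psi> n} \<Longrightarrow> n \<le> m"
      using finite_nat_set_iff_bounded_le by auto
    have "ereal u \<le> ereal (- ln (\<psi> n) / real n)" if n: "n \<ge> Suc m" for n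
    proof -
      have n1: "1 \<le> n" "0 < real n" using n by auto
      have "\<not> exp (- u * real n) \<le> \<psi> n" using m[of n] n by auto
      then have "\<psi> n < exp (- u * real n)" by simp
      then have "ln (\<psi> n) < ln (exp (- u * real n))" using psi_pos[OF n1(1)] by (subst ln_less_cancel_iff) auto
      then have "u * real n \<le> - ln (\<psi> n)" by simp
      then show ?thesis using n1(2) by (simp only: ereal_less_eq pos_le_divide_eq)
    qed
    then have "eventually (\<lambda>n. ereal u \<le> ereal (- ln (\<psi> n) / real n)) sequentially"
      using eventually_sequentially by blast
    then have "ereal u \<le> \<tau>" unfolding tau by (rule Liminf_bounded)
    then show False using u by simp
  qed
  show ?thesis
  proof (cases \<tau>)
    case PInf
    have "hausdorff_dim W = 0"
      unfolding W_def by (rule hausdorff_dim_hit_limsup_eq_0[where B = B and f = f, OF B lipschitz c ev]) (simp_all add: PInf)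
    then show ?thesis using PInf W by simp
  next
    \<comment> \<open>Excluded, as the denominators would be negative.\<close>
    case MInf
    then show ?thesis using denominators_pos[OF d1] by simp
  next
    case (real t)
    define b where "b k = ln (\<beta> k)" for k
    have b: "0 < b k" "0 < t + b k" if "k \<in> {1..d}" for k
      using beta_gt_1[OF that] denominators_pos[OF that] by (simp_all add: b_def real)
    have b_mono: "b j \<le> b k" if "j \<in> {1..d}" "k \<in> {1..d}" "j \<le> k" for j k
      using mono_onD[OF beta_mono that] beta_gt_1[OF that(1)] beta_gt_1[OF that(2)] by (simp add: b_def)
    define num where "num i = real i * ln (\<beta> i)
           - (\<Sum>j | j \<in> {1..d} \<and> \<beta> j > \<beta> i * exp t. ln (\<beta> j) - ln (\<beta> i) - t)
           + (\<Sum>j\<in>{i<..d}. ln (\<beta> j))" for i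
    \<comment> \<open>The numerator distributed over \<open>j\<close>, with
      \<open>i * ln (\<beta> i)\<close> giving \<open>b i\<close> to each \<open>j \<le> i\<close>.
      For t >= 0 and ordered eigenvalues these are the terms of the rate at b i + t; the splitting
      itself also serves t < 0.\<close>
    define summand where "summand i j = (if j \<le> i then b i else b j) - (if b i + t < b j then b j - b i - t else 0)" for i j
    have num: "num i = (\<Sum>j\<in>{1..d}. summand i j)" if i: "i \<in> {1..d}" for i
    proof -
      have "\<beta> i * exp t < \<beta> j \<longleftrightarrow> b i + t < b j" if "j \<in> {1..d}" for j
      proof -
        have "\<beta> i = exp (b i)" "\<beta> j = exp (b j)" using beta_gt_1[OF i] beta_gt_1[OF that] by (auto simp: b_def)
        then show ?thesis by (simp add: exp_add[symmetric])
      qed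
      then have "{j. j \<in> {1..d} \<and> \<beta> j > \<beta> i * exp t} = {j \<in> {1..d}. b i + t < b j}" by auto
      then have 1: "(\<Sum>j | j \<in> {1..d} \<and> \<beta> j > \<beta> i * exp t. ln (\<beta> j) - ln (\<beta> i) - t) =
        (\<Sum>j\<in>{1..d}. if b i + t < b j then b j - b i - t else 0)"
        unfolding b_def[symmetric] by (simp only: sum.inter_filter[OF finite_atLeastAtMost])
      have un: "{1..d} = {1..i} \<union> {i<..d}" using i by auto
      have "(\<Sum>j\<in>{1..d}. if j \<le> i then b i else b j) =
        (\<Sum>j\<in>{1..i}. if j \<le> i then b i else b j) + (\<Sum>j\<in>{i<..d}. if j \<le> i then b i else b j)"
        unfolding un by (rule sum.union_disjoint) auto
      also have "\<dots> = real i * b i + (\<Sum>j\<in>{i<..d}. b j)" by simp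
      finally show ?thesis unfolding num_def 1 summand_def by (simp add: sum_subtractf b_def)
    qed
    define m where "m = (MIN i\<in>{1..d}. num i / (t + b i))"
    have ne: "{1..d} \<noteq> {}" using d1 by blast
    have le_m: "a \<le> m \<longleftrightarrow> (\<forall>i\<in>{1..d}. a * (t + b i) \<le> num i)" for a
      unfolding m_def by (rule Min_divide_le_iff) (use ne b in auto)
    have "m \<in> (\<lambda>i. num i / (t + b i)) ` {1..d}"
      unfolding m_def by (rule Min_in) (use ne in auto)
    then obtain i0 where i0: "i0 \<in> {1..d}" "m = num i0 / (t + b i0)" by blast
    have "hausdorff_dim W = ereal m"
    proof (cases "0 \<le> t")
      case True
      have rate: "rate (\<lambda>i. ln (B i)) t (b k + t) = num k" if k: "k \<in> {1..d}" for k
      proof -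
        have "rate (\<lambda>i. ln (B i)) t (b k + t) = (\<Sum>j\<in>{1..d}. min (b j) (b k + t) + max 0 (b k + t - b j - t))"
          unfolding rate_def b_def by (rule sumB)
        also have "\<dots> = (\<Sum>j\<in>{1..d}. summand k j)"
        proof (rule sum.cong[OF refl])
          fix j assume j: "j \<in> {1..d}"
          show "min (b j) (b k + t) + max 0 (b k + t - b j - t) = summand k j"
            using b_mono[OF j k] b_mono[OF k j] True by (cases "j \<le> k") (auto simp: summand_def min_def max_def)
        qed
        finally show ?thesis using num[OF k] by simp
      qed
      have index: "\<exists>k\<in>{1..d}. ln (B i) = b k" for i
      proof -
        have "B i \<in> \<beta> ` {1..d}" using range by blast
        then show ?thesis by (auto simp: b_def)
      qed
      have lower: "ereal m \<le> hausdorff_dim W"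
        unfolding W_def
      proof (rule hausdorff_dim_hit_limsup_ge[where B = B and f = f, OF B lipschitz c True])
        show "infinite {n. 1 \<le> n \<and> exp (- u * real n) \<le> \<psi> n}" if "t < u" for u
          using inf[of u] that real by simp
        fix i
        obtain k where k: "k \<in> {1..d}" "ln (B i) = b k" using index by blast
        have "m * (t + b k) \<le> num k" using le_m[of m] k(1) by simp
        then show "m * (ln (B i) + t) \<le> rate (\<lambda>i. ln (B i)) t (ln (B i) + t)"
          unfolding k(2) rate[OF k(1)] by (simp add: add.commute)
      qed
      have upper: "hausdorff_dim W \<le> ereal m"
      \<comment> \<open>At t = 0 no smaller non-negative exponent is left for the covering, but all
        quotients are then \<open>d\<close>, the trivial upper bound.\<close>
      proof (cases "t = 0")
        case True
        have "summand i j = b i" if "i \<in> {1..d}" "j \<in> {1..d}" for i j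
          using b_mono[OF that] b_mono[OF that(2,1)] True by (cases "j \<le> i") (auto simp: summand_def)
        then have "real d * (t + b i) \<le> num i" if "i \<in> {1..d}" for i
          using num[OF that] that True by simp
        then have "real d \<le> m" unfolding le_m by blast
        then have "ereal (real d) \<le> ereal m" by simp
        then show ?thesis using hausdorff_dim_torus_le[of W] order_trans unfolding d by blast
      next
        case False
        then have t: "0 < t" using True by simp
        obtain i where i: "B i = \<beta> i0" using range i0(1) by (metis image_iff imageI)
        have li: "ln (B i) = b i0" by (simp add: i b_def)
        have "num i0 = m * (b i0 + t)" using i0(2) b(2)[OF i0(1)] by (simp add: add.commute)
        then have eq: "rate (\<lambda>i. ln (B i)) t (ln (B i) + t) \<le> m * (ln (B i) + t)"
          unfolding li rate[OF i0(1)] by simp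
        have "0 \<le> num k" if "k \<in> {1..d}" for k
        proof -
          have "0 \<le> rate (\<lambda>i. ln (B i)) t (b k + t)" unfolding rate_def
            using B b[OF that] t by (intro sum_nonneg add_nonneg_nonneg) (auto simp: less_imp_le)
          then show ?thesis using rate[OF that] by simp
        qed
        then have m0: "0 \<le> m" unfolding le_m by simp
        show ?thesis unfolding W_def
          by (rule hausdorff_dim_hit_limsup_le[where B = B and f = f, OF B lipschitz c t ev m0 eq]) (auto simp: real)
      qed
      show ?thesis using lower upper by (rule antisym[rotated])
    next
      case False
      \<comment> \<open>Every summand is at least t + b i, so no quotient is below \<open>d\<close>.
        For i = 1, the smallest eigenvalue, all summands equal t + b 1 and \<open>d\<close> is
        attained.\<close>
      have "real d * (t + b i) \<le> num i" if i: "i \<in> {1..d}" for i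
      proof -
        have "t + b i \<le> summand i j" if j: "j \<in> {1..d}" for j
          using b_mono[OF i j] b_mono[OF j i] False by (cases "j \<le> i") (auto simp: summand_def)
        then have "(\<Sum>j\<in>{1..d}. t + b i) \<le> (\<Sum>j\<in>{1..d}. summand i j)" by (intro sum_mono)
        then show ?thesis using num[OF i] by simp
      qed
      then have "real d \<le> m" unfolding le_m by blast
      moreover have "m \<le> real d"
      proof -
        have "summand 1 j = t + b 1" if j: "j \<in> {1..d}" for j
          using b_mono[OF d1 j] False j by (cases "j = 1") (auto simp: summand_def)
        then have "num 1 = real d * (t + b 1)" using num[OF d1] by simp
        moreover have "m * (t + b 1) \<le> num 1" using le_m[of m] d1 by blast
        ultimately show ?thesis using b(2)[OF d1] by simp
      qed
      ultimately have m: "m = real d" by simp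
      have "ereal (real d) \<le> hausdorff_dim W"
        unfolding W_def
      \<comment> \<open>For t < 0 the bound exp (- u n) <= \<psi> n holds infinitely often for every
        u > 0, so the lower bound applies with exponent 0.\<close>
      proof (rule hausdorff_dim_hit_limsup_ge[where B = B and f = f, OF B lipschitz c order_refl])
        show "infinite {n. 1 \<le> n \<and> exp (- u * real n) \<le> \<psi> n}" if "0 < u" for u
          using inf[of u] that real False by simp
        show "real d * (ln (B i) + 0) \<le> rate (\<lambda>i. ln (B i)) 0 (ln (B i) + 0)" for i
          using rate_0[of "\<lambda>i. ln (B i)" i] B[of i] by (simp add: d)
      qed
      then show ?thesis using hausdorff_dim_torus_le[of W] unfolding m d by (rule antisym[rotated])
    qed
    then show ?thesis unfolding W m_def num_def b_def by (simp add: real Let_def)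
  qed
qed

end
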